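(* Let the standing assumptions (see context) hold with $H\in(\tfrac12,1)$ and $\beta\in(1-2H,1]$. For $M\in\mathbb N$ let $\tau=T/M$, $t_m=m\tau$, and define the fully discrete approximation $\bar X^N_0=P_N\xi$ and $$\bar X^N_{m+1}=R(\tau A_N)\bar X^N_m+\tau R(\tau A_N)P_NF(\bar X^N_m)+R(\tau A_N)P_N\Phi\,\Delta W^H_m,\quad m=0,\dots,M-1,$$ with $R(z)=(1+z)^{-1}$ and $\Delta W^H_m=W^H(t_{m+1})-W^H(t_m)$. Let $X^N$ be the spectral Galerkin mild solution. Then there is a constant $C$ independent of $N$, $M$ and $m$ such that for all $m=0,\dots,M$, $$\|X^N(t_m)-\bar X^N_m\|_{L^2(\Omega;V)}\le C\big(1+\|\xi\|_{L^2(\Omega;V_{2H+\beta-1})}\big)\tau^{\frac{2H+\beta-1}{2}} .$$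
   Context: Standing setting. $(V,\langle\cdot,\cdot\rangle,\|\cdot\|)$ is a real separable Hilbert space, $\mathcal L_2$ the Hilbert–Schmidt operators on $V$. $A$ is a linear, densely defined, positive self-adjoint unbounded operator with compact inverse, orthonormal eigenbasis $(e_i)$, $Ae_i=\lambda_ie_i$, $0<\lambda_1\le\lambda_2\le\dots\to\infty$; $E(t)=e^{-tA}$; $V_\gamma=\mathrm{dom}(A^{\gamma/2})$ with norm $\|A^{\gamma/2}\cdot\|$. $F:V\to V$ satisfies $\|F(u)\|\le L(\|u\|+1)$, $\|F(u)-F(v)\|\le L\|u-v\|$. $W^H(t)=\sum_n w^H_n(t)e_n$ is a cylindrical fBm with independent scalar standard fBms of Hurst index $H\in(\tfrac12,1)$ on a filtered probability space. $\Phi$ is a deterministic linear operator on $V$ with $\|A^{\frac{\beta-1}{2}}\Phi\|_{\mathcal L_2}<\infty$. $\xi$ is $\mathcal F_0$-measurable with $\xi\in L^2(\Omega;V_{2H+\beta-1})$. $P_N$ is the orthogonal projection onto $\mathrm{span}\{e_1,\dots,e_N\}$, $A_N=AP_N$, $E_N(t)=e^{-tA_N}$. The spectral Galerkin mild solution is $X^N(t)=E_N(t)P_N\xi+\int_0^tE_N(t-s)P_NF(X^N(s))\,\mathrm ds+\int_0^tE_N(t-s)P_N\Phi\,\mathrm dW^H(s)$, $t\in[0,T]$. *)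

theory Defs
  imports "HOL-Probability.Probability"
begin

text \<open>The operator A is represented by its orthonormal eigenbasis e (indexed from 0)
  and its eigenvalues lam: A e_i = lam_i e_i.\<close>

definition projN :: "(nat \<Rightarrow> 'a::real_inner) \<Rightarrow> nat \<Rightarrow> 'a \<Rightarrow> 'a" where
  "projN e N x = (\<Sum>i<N. (x \<bullet> e i) *\<^sub>R e i)"

text \<open>E_N(t) = exp(-t A_N), A_N = A P_N (acts as identity on the complement of span e_0..e_(N-1)).\<close>
definition semigroupN :: "(nat \<Rightarrow> 'a::real_inner) \<Rightarrow> (nat \<Rightarrow> real) \<Rightarrow> nat \<Rightarrow> real \<Rightarrow> 'a \<Rightarrow> 'a" where
  "semigroupN e lam N t x = (\<Sum>i<N. (exp (- t * lam i) * (x \<bullet> e i)) *\<^sub>R e i) + (x - projN e N x)"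

definition resolvN :: "(nat \<Rightarrow> 'a::real_inner) \<Rightarrow> (nat \<Rightarrow> real) \<Rightarrow> nat \<Rightarrow> real \<Rightarrow> 'a \<Rightarrow> 'a" where
  "resolvN e lam N \<tau> x = (\<Sum>i<N. ((x \<bullet> e i) / (1 + \<tau> * lam i)) *\<^sub>R e i) + (x - projN e N x)"

text \<open>Squared norm of A^(gamma/2) x, i.e. squared V_gamma norm (infinite if x is not in V_gamma).\<close>
definition Vnorm2 :: "(nat \<Rightarrow> 'a::real_inner) \<Rightarrow> (nat \<Rightarrow> real) \<Rightarrow> real \<Rightarrow> 'a \<Rightarrow> ennreal" where
  "Vnorm2 e lam \<gamma> x = (\<Sum>i. ennreal (lam i powr \<gamma> * (x \<bullet> e i)\<^sup>2))"

definition fbm_cov :: "real \<Rightarrow> real \<Rightarrow> real \<Rightarrow> real" where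
  "fbm_cov H s t = (s powr (2*H) + t powr (2*H) - \<bar>t - s\<bar> powr (2*H)) / 2"

definition normal_rv :: "'b measure \<Rightarrow> ('b \<Rightarrow> real) \<Rightarrow> real \<Rightarrow> real \<Rightarrow> bool" where
  "normal_rv M X \<mu> v \<longleftrightarrow> X \<in> borel_measurable M \<and>
     (if v = 0 then (AE \<omega> in M. X \<omega> = \<mu>) else distributed M lborel X (normal_density \<mu> (sqrt v)))"

definition is_fbm :: "'b measure \<Rightarrow> real \<Rightarrow> (real \<Rightarrow> 'b \<Rightarrow> real) \<Rightarrow> bool" where
  "is_fbm M H w \<longleftrightarrow>
     (\<forall>(I::nat set) (c::nat \<Rightarrow> real) (t::nat \<Rightarrow> real). finite I \<longrightarrow> (\<forall>k\<in>I. 0 \<le> t k) \<longrightarrow>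
        normal_rv M (\<lambda>\<omega>. \<Sum>k\<in>I. c k * w (t k) \<omega>) 0
          (\<Sum>j\<in>I. \<Sum>k\<in>I. c j * c k * fbm_cov H (t j) (t k)))
   \<and> (AE \<omega> in M. continuous_on {0..} (\<lambda>t. w t \<omega>))"

text \<open>Pathwise (Riemann--Stieltjes) Wiener integral  int_0^t exp(-l (t-s)) dw(s),
  written via integration by parts (integrand is C^1, w continuous).\<close>
definition wiener_exp :: "real \<Rightarrow> real \<Rightarrow> (real \<Rightarrow> 'b \<Rightarrow> real) \<Rightarrow> 'b \<Rightarrow> real" where
  "wiener_exp l t w \<omega> = w t \<omega> - exp (- l * t) * w 0 \<omega>
      - l * integral {0..t} (\<lambda>s. exp (- l * (t - s)) * w s \<omega>)"

text \<open>Stochastic convolution int_0^t E_N(t-s) P_N Phi dW^H(s), W^H = sum_n w_n e_n.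
  Its e_i-component (i < N) is sum_n <Phi e_n, e_i> int_0^t exp(-lam_i (t-s)) dw_n(s).\<close>
definition stoch_convN :: "(nat \<Rightarrow> 'a::real_inner) \<Rightarrow> (nat \<Rightarrow> real) \<Rightarrow> ('a \<Rightarrow> 'a)
    \<Rightarrow> (nat \<Rightarrow> real \<Rightarrow> 'b \<Rightarrow> real) \<Rightarrow> nat \<Rightarrow> real \<Rightarrow> 'b \<Rightarrow> 'a" where
  "stoch_convN e lam \<Phi> w N t \<omega> =
     (\<Sum>i<N. (\<Sum>n. (\<Phi> (e n) \<bullet> e i) * wiener_exp (lam i) t (w n) \<omega>) *\<^sub>R e i)"

text \<open>R(tau A_N) P_N Phi (W^H(b) - W^H(a)).\<close>
definition noise_incrN :: "(nat \<Rightarrow> 'a::real_inner) \<Rightarrow> (nat \<Rightarrow> real) \<Rightarrow> ('a \<Rightarrow> 'a)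
    \<Rightarrow> (nat \<Rightarrow> real \<Rightarrow> 'b \<Rightarrow> real) \<Rightarrow> nat \<Rightarrow> real \<Rightarrow> real \<Rightarrow> real \<Rightarrow> 'b \<Rightarrow> 'a" where
  "noise_incrN e lam \<Phi> w N \<tau> a b \<omega> =
     (\<Sum>i<N. ((\<Sum>n. (\<Phi> (e n) \<bullet> e i) * (w n b \<omega> - w n a \<omega>)) / (1 + \<tau> * lam i)) *\<^sub>R e i)"

definition galerkin_mild :: "'b measure \<Rightarrow> (nat \<Rightarrow> 'a::{real_inner,complete_space}) \<Rightarrow> (nat \<Rightarrow> real)
    \<Rightarrow> ('a \<Rightarrow> 'a) \<Rightarrow> ('a \<Rightarrow> 'a) \<Rightarrow> (nat \<Rightarrow> real \<Rightarrow> 'b \<Rightarrow> real) \<Rightarrow> ('b \<Rightarrow> 'a) \<Rightarrow> real \<Rightarrow> nat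
    \<Rightarrow> (real \<Rightarrow> 'b \<Rightarrow> 'a) \<Rightarrow> bool" where
  "galerkin_mild M e lam F \<Phi> w \<xi> T N X \<longleftrightarrow>
     (\<lambda>p. X (fst p) (snd p)) \<in> borel_measurable (lborel \<Otimes>\<^sub>M M) \<and>
     (\<forall>t\<in>{0..T}. AE \<omega> in M.
        ((\<lambda>s. semigroupN e lam N (t - s) (projN e N (F (X s \<omega>)))) has_integral
           (X t \<omega> - semigroupN e lam N t (projN e N (\<xi> \<omega>)) - stoch_convN e lam \<Phi> w N t \<omega>)) {0..t})"

fun scheme :: "(nat \<Rightarrow> 'a::real_inner) \<Rightarrow> (nat \<Rightarrow> real) \<Rightarrow> ('a \<Rightarrow> 'a) \<Rightarrow> ('a \<Rightarrow> 'a)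
    \<Rightarrow> (nat \<Rightarrow> real \<Rightarrow> 'b \<Rightarrow> real) \<Rightarrow> ('b \<Rightarrow> 'a) \<Rightarrow> real \<Rightarrow> nat \<Rightarrow> nat \<Rightarrow> nat \<Rightarrow> 'b \<Rightarrow> 'a" where
  "scheme e lam F \<Phi> w \<xi> T Mt N 0 \<omega> = projN e N (\<xi> \<omega>)"
| "scheme e lam F \<Phi> w \<xi> T Mt N (Suc m) \<omega> =
     (let \<tau> = T / real Mt; Y = scheme e lam F \<Phi> w \<xi> T Mt N m \<omega> in
       resolvN e lam N \<tau> Y + \<tau> *\<^sub>R resolvN e lam N \<tau> (projN e N (F Y))
       + noise_incrN e lam \<Phi> w N \<tau> (real m * \<tau>) (real (Suc m) * \<tau>) \<omega>)"

end

(* Everything is done in eigencoordinates. For H > 1/2 the increments of fBm over disjoint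
   intervals are positively correlated, so the second moment of a sum  sum_l g_l (w(s_{l+1}) - w(s_l))
   is monotone in |g|; hence every Wiener integral needed (the convolution, its time increments and
   the difference to the discrete convolution) is dominated by one with an exponential weight, and
   that one is estimated by Abel summation. Since the noise is an infinite series, almost sure
   convergence comes from Kolmogorov's maximal inequality, the L2 bound from Fatou's lemma.
   With tau lam = z the coordinatewise noise error is at most C lam^(-2H) min(1, z)^2, which is
   bounded by C tau^(2H+beta-1) lam^(beta-1) and summable by the Hilbert-Schmidt assumption.
   The mild equation gives no integrability of the solution for free: pathwise continuity of the
   drift integral yields localising events on which Gronwall's argument applies. The drift error
   is handled by the kernel bound |exp(-z x) - (1+z)^(-j)| <= C x^(-rho), Hoelder continuity of
   order rho = (2H+beta-1)/2 of the solution, and the discrete Gronwall inequality. *)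

theory Submission
  imports Defs
begin

section \<open>Second moments of weighted fBm increments\<close>

text \<open>The mild equation is known at each time only outside a null set that may depend on the
  time, and only as a gauge integral. Hence second moments are taken in \<open>ennreal\<close>,
  drift integrals are dominated without assuming absolute integrability, and paths are compared on a
  countable dense set of times. Likewise \<open>is_fbm\<close> gives laws of finite linear
  combinations and almost sure continuity, so every Wiener functional is reached as a limit of
  finite increment sums, with bounds that do not depend on the mesh. Constants stay independent of
  \<open>N\<close> because an eigenvalue enters through \<open>lam i powr (2*\<rho>)\<close> paired
  with the initial value, through \<open>lam i powr (\<beta> - 1)\<close> paired with the noise, or
  not at all: drift kernels are bounded uniformly in the eigenvalue, so that the Lipschitz property
  of \<open>F\<close> can be applied to the whole vector. The price is a singularity of order
  \<open>\<rho>\<close>, integrable since \<open>\<rho> \<le> H < 1\<close> but possibly not square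
  integrable; therefore Cauchy-Schwarz is used with the kernel itself as weight.\<close>

lemma (in prob_space) normal_rv_moments:
  assumes "normal_rv M X 0 v"
  shows "X \<in> borel_measurable M" "integrable M X" "expectation X = 0"
    "integrable M (\<lambda>\<omega>. (X \<omega>)\<^sup>2)" "expectation (\<lambda>\<omega>. (X \<omega>)\<^sup>2) = \<bar>v\<bar>"
proof -
  have X [measurable]: "X \<in> borel_measurable M"
    using assms by (simp add: normal_rv_def)
  then show "X \<in> borel_measurable M" .
  have "integrable M X \<and> expectation X = 0 \<and> integrable M (\<lambda>\<omega>. (X \<omega>)\<^sup>2) \<and>
      expectation (\<lambda>\<omega>. (X \<omega>)\<^sup>2) = \<bar>v\<bar>"
  proof (cases "v = 0")
    case True
    then have ae: "AE \<omega> in M. X \<omega> = 0"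
      using assms by (simp add: normal_rv_def)
    have ae2: "AE \<omega> in M. (X \<omega>)\<^sup>2 = 0" using ae by auto
    have "integrable M X" "integrable M (\<lambda>\<omega>. (X \<omega>)\<^sup>2)"
      using integrable_cong_AE[THEN iffD2, OF X _ ae] integrable_cong_AE[THEN iffD2, OF _ _ ae2] by auto
    then show ?thesis
      using integral_cong_AE[OF X _ ae] integral_cong_AE[OF _ _ ae2] True by auto
  next
    case False
    \<comment> \<open>The real square root is odd, so \<open>sqrt v\<close> is negative for negative
      \<open>v\<close>; the density depends on its square only.\<close>
    define \<sigma> where "\<sigma> = sqrt \<bar>v\<bar>"
    have \<sigma>: "\<sigma> > 0" "\<sigma>\<^sup>2 = \<bar>v\<bar>" using False by (auto simp: \<sigma>_def)
    have "(sqrt v)\<^sup>2 = \<sigma>\<^sup>2"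
      by (cases "v \<ge> 0") (auto simp: \<sigma>_def real_sqrt_minus)
    then have "normal_density 0 (sqrt v) = normal_density 0 \<sigma>"
      by (simp add: normal_density_def fun_eq_iff)
    then have D: "distributed M lborel X (normal_density 0 \<sigma>)"
      using assms False by (simp add: normal_rv_def)
    have 1: "integrable M X"
      using distributed_integrable[OF D, of "\<lambda>x. x"] integrable_normal_moment_nz_1[OF \<sigma>(1), of 0] by simp
    have 2: "integrable M (\<lambda>\<omega>. (X \<omega>)\<^sup>2)"
      using distributed_integrable[OF D, of "\<lambda>x. x\<^sup>2"] integrable_normal_moment[OF \<sigma>(1), of 0 2] by simp
    have 3: "expectation X = 0" by (rule normal_distributed_expectation[OF \<sigma>(1) D])
    then have "expectation (\<lambda>\<omega>. (X \<omega>)\<^sup>2) = \<bar>v\<bar>"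
      using normal_distributed_variance[OF \<sigma>(1) D] \<sigma>(2) by simp
    with 1 2 3 show ?thesis by blast
  qed
  then show "integrable M X" "expectation X = 0" "integrable M (\<lambda>\<omega>. (X \<omega>)\<^sup>2)"
      "expectation (\<lambda>\<omega>. (X \<omega>)\<^sup>2) = \<bar>v\<bar>" by auto
qed

text \<open>The covariance of \<open>w b - w a\<close> and \<open>w d - w c\<close>, expanded by
  bilinearity.\<close>

definition fbm_incr_cov :: "real \<Rightarrow> real \<Rightarrow> real \<Rightarrow> real \<Rightarrow> real \<Rightarrow> real" where
  "fbm_incr_cov H a b c d = fbm_cov H b d - fbm_cov H b c - fbm_cov H a d + fbm_cov H a c"

lemma sum_pairs_lessThan:
  fixes f :: "nat \<Rightarrow> 'a::comm_monoid_add"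
  shows "(\<Sum>k<2*n. f k) = (\<Sum>k<n. f (2*k) + f (2*k+1))"
proof (induction n)
  case (Suc n)
  have "2 * Suc n = Suc (Suc (2*n))" by simp
  then show ?case using Suc by (simp add: add.assoc)
qed simp

text \<open>The absolute value on the right is needed because positive semidefiniteness of the covariance
  kernel is not known at this point: for a negative \<open>v\<close> the predicate \<^const>\<open>normal_rv\<close> describes
  a normal variable of variance \<open>-v\<close>.\<close>

lemma (in prob_space) fbm_incr_sum_moments:
  fixes g a b :: "nat \<Rightarrow> real" and n :: nat
  assumes fbm: "is_fbm M H w" and nn: "\<And>k. k < n \<Longrightarrow> 0 \<le> a k" "\<And>k. k < n \<Longrightarrow> 0 \<le> b k"
  defines "D \<equiv> \<lambda>\<omega>. \<Sum>k<n. g k * (w (b k) \<omega> - w (a k) \<omega>)"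
  shows "D \<in> borel_measurable M" "integrable M D" "expectation D = 0"
    "integrable M (\<lambda>\<omega>. (D \<omega>)\<^sup>2)"
    "expectation (\<lambda>\<omega>. (D \<omega>)\<^sup>2) =
      \<bar>\<Sum>j<n. \<Sum>k<n. g j * g k * fbm_incr_cov H (a j) (b j) (a k) (b k)\<bar>"
proof -
  \<comment> \<open>\<open>is_fbm\<close> speaks of values, not increments: even positions carry the
    right endpoints with weight \<open>g\<close>, odd ones the left endpoints with weight
    \<open>- g\<close>.\<close>
  define c where "c k = (if even k then g (k div 2) else - g (k div 2))" for k
  define t where "t k = (if even k then b (k div 2) else a (k div 2))" for k
  have t: "\<forall>k\<in>{..<2*n}. 0 \<le> t k" using nn by (auto simp: t_def)
  have c2: "c (2*k) = g k" "c (2*k+1) = - g k" "t (2*k) = b k" "t (2*k+1) = a k" for k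
    by (auto simp: c_def t_def)
  have "normal_rv M (\<lambda>\<omega>. \<Sum>k<2*n. c k * w (t k) \<omega>) 0
      (\<Sum>j<2*n. \<Sum>k<2*n. c j * c k * fbm_cov H (t j) (t k))"
    by (rule fbm[unfolded is_fbm_def, THEN conjunct1, rule_format]) (use t in auto)
  moreover have "(\<lambda>\<omega>. \<Sum>k<2*n. c k * w (t k) \<omega>) = D"
    unfolding sum_pairs_lessThan c2 D_def by (intro ext sum.cong refl) (simp add: algebra_simps)
  moreover have "(\<Sum>j<2*n. \<Sum>k<2*n. c j * c k * fbm_cov H (t j) (t k)) =
      (\<Sum>j<n. \<Sum>k<n. g j * g k * fbm_incr_cov H (a j) (b j) (a k) (b k))"
    unfolding sum_pairs_lessThan c2 sum.distrib[symmetric]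
    by (intro sum.cong refl) (simp add: fbm_incr_cov_def algebra_simps)
  ultimately have "normal_rv M D 0 (\<Sum>j<n. \<Sum>k<n. g j * g k * fbm_incr_cov H (a j) (b j) (a k) (b k))"
    by simp
  from normal_rv_moments[OF this] show "D \<in> borel_measurable M" "integrable M D" "expectation D = 0"
    "integrable M (\<lambda>\<omega>. (D \<omega>)\<^sup>2)"
    "expectation (\<lambda>\<omega>. (D \<omega>)\<^sup>2) =
      \<bar>\<Sum>j<n. \<Sum>k<n. g j * g k * fbm_incr_cov H (a j) (b j) (a k) (b k)\<bar>" by auto
qed

section \<open>Positive correlation of increments and monotonicity in the weights\<close>

lemma fbm_incr_cov_eq:
  "fbm_incr_cov H a b c d =
    (\<bar>d - a\<bar> powr (2*H) + \<bar>c - b\<bar> powr (2*H) - \<bar>d - b\<bar> powr (2*H) - \<bar>c - a\<bar> powr (2*H)) / 2"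
  by (simp add: fbm_incr_cov_def fbm_cov_def field_simps)

lemma fbm_incr_cov_commute: "fbm_incr_cov H a b c d = fbm_incr_cov H c d a b"
  by (simp add: fbm_incr_cov_eq abs_minus_commute)

text \<open>\<open>u + x\<close> and \<open>u + y\<close> are convex combinations of
  \<open>u\<close> and \<open>u + x + y\<close> with complementary weights, so the two convexity
  inequalities are added. Convexity is used on the open half-line; for \<open>u = 0\<close> the
  claim is superadditivity of the \<open>p\<close>-th power, from \<open>r powr p \<le> r\<close> on
  the unit interval.\<close>

lemma powr_convex_increments:
  fixes p :: real
  assumes "1 \<le> p" "0 \<le> u" "0 \<le> x" "0 \<le> y"
  shows "(u + x) powr p + (u + y) powr p \<le> u powr p + (u + x + y) powr p"
proof (cases "x + y = 0 \<or> u = 0")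
  case True
  have "x powr p + y powr p \<le> (x + y) powr p" if "0 < x + y"
  proof -
    have *: "z powr p \<le> z / (x + y) * (x + y) powr p" if z: "0 \<le> z" "z \<le> x + y" for z
    proof -
      have "(z / (x + y)) powr p \<le> (z / (x + y)) powr 1"
        using z \<open>0 < x + y\<close> assms by (intro powr_mono') auto
      then have "(z / (x + y)) powr p * (x + y) powr p \<le> z / (x + y) * (x + y) powr p"
        using z \<open>0 < x + y\<close> by (intro mult_right_mono) auto
      then show ?thesis using z \<open>0 < x + y\<close> by (simp add: powr_mult[symmetric])
    qed
    have "x / (x+y) * (x + y) powr p + y / (x + y) * (x + y) powr p = (x + y) powr p"
      using that by (simp add: distrib_right[symmetric] add_divide_distrib[symmetric])
    then show ?thesis using *[of x] *[of y] assms by linarith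
  qed
  then show ?thesis using True assms by (cases "x + y = 0") (auto simp: add_nonneg_eq_0_iff)
next
  case False
  then have pos: "x + y > 0" and u: "u > 0" using assms by auto
  have conv: "convex_on {0<..} (\<lambda>x::real. x powr p)" by (rule powr_convex[OF assms(1)])
  define s where "s = x / (x + y)"
  have s: "0 \<le> s" "s \<le> 1" "1 - s = y / (x+y)" using assms pos by (auto simp: s_def field_simps)
  have sx: "s * (x+y) = x" "(1-s) * (x+y) = y" using pos by (auto simp: s_def field_simps)
  have "((1-s) * u + s * (u+x+y)) powr p \<le> (1-s) * u powr p + s * (u+x+y) powr p"
    using convex_onD[OF conv s(1,2), of u "u+x+y"] assms u by simp
  moreover have "(1-s) * u + s * (u+x+y) = u + x" using sx by (simp add: algebra_simps)
  moreover have "(s * u + (1-s) * (u+x+y)) powr p \<le> s * u powr p + (1-s) * (u+x+y) powr p"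
    using convex_onD[OF conv, of "1-s" u "u+x+y"] assms s(1,2) u by simp
  moreover have "s * u + (1-s) * (u+x+y) = u + y" using sx by (simp add: algebra_simps)
  ultimately show ?thesis by (simp add: algebra_simps)
qed

text \<open>The covariance is a mixed second difference of the power \<open>2*H \<ge> 1\<close>,
  taken with gap \<open>c - b\<close> and lengths \<open>b - a\<close> and \<open>d - c\<close>;
  convexity fixes its sign.\<close>

lemma fbm_incr_cov_nonneg_disjoint:
  assumes "1/2 < H" "a \<le> b" "b \<le> c" "c \<le> d"
  shows "0 \<le> fbm_incr_cov H a b c d"
  using powr_convex_increments[of "2*H" "c-b" "b-a" "d-c"] assms
  by (simp add: fbm_incr_cov_eq abs_if)

text \<open>Two cells of a grid are disjoint in one of two orders or identical; in the last case the
  expression is the variance of an increment.\<close>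

lemma fbm_incr_cov_nonneg:
  fixes s :: "nat \<Rightarrow> real"
  assumes "1/2 < H" "mono s"
  shows "0 \<le> fbm_incr_cov H (s j) (s (Suc j)) (s k) (s (Suc k))"
proof (cases j k rule: linorder_cases)
  case less
  then show ?thesis
    by (intro fbm_incr_cov_nonneg_disjoint) (use assms in \<open>auto intro!: monoD[OF assms(2)]\<close>)
next
  case greater
  then show ?thesis
    by (subst fbm_incr_cov_commute, intro fbm_incr_cov_nonneg_disjoint)
       (use assms in \<open>auto intro!: monoD[OF assms(2)]\<close>)
qed (auto simp: fbm_incr_cov_eq abs_minus_commute)

text \<open>The covariance matrix of the increments has nonnegative entries, so its quadratic form
  grows when the weights are replaced by nonnegative majorants. Kernels of varying sign, such as
  exponential minus resolvent power, thereby need only be bounded in absolute value.\<close>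

lemma (in prob_space) fbm_incr_sum_mono:
  fixes g G s :: "nat \<Rightarrow> real"
  assumes fbm: "is_fbm M H w" and H: "1/2 < H" and s: "mono s" "0 \<le> s 0"
    and gG: "\<And>l. l < n \<Longrightarrow> \<bar>g l\<bar> \<le> K * G l" and K: "0 \<le> K" and G: "\<And>l. l < n \<Longrightarrow> 0 \<le> G l"
  shows "expectation (\<lambda>\<omega>. (\<Sum>l<n. g l * (w (s (Suc l)) \<omega> - w (s l) \<omega>))\<^sup>2)
    \<le> K\<^sup>2 * expectation (\<lambda>\<omega>. (\<Sum>l<n. G l * (w (s (Suc l)) \<omega> - w (s l) \<omega>))\<^sup>2)"
proof -
  have nn: "0 \<le> s k" for k using monoD[OF s(1), of 0 k] s(2) by simp
  let ?R = "\<lambda>j k. fbm_incr_cov H (s j) (s (Suc j)) (s k) (s (Suc k))"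
  have R: "0 \<le> ?R j k" for j k by (rule fbm_incr_cov_nonneg[OF H s(1)])
  have "\<bar>\<Sum>j<n. \<Sum>k<n. g j * g k * ?R j k\<bar> \<le> (\<Sum>j<n. \<Sum>k<n. \<bar>g j * g k * ?R j k\<bar>)"
    by (rule order_trans[OF sum_abs sum_mono[OF sum_abs]])
  also have "\<dots> \<le> (\<Sum>j<n. \<Sum>k<n. (K * G j) * (K * G k) * ?R j k)"
    using R by (intro sum_mono) (auto simp: abs_mult intro!: mult_right_mono mult_mono gG mult_nonneg_nonneg K G)
  also have "\<dots> = K\<^sup>2 * (\<Sum>j<n. \<Sum>k<n. G j * G k * ?R j k)"
    by (simp add: sum_distrib_left power2_eq_square ac_simps)
  also have "\<dots> \<le> K\<^sup>2 * \<bar>\<Sum>j<n. \<Sum>k<n. G j * G k * ?R j k\<bar>"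
    by (intro mult_left_mono) auto
  finally show ?thesis
    using fbm_incr_sum_moments(5)[OF fbm, of n s "\<lambda>l. s (Suc l)" g]
      fbm_incr_sum_moments(5)[OF fbm, of n s "\<lambda>l. s (Suc l)" G] nn by simp
qed

section \<open>Abel summation and exponentially weighted sums of increments\<close>

lemma summation_by_parts_partial:
  fixes a w :: "nat \<Rightarrow> real"
  shows "(\<Sum>l<n. (\<Sum>k\<le>l. a k) * (w (Suc l) - w l)) = (\<Sum>l<n. a l * (w n - w l))"
proof (induction n)
  case (Suc n)
  have "(\<Sum>l<Suc n. a l * (w (Suc n) - w l)) =
      (\<Sum>l<n. a l * (w n - w l)) + (\<Sum>l<n. a l * (w (Suc n) - w n)) + a n * (w (Suc n) - w n)"
    unfolding sum.distrib[symmetric] by (simp add: algebra_simps)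
  also have "\<dots> = (\<Sum>l<n. a l * (w n - w l)) + (\<Sum>k\<le>n. a k) * (w (Suc n) - w n)"
    unfolding sum_distrib_right[symmetric] lessThan_Suc_atMost[symmetric] by (simp add: algebra_simps)
  finally show ?case using Suc by simp
qed simp

lemma (in prob_space) fbm_incr_L2:
  assumes fbm: "is_fbm M H w" and "0 \<le> s" "0 \<le> t"
  shows "integrable M (\<lambda>\<omega>. (w t \<omega> - w s \<omega>)\<^sup>2)"
    "expectation (\<lambda>\<omega>. (w t \<omega> - w s \<omega>)\<^sup>2) = \<bar>t - s\<bar> powr (2*H)"
  using fbm_incr_sum_moments(4,5)[OF fbm, of 1 "\<lambda>_. s" "\<lambda>_. t" "\<lambda>_. 1"] assms
  by (auto simp: fbm_incr_cov_eq abs_minus_commute)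

text \<open>Cauchy-Schwarz after splitting \<open>a l\<close> as
  \<open>sqrt (a l * u l) * sqrt (a l / u l)\<close>. The free weights \<open>u\<close> will be the
  standard deviations of the \<open>B l\<close>; then the expectation of the second factor equals
  the first factor.\<close>

lemma sum_weighted_square_le:
  fixes a u B :: "nat \<Rightarrow> real"
  assumes "finite I" "\<And>l. l \<in> I \<Longrightarrow> 0 \<le> a l" "\<And>l. l \<in> I \<Longrightarrow> 0 < u l"
  shows "(\<Sum>l\<in>I. a l * B l)\<^sup>2 \<le> (\<Sum>l\<in>I. a l * u l) * (\<Sum>l\<in>I. a l / u l * (B l)\<^sup>2)"
proof -
  have "(\<Sum>l\<in>I. a l * B l) = (\<Sum>l\<in>I. sqrt (a l * u l) * (sqrt (a l / u l) * B l))"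
  proof (rule sum.cong)
    fix l assume "l \<in> I"
    then have "sqrt (a l * u l) * sqrt (a l / u l) = a l"
      using assms(2)[of l] assms(3)[of l] by (simp add: real_sqrt_mult[symmetric])
    then show "a l * B l = sqrt (a l * u l) * (sqrt (a l / u l) * B l)" by simp
  qed simp
  also have "\<dots>\<^sup>2 \<le> (\<Sum>l\<in>I. (sqrt (a l * u l))\<^sup>2) * (\<Sum>l\<in>I. (sqrt (a l / u l) * B l)\<^sup>2)"
    by (rule Cauchy_Schwarz_ineq_sum)
  also have "(\<Sum>l\<in>I. (sqrt (a l * u l))\<^sup>2) = (\<Sum>l\<in>I. a l * u l)"
    using assms by (intro sum.cong) (auto simp: less_imp_le)
  also have "(\<Sum>l\<in>I. (sqrt (a l / u l) * B l)\<^sup>2) = (\<Sum>l\<in>I. a l / u l * (B l)\<^sup>2)"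
    using assms by (intro sum.cong) (auto simp: power_mult_distrib less_imp_le)
  finally show ?thesis .
qed

text \<open>Discrete counterpart of the integral of \<open>c * exp (- c * x)\<close>. The induction
  needs the sharper bound \<open>1 - exp (- c * n)\<close>, which reproduces itself because
  \<open>exp (- c) * (1 + c) \<le> 1\<close>.\<close>

lemma sum_exp_decay_le:
  fixes c :: real
  assumes "0 < c"
  shows "c * (\<Sum>l<n. exp (- c * real (n - l))) \<le> 1"
proof -
  have "c * (\<Sum>l<n. exp (- c * real (n - l))) \<le> 1 - exp (- c * real n)"
  proof (induction n)
    case (Suc n)
    have e: "exp (- c) * (1 + c) \<le> 1"
      using mult_left_mono[OF exp_ge_add_one_self[of c], of "exp (-c)"] by (simp add: exp_minus field_simps)
    have "(\<Sum>l<Suc n. exp (- c * real (Suc n - l))) =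
        (\<Sum>l<n. exp (- c) * exp (- c * real (n - l))) + exp (- c)"
      by (auto intro!: sum.cong simp: mult_exp_exp of_nat_diff algebra_simps)
    then have "c * (\<Sum>l<Suc n. exp (- c * real (Suc n - l))) =
        exp (-c) * (c * (\<Sum>l<n. exp (- c * real (n - l)))) + c * exp (- c)"
      by (simp add: sum_distrib_left[symmetric] algebra_simps)
    also have "\<dots> \<le> exp (-c) * (1 - exp (- c * real n)) + c * exp (- c)"
      using Suc by (intro add_right_mono mult_left_mono) auto
    also have "\<dots> = exp (-c) * (1 + c) - exp (- c * real (Suc n))"
      by (simp add: mult_exp_exp algebra_simps exp_add[symmetric])
    finally show ?case using e by linarith
  qed simp
  also have "\<dots> \<le> 1" by simp
  finally show ?thesis .
qed

lemma powr_le_one_plus: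
  fixes y H :: real
  assumes "0 \<le> y" "0 \<le> H" "H \<le> 1"
  shows "y powr H \<le> 1 + y"
proof (cases "y \<le> 1")
  case True
  then have "y powr H \<le> 1 powr H" using assms by (intro powr_mono2) auto
  then show ?thesis using assms by simp
next
  case False
  then have "y powr H \<le> y powr 1" using assms by (intro powr_mono) auto
  then show ?thesis using assms False by simp
qed

text \<open>Abel summation turns the weighted sum of increments into a combination of
  \<open>w (s n) - w (s l)\<close> with positive weights, whose second moment is controlled by the
  Cauchy--Schwarz inequality and the variance of the single increments.\<close>

lemma (in prob_space) fbm_exp_sum_L2:
  assumes fbm: "is_fbm M H w" and H: "0 < H" "H \<le> 1" and \<delta>: "0 < \<delta>" and c: "0 < c" and x0: "0 \<le> x0"
  defines "s \<equiv> \<lambda>l. x0 + real l * \<delta>"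
  shows "expectation (\<lambda>\<omega>. (\<Sum>l<n. exp (- c * real (n - l)) * (w (s (Suc l)) \<omega> - w (s l) \<omega>))\<^sup>2)
    \<le> 4 * (\<delta> / c) powr (2*H)"
proof -
  define G where "G l = exp (- c * real n) * exp (c * real l)" for l
  \<comment> \<open>The increments of the increasing weights \<open>G\<close>, started with
    \<open>G 0\<close> so that their partial sums are \<open>G\<close> again.\<close>
  define a where "a l = (if l = 0 then G 0 else G l - G (l - 1))" for l
  define u where "u l = (real (n - l) * \<delta>) powr H" for l
  have G: "G l = exp (- c * real (n - l))" if "l \<le> n" for l
    using that by (simp add: G_def mult_exp_exp of_nat_diff algebra_simps)
  have Gsum: "(\<Sum>k\<le>l. a k) = G l" for l
    by (induction l) (auto simp: a_def)
  have a: "0 \<le> a l" for l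
    using c by (cases l) (auto simp: a_def G_def)
  have u: "0 < u l" if "l < n" for l using that \<delta> by (auto simp: u_def)
  have eq: "(\<Sum>l<n. exp (- c * real (n - l)) * (f (Suc l) - f l)) = (\<Sum>l<n. a l * (f n - f l))"
    for f :: "nat \<Rightarrow> real"
    unfolding summation_by_parts_partial[symmetric] Gsum by (intro sum.cong) (auto simp: G)
  let ?B = "\<lambda>l \<omega>. w (s n) \<omega> - w (s l) \<omega>"
  have s: "0 \<le> s l" for l using x0 \<delta> by (simp add: s_def)
  note B = fbm_incr_L2[OF fbm s s]
  have EB: "expectation (\<lambda>\<omega>. (?B l \<omega>)\<^sup>2) = (u l)\<^sup>2" if "l < n" for l
  proof -
    have "s n - s l = real (n - l) * \<delta>" using that by (simp add: s_def of_nat_diff algebra_simps)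
    then show ?thesis unfolding B(2) using \<delta>
      by (simp add: u_def abs_mult power2_eq_square powr_add[symmetric])
  qed
  have "expectation (\<lambda>\<omega>. (\<Sum>l<n. exp (- c * real (n - l)) * (w (s (Suc l)) \<omega> - w (s l) \<omega>))\<^sup>2)
    \<le> expectation (\<lambda>\<omega>. (\<Sum>l<n. a l * u l) * (\<Sum>l<n. a l / u l * (?B l \<omega>)\<^sup>2))"
  proof (rule integral_mono)
    show "integrable M (\<lambda>\<omega>. (\<Sum>l<n. exp (- c * real (n - l)) * (w (s (Suc l)) \<omega> - w (s l) \<omega>))\<^sup>2)"
      by (rule fbm_incr_sum_moments(4)[OF fbm]) (auto simp: s)
    show "integrable M (\<lambda>\<omega>. (\<Sum>l<n. a l * u l) * (\<Sum>l<n. a l / u l * (?B l \<omega>)\<^sup>2))"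
      by (intro integrable_mult_right Bochner_Integration.integrable_sum B(1))
    fix \<omega>
    show "(\<Sum>l<n. exp (- c * real (n - l)) * (w (s (Suc l)) \<omega> - w (s l) \<omega>))\<^sup>2 \<le>
        (\<Sum>l<n. a l * u l) * (\<Sum>l<n. a l / u l * (?B l \<omega>)\<^sup>2)"
      unfolding eq[of "\<lambda>l. w (s l) \<omega>"] by (rule sum_weighted_square_le) (auto simp: a u)
  qed
  also have "\<dots> = (\<Sum>l<n. a l * u l) * (\<Sum>l<n. a l / u l * (u l)\<^sup>2)"
    unfolding integral_mult_right_zero
  proof (subst Bochner_Integration.integral_sum)
    show "integrable M (\<lambda>\<omega>. a l / u l * (?B l \<omega>)\<^sup>2)" for l
      by (intro integrable_mult_right B(1))
  qed (simp add: EB)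
  also have "(\<Sum>l<n. a l / u l * (u l)\<^sup>2) = (\<Sum>l<n. a l * u l)"
    by (intro sum.cong) (auto simp: power2_eq_square dest: u)
  also have "(\<Sum>l<n. a l * u l) * (\<Sum>l<n. a l * u l) \<le> (2 * (\<delta> / c) powr H) * (2 * (\<delta> / c) powr H)"
  proof -
    \<comment> \<open>\<open>(\<delta> / c) powr H\<close> is the standard deviation of an increment
      over the decay length of the weights; \<open>y powr H \<le> 1 + y\<close> makes the other
      factor affine in \<open>n - l\<close>.\<close>
    have ul: "u l \<le> (\<delta> / c) powr H * (1 + c * real (n - l))" for l
    proof -
      have "u l = (\<delta> / c) powr H * (c * real (n - l)) powr H"
        using c \<delta> by (simp add: u_def powr_mult[symmetric] mult.commute)
      also have "\<dots> \<le> (\<delta> / c) powr H * (1 + c * real (n - l))"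
        using c H by (intro mult_left_mono powr_le_one_plus) auto
      finally show ?thesis .
    qed
    \<comment> \<open>Abel summation applied to the identity in place of a path leads back to the
      geometric sum.\<close>
    have e2: "(\<Sum>l<n. a l * real (n - l)) = (\<Sum>l<n. exp (- c * real (n - l)))"
    proof -
      have "(\<Sum>l<n. a l * real (n - l)) = (\<Sum>l<n. a l * (real n - real l))"
        by (intro sum.cong refl) (auto simp: of_nat_diff)
      then show ?thesis using eq[of real] by simp
    qed
    have e1: "(\<Sum>l<n. a l) \<le> 1"
    proof (cases n)
      case (Suc k)
      then have "(\<Sum>l<n. a l) = G k" using Gsum[of k] by (simp add: lessThan_Suc_atMost)
      then show ?thesis using c Suc G[of k] by simp
    qed simp
    have "(\<Sum>l<n. a l * u l) \<le> (\<Sum>l<n. a l * ((\<delta> / c) powr H * (1 + c * real (n - l))))"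
      by (intro sum_mono mult_left_mono ul a)
    also have "\<dots> = (\<delta> / c) powr H * ((\<Sum>l<n. a l) + c * (\<Sum>l<n. a l * real (n - l)))"
      by (simp add: sum_distrib_left sum.distrib[symmetric] algebra_simps)
    also have "\<dots> \<le> (\<delta> / c) powr H * (1 + 1)"
      unfolding e2 using e1 sum_exp_decay_le[OF c, of n] by (intro mult_left_mono add_mono) auto
    finally have "(\<Sum>l<n. a l * u l) \<le> 2 * (\<delta> / c) powr H" by simp
    moreover have "0 \<le> (\<Sum>l<n. a l * u l)" by (intro sum_nonneg mult_nonneg_nonneg a) (auto simp: u_def)
    ultimately show ?thesis by (intro mult_mono) auto
  qed
  also have "\<dots> = 4 * (\<delta> / c) powr (2*H)" by (simp add: powr_add[symmetric] mult.commute)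
  finally show ?thesis .
qed

text \<open>The bound sees mesh and decay rate only through \<open>\<delta> / c\<close>. On refined
  grids \<open>c\<close> is taken proportional to \<open>\<delta>\<close>, so the estimate does not
  deteriorate and survives the limit to the Wiener integral.\<close>

lemma (in prob_space) fbm_dominated_sum_L2:
  assumes fbm: "is_fbm M H w" and H: "1/2 < H" "H \<le> 1" and \<delta>: "0 < \<delta>" and c: "0 < c" and x0: "0 \<le> x0"
    and g: "\<And>l. l < n \<Longrightarrow> \<bar>g l\<bar> \<le> K * exp (- c * real (n - l))" and K: "0 \<le> K"
  defines "s \<equiv> \<lambda>l. x0 + real l * \<delta>"
  shows "expectation (\<lambda>\<omega>. (\<Sum>l<n. g l * (w (s (Suc l)) \<omega> - w (s l) \<omega>))\<^sup>2)
    \<le> 4 * K\<^sup>2 * (\<delta> / c) powr (2*H)"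
proof -
  have "mono s" using \<delta> by (auto simp: s_def mono_def)
  then have "expectation (\<lambda>\<omega>. (\<Sum>l<n. g l * (w (s (Suc l)) \<omega> - w (s l) \<omega>))\<^sup>2)
    \<le> K\<^sup>2 * expectation (\<lambda>\<omega>. (\<Sum>l<n. exp (- c * real (n - l)) * (w (s (Suc l)) \<omega> - w (s l) \<omega>))\<^sup>2)"
    by (intro fbm_incr_sum_mono[OF fbm H(1)] g K) (use x0 in \<open>auto simp: s_def\<close>)
  also have "\<dots> \<le> K\<^sup>2 * (4 * (\<delta> / c) powr (2*H))"
    using fbm_exp_sum_L2[OF fbm _ H(2) \<delta> c x0, of n] H by (intro mult_left_mono) (auto simp: s_def)
  finally show ?thesis by simp
qed

text \<open>For constant weight one the sum telescopes to a single increment; positive correlation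
  makes this the worst case.\<close>

lemma (in prob_space) fbm_bounded_sum_L2:
  assumes fbm: "is_fbm M H w" and H: "1/2 < H" and s: "mono s" "0 \<le> s 0"
    and g: "\<And>l. l < n \<Longrightarrow> \<bar>g l\<bar> \<le> 1"
  shows "expectation (\<lambda>\<omega>. (\<Sum>l<n. g l * (w (s (Suc l)) \<omega> - w (s l) \<omega>))\<^sup>2)
    \<le> (s n - s 0) powr (2*H)"
proof -
  have nn: "0 \<le> s k" for k using monoD[OF s(1), of 0 k] s(2) by simp
  have "expectation (\<lambda>\<omega>. (\<Sum>l<n. g l * (w (s (Suc l)) \<omega> - w (s l) \<omega>))\<^sup>2)
    \<le> 1\<^sup>2 * expectation (\<lambda>\<omega>. (\<Sum>l<n. 1 * (w (s (Suc l)) \<omega> - w (s l) \<omega>))\<^sup>2)"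
    by (rule fbm_incr_sum_mono[OF fbm H s]) (use g in auto)
  also have "\<dots> = (s n - s 0) powr (2*H)"
    using fbm_incr_L2(2)[OF fbm nn nn, of n 0] monoD[OF s(1), of 0 n]
    by (simp add: sum_lessThan_telescope[of "\<lambda>l. w (s l) \<omega>" for \<omega>])
  finally show ?thesis .
qed

section \<open>Resolvent powers and Riemann sums of the Wiener integral\<close>

lemma y_exp_neg_le_one: "(y::real) * exp (- y) \<le> 1"
  using mult_right_mono[OF exp_ge_add_one_self[of y], of "exp (- y)"]
  by (simp add: exp_minus_inverse algebra_simps) (smt (verit) exp_gt_zero)

lemma resolvent_power_ge_exp:
  fixes z :: real
  assumes "0 \<le> z"
  shows "exp (- z * real j) \<le> (1 / (1 + z)) ^ j"
proof -
  have "exp (- z) \<le> 1 / (1 + z)"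
    using exp_ge_add_one_self[of z] assms by (simp add: exp_minus field_simps)
  then have "exp (- z) ^ j \<le> (1 / (1 + z)) ^ j" by (intro power_mono) auto
  then show ?thesis by (simp add: exp_of_nat_mult[symmetric] mult.commute)
qed

lemma resolvent_power_le_one:
  fixes z :: real
  assumes "0 \<le> z"
  shows "0 \<le> (1 / (1 + z)) ^ j" "(1 / (1 + z)) ^ j \<le> 1"
  using assms by (auto intro!: power_le_one)

text \<open>\<open>x\<close> may vary over a unit cell because the resolvent weight is constant
  there. In one direction, moving \<open>x\<close> away from \<open>j\<close> costs at most a factor
  \<open>exp z\<close>. In the other, \<open>ln (1 + z) \<ge> z - z^2\<close> produces an error
  \<open>j * z^2\<close> relative to the resolvent power; that power decays like
  \<open>exp (- z * j / 2)\<close>, and half of this decay absorbs the factor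
  \<open>z * j\<close>.\<close>

lemma exp_resolvent_diff_small:
  fixes z x :: real
  assumes z: "0 \<le> z" "z \<le> 1" and x: "real j - 1 \<le> x" "x \<le> real j"
  shows "\<bar>exp (- z * x) - (1 / (1 + z)) ^ j\<bar> \<le> 4 * z * exp (- z * real j / 4)"
proof -
  define p where "p = (1 / (1 + z)) ^ j"
  have pe: "p = exp (- real j * ln (1 + z))"
  proof -
    have "1 / (1 + z) = exp (- ln (1 + z))" using z by (simp add: exp_minus inverse_eq_divide)
    then have "p = exp (- ln (1 + z)) ^ j" by (simp add: p_def)
    then show ?thesis by (simp add: exp_of_nat_mult[symmetric])
  qed
  have "exp (- z * x) - p \<le> exp (- z * real j) * (exp z - 1)"
  proof -
    have "- z * x \<le> - z * real j + z"
      using mult_left_mono[OF x(1) z(1)] by (simp add: algebra_simps)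
    then have "exp (- z * x) \<le> exp (- z * real j) * exp z" by (simp add: mult_exp_exp)
    then show ?thesis using resolvent_power_ge_exp[OF z(1), of j] by (simp add: p_def algebra_simps)
  qed
  also have "\<dots> \<le> exp (- z * real j / 4) * (4 * z)"
  proof (rule mult_mono)
    show "exp (- z * real j) \<le> exp (- z * real j / 4)" using z by simp
    show "exp z - 1 \<le> 4 * z"
      using exp_bound[of z] z mult_left_mono[of z 1 z] by (simp add: power2_eq_square)
  qed (use z in auto)
  finally have 1: "exp (- z * x) - p \<le> 4 * z * exp (- z * real j / 4)" by (simp add: ac_simps)
  have "p - exp (- z * x) \<le> p - exp (- z * real j)"
    using mult_left_mono[OF x(2) z(1)] by simp
  also have "\<dots> \<le> p * (real j * z\<^sup>2)"
  proof -
    have "- (real j * z\<^sup>2) \<le> - real j * (z - ln (1 + z))"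
      using mult_left_mono[OF ln_one_plus_pos_lower_bound[OF z], of "real j"] by (simp add: algebra_simps)
    also have "1 + \<dots> \<le> exp (- real j * (z - ln (1 + z)))"
      by (rule exp_ge_add_one_self)
    finally have "p * (1 - real j * z\<^sup>2) \<le> p * exp (- real j * (z - ln (1 + z)))"
      by (intro mult_left_mono) (auto simp: pe)
    also have "\<dots> = exp (- z * real j)" by (simp add: pe mult_exp_exp algebra_simps)
    finally show ?thesis by (simp add: algebra_simps)
  qed
  also have "\<dots> \<le> exp (- z * real j / 2) * (real j * z\<^sup>2)"
  proof (rule mult_right_mono)
    have "exp (z / 2) \<le> 1 + z"
      using exp_bound[of "z/2"] z mult_left_mono[of z 1 z] by (simp add: power2_eq_square field_simps)
    then have "z / 2 \<le> ln (1 + z)" using z by (subst ln_ge_iff) auto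
    then have "real j * (z / 2) \<le> real j * ln (1 + z)" by (intro mult_left_mono) auto
    then show "p \<le> exp (- z * real j / 2)" by (simp add: pe algebra_simps)
  qed simp
  also have "\<dots> = 4 * z * exp (- z * real j / 4) * ((z * real j / 4) * exp (- (z * real j / 4)))"
    by (simp add: power2_eq_square mult_exp_exp algebra_simps)
  also have "\<dots> \<le> 4 * z * exp (- z * real j / 4) * 1"
    using z by (intro mult_left_mono y_exp_neg_le_one) auto
  finally have 2: "p - exp (- z * x) \<le> 4 * z * exp (- z * real j / 4)" by simp
  show ?thesis using 1 2 by (simp add: p_def)
qed

text \<open>For \<open>z \<le> 1\<close> the remaining decay is used up by
  \<open>y * exp (- y) \<le> 1\<close> with \<open>y = z * j / 4\<close>; for \<open>z > 1\<close>
  each term is geometrically small by itself. The bound is free of \<open>z\<close>, hence uniform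
  over all eigenvalues.\<close>

lemma exp_resolvent_diff_inverse:
  fixes z x :: real
  assumes z: "0 \<le> z" and x: "real j - 1 \<le> x" "x \<le> real j" and j: "1 \<le> j"
  shows "\<bar>exp (- z * x) - (1 / (1 + z)) ^ j\<bar> \<le> 16 / real j"
proof (cases "z \<le> 1")
  case True
  have "\<bar>exp (- z * x) - (1 / (1 + z)) ^ j\<bar> \<le> 4 * z * exp (- z * real j / 4)"
    by (rule exp_resolvent_diff_small[OF z True x])
  also have "\<dots> = 16 / real j * ((z * real j / 4) * exp (- (z * real j / 4)))"
    using j by (simp add: field_simps)
  also have "\<dots> \<le> 16 / real j * 1"
    by (intro mult_left_mono y_exp_neg_le_one) auto
  finally show ?thesis by simp
next
  case False
  have "exp (- z * x) \<le> 1 / real j"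
  proof -
    have "real j \<le> exp (real j - 1)" using exp_ge_add_one_self[of "real j - 1"] by simp
    also have "\<dots> \<le> exp (z * x)"
      using mult_mono[of 1 z "real j - 1" x] False x j by simp
    finally show ?thesis using j by (simp add: exp_minus field_simps)
  qed
  moreover have "(1 / (1 + z)) ^ j \<le> 1 / real j"
  proof -
    have "(1 / (1 + z)) ^ j \<le> (1 / 2) ^ j" using False by (intro power_mono) (auto simp: field_simps)
    also have "\<dots> \<le> 1 / real j"
      using of_nat_mono[OF less_imp_le[OF less_exp[of j]], where 'a=real] j
      by (simp add: power_divide field_simps)
    finally show ?thesis .
  qed
  moreover have "1 / real j \<le> 16 / real j" using j by (intro divide_right_mono) auto
  moreover have "0 \<le> exp (- z * x)" "0 \<le> (1 / (1 + z)) ^ j" using z by auto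
  ultimately show ?thesis by linarith
qed

text \<open>Lowering the exponent from \<open>1\<close> to \<open>\<rho>\<close> makes the
  singularity integrable when \<open>\<rho> < 1\<close>; since the exponent is negative,
  \<open>x \<le> j\<close> lets the continuous variable replace \<open>j\<close>.\<close>

lemma exp_resolvent_diff_powr:
  fixes z x \<rho> :: real
  assumes z: "0 \<le> z" and x: "real j - 1 \<le> x" "x \<le> real j" "0 < x" and \<rho>: "0 \<le> \<rho>" "\<rho> \<le> 1"
  shows "\<bar>exp (- z * x) - (1 / (1 + z)) ^ j\<bar> \<le> 16 * x powr (- \<rho>)"
proof -
  have j: "1 \<le> j" using x by (cases j) auto
  have "\<bar>exp (- z * x) - (1 / (1 + z)) ^ j\<bar> \<le> 16 * real j powr (- 1)"
    using exp_resolvent_diff_inverse[OF z x(1,2) j] by (simp add: powr_minus_divide)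
  also have "\<dots> \<le> 16 * real j powr (- \<rho>)"
    using \<rho> j by (intro mult_left_mono powr_mono) auto
  also have "\<dots> \<le> 16 * x powr (- \<rho>)"
    using x \<rho> by (intro mult_left_mono powr_mono2') auto
  finally show ?thesis .
qed

text \<open>At grid points there is no shift to pay for. With \<open>z = \<tau> * lam i\<close>, the
  squared bound contains \<open>lam i powr (2*\<rho>)\<close>, the weight in the norm of the initial
  value.\<close>

lemma exp_resolvent_diff_node:
  fixes z \<rho> :: real
  assumes z: "0 < z" and \<rho>: "0 \<le> \<rho>" "\<rho> \<le> 1"
  shows "\<bar>exp (- z * real j) - (1 / (1 + z)) ^ j\<bar> \<le> 4 * z powr \<rho>"
proof (cases "z \<le> 1")
  case True
  have "\<bar>exp (- z * real j) - (1 / (1 + z)) ^ j\<bar> \<le> 4 * z * exp (- z * real j / 4)"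
    by (rule exp_resolvent_diff_small) (use z True in auto)
  also have "\<dots> \<le> 4 * z * 1" using z by (intro mult_left_mono) auto
  also have "\<dots> \<le> 4 * z powr \<rho>"
    using powr_mono'[of \<rho> 1 z] z True \<rho> by simp
  finally show ?thesis .
next
  case False
  have "\<bar>exp (- z * real j) - (1 / (1 + z)) ^ j\<bar> \<le> 1"
    using resolvent_power_ge_exp[of z j] resolvent_power_le_one[of z j] z exp_ge_zero[of "- z * real j"]
    by linarith
  also have "1 \<le> 4 * z powr \<rho>"
    using ge_one_powr_ge_zero[of z \<rho>] False \<rho> by simp
  finally show ?thesis .
qed

text \<open>One factor \<open>1 / (1 + z)\<close> is kept for smallness in \<open>z\<close>; the
  others are bounded by \<open>1/2\<close>, so that the decay in \<open>j\<close> has a rate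
  independent of \<open>z\<close>.\<close>

lemma resolvent_power_large:
  fixes z :: real
  assumes z: "1 \<le> z" and j: "1 \<le> j"
  shows "(1 / (1 + z)) ^ j \<le> 2 / (1 + z) * exp (- ln 2 * real j)"
proof -
  obtain k where k: "j = Suc k" using j by (cases j) auto
  have "(1 / (1 + z)) ^ j \<le> 1 / (1 + z) * (1 / 2) ^ k"
    unfolding k power_Suc using z by (intro mult_left_mono power_mono) (auto simp: field_simps)
  also have "(1 / 2) ^ k = 2 * (1/2::real) ^ j" by (simp add: k)
  also have "(1/2::real) ^ j = exp (- ln 2 * real j)"
  proof -
    have "exp (- ln 2 * real j) = exp (- ln 2) ^ j"
      by (simp add: exp_of_nat_mult[symmetric] mult.commute)
    then show ?thesis by (simp add: exp_minus inverse_eq_divide)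
  qed
  finally show ?thesis by simp
qed

lemma one_minus_exp_le_powr:
  fixes v \<rho> :: real
  assumes "0 \<le> v" "0 \<le> \<rho>" "\<rho> \<le> 1"
  shows "0 \<le> 1 - exp (- v)" "1 - exp (- v) \<le> v powr \<rho>"
proof -
  show "0 \<le> 1 - exp (- v)" using assms by simp
  show "1 - exp (- v) \<le> v powr \<rho>"
  proof (cases "v \<le> 1")
    case True
    have "1 - exp (- v) \<le> v" using exp_ge_add_one_self[of "-v"] by simp
    also have "\<dots> \<le> v powr \<rho>" using powr_mono'[of \<rho> 1 v] True assms by (cases "v = 0") auto
    finally show ?thesis .
  next
    case False
    then have "1 \<le> v powr \<rho>" using ge_one_powr_ge_zero[of v \<rho>] assms by simp
    then show ?thesis using exp_gt_zero[of "-v"] by linarith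
  qed
qed

text \<open>Smoothing of the semigroup: \<open>exp (- u)\<close> is traded for
  \<open>u powr (- \<rho>)\<close>. With \<open>u = lam i * (s - r)\<close> and
  \<open>v = lam i * (t - s)\<close> the eigenvalue cancels on the right.\<close>

lemma exp_smoothing:
  fixes u v \<rho> :: real
  assumes "0 < u" "0 \<le> v" "0 \<le> \<rho>" "\<rho> \<le> 1"
  shows "exp (- u) * (1 - exp (- v)) \<le> v powr \<rho> * u powr (- \<rho>)"
proof -
  have "u powr \<rho> \<le> exp u"
    using powr_le_one_plus[of u \<rho>] exp_ge_add_one_self[of u] assms by linarith
  then have "exp (- u) \<le> u powr (- \<rho>)"
    using assms by (simp add: exp_minus powr_minus le_imp_inverse_le)
  then have "exp (- u) * (1 - exp (- v)) \<le> u powr (- \<rho>) * v powr \<rho>"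
    by (intro mult_mono one_minus_exp_le_powr) (use assms in auto)
  then show ?thesis by (simp add: mult.commute)
qed

section \<open>The pathwise Wiener integral and its Riemann sums\<close>

text \<open>The integral of \<open>exp (- l * (b - s))\<close> against \<open>dp(s)\<close> over
  \<open>{a..b}\<close>, integrated by parts, as a functional of a single path. The free lower end
  serves the time increments of the convolution.\<close>

definition wexp :: "real \<Rightarrow> real \<Rightarrow> real \<Rightarrow> (real \<Rightarrow> real) \<Rightarrow> real" where
  "wexp l a b p = p b - exp (- l * (b - a)) * p a - l * integral {a..b} (\<lambda>s. exp (- l * (b - s)) * p s)"

lemma wiener_exp_eq_wexp: "wiener_exp l t w \<omega> = wexp l 0 t (\<lambda>s. w s \<omega>)"
  by (simp add: wiener_exp_def wexp_def)

lemma wexp_same [simp]: "wexp l a a p = 0"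
  by (simp add: wexp_def)

text \<open>Flow property: once \<open>exp (- l * (t - s))\<close> is pulled out of the integral
  over \<open>{0..s}\<close>, the boundary terms at \<open>s\<close> cancel.\<close>

lemma wexp_split:
  assumes p: "continuous_on {0..} p" and st: "0 \<le> s" "s \<le> t"
  shows "wexp l 0 t p = exp (- l * (t - s)) * wexp l 0 s p + wexp l s t p"
proof -
  have cont: "continuous_on {a..b} p" if "0 \<le> a" for a b
    by (rule continuous_on_subset[OF p]) (use that in auto)
  have int: "(\<lambda>r. exp (- l * (t - r)) * p r) integrable_on {a..b}" if "0 \<le> a" for a b
    using that by (intro integrable_continuous_interval continuous_intros cont)
  have "integral {0..t} (\<lambda>r. exp (- l * (t - r)) * p r) =
      integral {0..s} (\<lambda>r. exp (- l * (t - r)) * p r) + integral {s..t} (\<lambda>r. exp (- l * (t - r)) * p r)"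
    using Henstock_Kurzweil_Integration.integral_combine[OF st int[of 0 t]] by simp
  also have "integral {0..s} (\<lambda>r. exp (- l * (t - r)) * p r) =
      exp (- l * (t - s)) * integral {0..s} (\<lambda>r. exp (- l * (s - r)) * p r)"
    unfolding integral_mult_right[symmetric] mult.assoc[symmetric] mult_exp_exp
    by (simp add: algebra_simps)
  moreover have "exp (- l * (t - s)) * exp (- l * (s - 0)) = exp (- l * (t - 0))"
    unfolding mult_exp_exp by (simp add: algebra_simps)
  ultimately show ?thesis unfolding wexp_def
    by (simp add: algebra_simps)
qed

text \<open>Summation by parts moves the differences from the path to the kernel \<open>f\<close>.
  On each cell \<open>p\<close> is compared with its value at the right end, and since the
  derivative \<open>l * f\<close> is nonnegative the errors add up to
  \<open>\<epsilon> * (f b - f a) \<le> \<epsilon>\<close>. Only the modulus of continuity of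
  \<open>p\<close> enters, so paths of unbounded variation are covered.\<close>

lemma riemann_sum_wexp_error:
  fixes p :: "real \<Rightarrow> real"
  assumes p: "continuous_on {a..b} p" and l: "0 \<le> l" and ab: "a \<le> b" and n: "0 < n"
    and eps: "\<And>x y. x \<in> {a..b} \<Longrightarrow> y \<in> {a..b} \<Longrightarrow> \<bar>x - y\<bar> \<le> (b - a) / real n \<Longrightarrow> \<bar>p x - p y\<bar> \<le> \<epsilon>"
  defines "s \<equiv> \<lambda>k. a + real k * ((b - a) / real n)"
  shows "\<bar>(\<Sum>k<n. exp (- l * (b - s k)) * (p (s (Suc k)) - p (s k))) - wexp l a b p\<bar> \<le> \<epsilon>"
proof -
  define f where "f x = exp (- l * (b - x))" for x
  have f: "((\<lambda>x. l * f x) has_integral f y - f x) {x..y}" if "x \<le> y" for x y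
    unfolding f_def using that
    by (intro fundamental_theorem_of_calculus)
       (auto intro!: derivative_eq_intros simp: has_real_derivative_iff_has_vector_derivative[symmetric])
  have \<delta>: "0 \<le> (b - a) / real n" using ab by simp
  have smono: "mono s" unfolding s_def mono_def
    using \<delta> by (intro allI impI add_left_mono mult_right_mono) auto
  have s0: "s 0 = a" and sn: "s n = b" using n by (auto simp: s_def)
  have sm: "s k \<in> {a..b}" if "k \<le> n" for k
    using monoD[OF smono, of 0 k] monoD[OF smono that] s0 sn by simp
  have int: "(\<lambda>x. l * f x * p x) integrable_on {x..y}" if "a \<le> x" "y \<le> b" for x y
    unfolding f_def using that
    by (intro integrable_continuous_interval continuous_intros continuous_on_subset[OF p]) auto
  have "\<bar>(\<Sum>j<k. p (s (Suc j)) * (f (s (Suc j)) - f (s j))) - integral {a..s k} (\<lambda>x. l * f x * p x)\<bar>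
      \<le> \<epsilon> * (f (s k) - f a)" if "k \<le> n" for k
    using that
  proof (induction k)
    case 0
    then show ?case by (simp add: s0)
  next
    case (Suc k)
    let ?x = "s k" and ?y = "s (Suc k)"
    have xy: "?x \<le> ?y" using smono by (simp add: monoD)
    have ax: "a \<le> ?x" "?y \<le> b" using sm[of k] sm[of "Suc k"] Suc.prems by auto
    have I: "integral {a..?y} (\<lambda>x. l * f x * p x) =
        integral {a..?x} (\<lambda>x. l * f x * p x) + integral {?x..?y} (\<lambda>x. l * f x * p x)"
      using Henstock_Kurzweil_Integration.integral_combine[OF ax(1) xy int[of a ?y]] ax by simp
    have F: "((\<lambda>x. l * f x * p ?y) has_integral (f ?y - f ?x) * p ?y) {?x..?y}"
      by (rule has_integral_mult_left[OF f[OF xy]])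
    have D: "((\<lambda>x. l * f x * p ?y - l * f x * p x) has_integral
        (f ?y - f ?x) * p ?y - integral {?x..?y} (\<lambda>x. l * f x * p x)) {?x..?y}"
      by (rule has_integral_diff[OF F integrable_integral[OF int[OF ax]]])
    have "norm (integral {?x..?y} (\<lambda>x. l * f x * p ?y - l * f x * p x)) \<le>
        integral {?x..?y} (\<lambda>x. \<epsilon> * (l * f x))"
    proof (rule integral_norm_bound_integral)
      show "(\<lambda>x. l * f x * p ?y - l * f x * p x) integrable_on {?x..?y}" using D by blast
      show "(\<lambda>x. \<epsilon> * (l * f x)) integrable_on {?x..?y}"
        using has_integral_mult_right[OF f[OF xy], of \<epsilon>] by blast
      fix x assume x: "x \<in> {?x..?y}"
      have "?y - ?x = (b - a) / real n"
        unfolding s_def of_nat_Suc distrib_right by simp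
      then have "\<bar>p ?y - p x\<bar> \<le> \<epsilon>"
        using x ax by (intro eps) auto
      then have "l * f x * \<bar>p ?y - p x\<bar> \<le> l * f x * \<epsilon>"
        using l by (intro mult_left_mono) (auto simp: f_def)
      moreover have "norm (l * f x * p ?y - l * f x * p x) = l * f x * \<bar>p ?y - p x\<bar>"
        using l by (simp add: f_def abs_mult right_diff_distrib[symmetric])
      ultimately show "norm (l * f x * p ?y - l * f x * p x) \<le> \<epsilon> * (l * f x)" by (simp add: ac_simps)
    qed
    then have "\<bar>(f ?y - f ?x) * p ?y - integral {?x..?y} (\<lambda>x. l * f x * p x)\<bar> \<le> \<epsilon> * (f ?y - f ?x)"
      unfolding integral_unique[OF D] integral_unique[OF has_integral_mult_right[OF f[OF xy], of \<epsilon>]]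
      by (simp only: real_norm_def)
    moreover have "\<bar>(\<Sum>j<k. p (s (Suc j)) * (f (s (Suc j)) - f (s j))) - integral {a..?x} (\<lambda>x. l * f x * p x)\<bar>
      \<le> \<epsilon> * (f (s k) - f a)" using Suc by simp
    ultimately show ?case unfolding I by (simp add: algebra_simps)
  qed
  from this[of n] have main: "\<bar>(\<Sum>j<n. p (s (Suc j)) * (f (s (Suc j)) - f (s j))) -
      integral {a..b} (\<lambda>x. l * f x * p x)\<bar> \<le> \<epsilon> * (f b - f a)"
    by (simp add: sn)
  have eps0: "0 \<le> \<epsilon>" using eps[of a a] ab \<delta> by simp
  have "f b - f a \<le> 1" by (simp add: f_def)
  then have "\<epsilon> * (f b - f a) \<le> \<epsilon>" using eps0 by (simp add: mult_left_le)
  moreover have "(\<Sum>k<n. f (s k) * (p (s (Suc k)) - p (s k))) =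
     f b * p b - f a * p a - (\<Sum>j<n. p (s (Suc j)) * (f (s (Suc j)) - f (s j)))"
  proof -
    have "(\<Sum>k<n. f (s k) * (p (s (Suc k)) - p (s k))) + (\<Sum>j<n. p (s (Suc j)) * (f (s (Suc j)) - f (s j)))
      = (\<Sum>k<n. f (s (Suc k)) * p (s (Suc k)) - f (s k) * p (s k))"
      unfolding sum.distrib[symmetric] by (intro sum.cong refl) (simp add: algebra_simps)
    also have "\<dots> = f b * p b - f a * p a"
      by (subst sum_lessThan_telescope) (simp add: s0 sn)
    finally show ?thesis by simp
  qed
  moreover have "wexp l a b p = f b * p b - f a * p a - integral {a..b} (\<lambda>x. l * f x * p x)"
    unfolding wexp_def integral_mult_right[symmetric] by (simp add: f_def mult.assoc)
  ultimately show ?thesis using main unfolding f_def by linarith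
qed

text \<open>The number of cells runs through a general sequence because the comparison with the
  scheme uses grids of \<open>m * Suc q\<close> cells, compatible with the time steps.\<close>

lemma riemann_sum_tendsto_wexp:
  fixes p :: "real \<Rightarrow> real"
  assumes p: "continuous_on {0..} p" and l: "0 \<le> l" and a: "0 \<le> a" "a \<le> b"
    and N: "filterlim N at_top sequentially"
  shows "(\<lambda>q. \<Sum>k<N q. exp (- l * (b - (a + real k * ((b - a) / real (N q))))) *
      (p (a + real (Suc k) * ((b - a) / real (N q))) - p (a + real k * ((b - a) / real (N q)))))
    \<longlonglongrightarrow> wexp l a b p"
proof (rule LIMSEQ_I)
  fix r :: real assume r: "0 < r"
  have pc: "continuous_on {a..b} p" by (rule continuous_on_subset[OF p]) (use a in auto)
  then have "uniformly_continuous_on {a..b} p" by (intro compact_uniformly_continuous) auto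
  then obtain d where d: "0 < d" "\<And>x y. x \<in> {a..b} \<Longrightarrow> y \<in> {a..b} \<Longrightarrow> dist x y < d \<Longrightarrow> dist (p x) (p y) < r / 2"
    unfolding uniformly_continuous_on_def using r by (metis half_gt_zero)
  obtain n0 :: nat where n0: "(b - a) / d < real n0" using reals_Archimedean2 by blast
  have "eventually (\<lambda>q. max 1 n0 \<le> N q) sequentially"
    using N unfolding filterlim_at_top by blast
  then obtain q0 where q0: "\<And>q. q \<ge> q0 \<Longrightarrow> max 1 n0 \<le> N q" by (auto simp: eventually_sequentially)
  show "\<exists>no. \<forall>q\<ge>no. norm ((\<Sum>k<N q. exp (- l * (b - (a + real k * ((b - a) / real (N q))))) *
      (p (a + real (Suc k) * ((b - a) / real (N q))) - p (a + real k * ((b - a) / real (N q))))) - wexp l a b p) < r"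
  proof (intro exI[of _ q0] allI impI)
    fix q assume "q0 \<le> q"
    from q0[OF this] have n: "0 < N q" "n0 \<le> N q" by auto
    have "(b - a) / d < real (N q)" using n0 n by linarith
    then have "(b - a) / real (N q) < d" using n d(1) by (simp add: field_simps)
    then have eps: "\<bar>p x - p y\<bar> \<le> r / 2"
      if "x \<in> {a..b}" "y \<in> {a..b}" "\<bar>x - y\<bar> \<le> (b - a) / real (N q)" for x y
      using d(2)[OF that(1,2)] that(3) by (simp add: dist_real_def)
    show "norm ((\<Sum>k<N q. exp (- l * (b - (a + real k * ((b - a) / real (N q))))) *
      (p (a + real (Suc k) * ((b - a) / real (N q))) - p (a + real k * ((b - a) / real (N q))))) - wexp l a b p) < r"
      using riemann_sum_wexp_error[OF pc l a(2) n(1) eps] r by simp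
  qed
qed

section \<open>Random series of functionals of independent fBms\<close>

text \<open>\<open>g\<close> is a general functional of the past: the partial sum gives
  orthogonality of the terms, the partial sum before exit from a band gives the maximal
  inequality.\<close>

lemma (in prob_space) indep_past_times_centered:
  fixes Z :: "nat \<Rightarrow> 'a \<Rightarrow> real"
  assumes ind: "indep_vars (\<lambda>_. borel) Z UNIV"
    and Z: "integrable M (Z k)" "expectation (Z k) = 0"
    and g: "g \<in> borel_measurable (PiM {..<k} (\<lambda>_. borel))"
    and int: "integrable M (\<lambda>\<omega>. g (\<lambda>i\<in>{..<k}. Z i \<omega>))"
  shows "integrable M (\<lambda>\<omega>. g (\<lambda>i\<in>{..<k}. Z i \<omega>) * Z k \<omega>)"
    "expectation (\<lambda>\<omega>. g (\<lambda>i\<in>{..<k}. Z i \<omega>) * Z k \<omega>) = 0"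
proof -
  have "indep_var (PiM {..<k} (\<lambda>_. borel)) (\<lambda>\<omega>. \<lambda>i\<in>{..<k}. Z i \<omega>) (PiM {k} (\<lambda>_. borel)) (\<lambda>\<omega>. \<lambda>i\<in>{k}. Z i \<omega>)"
    by (rule indep_var_restrict[OF ind]) auto
  from indep_var_compose[OF this g, of "\<lambda>f. f k" borel]
  have "indep_var borel (\<lambda>\<omega>. g (\<lambda>i\<in>{..<k}. Z i \<omega>)) borel (Z k)"
    by (simp add: comp_def)
  note ind2 = this
  show "integrable M (\<lambda>\<omega>. g (\<lambda>i\<in>{..<k}. Z i \<omega>) * Z k \<omega>)"
    by (rule indep_var_integrable[OF ind2 int Z(1)])
  show "expectation (\<lambda>\<omega>. g (\<lambda>i\<in>{..<k}. Z i \<omega>) * Z k \<omega>) = 0"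
    using indep_var_lebesgue_integral[OF ind2 int Z(1)] Z(2) by simp
qed

lemma integrable_of_square:
  fixes X :: "'a \<Rightarrow> real"
  assumes "finite_measure M" and [measurable]: "X \<in> borel_measurable M" and X: "integrable M (\<lambda>\<omega>. (X \<omega>)\<^sup>2)"
  shows "integrable M X"
proof (rule Bochner_Integration.integrable_bound[where f = "\<lambda>\<omega>. 1 + (X \<omega>)\<^sup>2"])
  show "integrable M (\<lambda>\<omega>. 1 + (X \<omega>)\<^sup>2)"
    using X finite_measure.integrable_const[OF assms(1)] by (intro Bochner_Integration.integrable_add) auto
  have "\<bar>x\<bar> \<le> 1 + x\<^sup>2" for x :: real
  proof -
    have "0 \<le> (\<bar>x\<bar> - 1)\<^sup>2" by simp
    then have "2 * \<bar>x\<bar> \<le> 1 + x\<^sup>2" by (simp add: power2_diff)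
    then show ?thesis by linarith
  qed
  then show "AE x in M. norm (X x) \<le> norm (1 + (X x)\<^sup>2)" by (auto simp: abs_of_nonneg)
qed measurable

lemma (in prob_space) indep_sum_L2:
  fixes Z :: "nat \<Rightarrow> 'a \<Rightarrow> real"
  assumes ind: "indep_vars (\<lambda>_. borel) Z UNIV"
    and Z: "\<And>k. integrable M (\<lambda>\<omega>. (Z k \<omega>)\<^sup>2)" "\<And>k. expectation (Z k) = 0"
  shows "integrable M (\<lambda>\<omega>. (\<Sum>i<k. Z i \<omega>)\<^sup>2) \<and>
    expectation (\<lambda>\<omega>. (\<Sum>i<k. Z i \<omega>)\<^sup>2) = (\<Sum>i<k. expectation (\<lambda>\<omega>. (Z i \<omega>)\<^sup>2))"
proof (induction k)
  case (Suc k)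
  have [measurable]: "Z k \<in> borel_measurable M" for k
    using ind by (auto simp: indep_vars_def)
  have Z1: "integrable M (Z k)" for k
    by (rule integrable_of_square[OF finite_measure_axioms]) (auto intro: Z)
  note o = indep_past_times_centered[OF ind Z1 Z(2), of "\<lambda>f. \<Sum>i<k. f i" k]
  have 1: "integrable M (\<lambda>\<omega>. (\<Sum>i<k. Z i \<omega>) * Z k \<omega>)" "expectation (\<lambda>\<omega>. (\<Sum>i<k. Z i \<omega>) * Z k \<omega>) = 0"
    using o Z1 by auto
  have eq: "(\<Sum>i<Suc k. Z i \<omega>)\<^sup>2 = (\<Sum>i<k. Z i \<omega>)\<^sup>2 + 2 * ((\<Sum>i<k. Z i \<omega>) * Z k \<omega>) + (Z k \<omega>)\<^sup>2" for \<omega>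
    by (simp add: power2_sum)
  show ?case unfolding eq using Suc 1 Z(1) by simp
qed simp

text \<open>\<open>T\<close> is the partial sum process stopped when it first leaves \<open>(-\<epsilon>, \<epsilon>)\<close>.\<close>

lemma (in prob_space) kolmogorov_maximal_inequality:
  fixes Z :: "nat \<Rightarrow> 'a \<Rightarrow> real"
  assumes ind: "indep_vars (\<lambda>_. borel) Z UNIV"
    and Z: "\<And>k. integrable M (\<lambda>\<omega>. (Z k \<omega>)\<^sup>2)" "\<And>k. expectation (Z k) = 0" and \<epsilon>: "0 < \<epsilon>"
  shows "prob {\<omega>\<in>space M. \<exists>k\<le>n. \<epsilon> \<le> \<bar>\<Sum>i<k. Z i \<omega>\<bar>} \<le> (\<Sum>i<n. expectation (\<lambda>\<omega>. (Z i \<omega>)\<^sup>2)) / \<epsilon>\<^sup>2"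
proof -
  have [measurable]: "Z k \<in> borel_measurable M" for k
    using ind by (auto simp: indep_vars_def)
  have Z1: "integrable M (Z k)" for k
    by (rule integrable_of_square[OF finite_measure_axioms]) (auto intro: Z)
  define S where "S k \<omega> = (\<Sum>i<k. Z i \<omega>)" for k \<omega>
  define G where "G k \<omega> \<longleftrightarrow> (\<forall>j\<le>k. \<bar>S j \<omega>\<bar> < \<epsilon>)" for k \<omega>
  define T where "T k \<omega> = (\<Sum>i<k. if G i \<omega> then Z i \<omega> else 0)" for k \<omega>
  have [measurable]: "S k \<in> borel_measurable M" "Measurable.pred M (G k)" "T k \<in> borel_measurable M" for k
    unfolding S_def G_def T_def by measurable
  \<comment> \<open>Before the exit the stopped sum is the partial sum; afterwards it is frozen at a
    value of modulus at least \<open>\<epsilon>\<close>.\<close>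
  have TG: "if G k \<omega> then T k \<omega> = S k \<omega> else \<epsilon> \<le> \<bar>T k \<omega>\<bar>" for k \<omega>
  proof (induction k)
    case 0
    then show ?case using \<epsilon> by (simp add: G_def T_def S_def)
  next
    case (Suc k)
    then show ?case by (auto simp: G_def T_def S_def le_Suc_eq split: if_splits)
  qed
  have ET: "integrable M (\<lambda>\<omega>. (T k \<omega>)\<^sup>2) \<and> expectation (\<lambda>\<omega>. (T k \<omega>)\<^sup>2) \<le> (\<Sum>i<k. expectation (\<lambda>\<omega>. (Z i \<omega>)\<^sup>2))" for k
  proof (induction k)
    case 0
    then show ?case by (simp add: T_def)
  next
    case (Suc k)
    \<comment> \<open>\<open>G k\<close> and \<open>S k\<close> involve only the \<open>Z i\<close>
      with \<open>i < k\<close>, so the stopped partial sum is a functional of the past; it is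
      bounded by \<open>\<epsilon>\<close>, hence integrable.\<close>
    define g where "g f = (if \<forall>j\<le>k. \<bar>\<Sum>i<j. f i\<bar> < \<epsilon> then \<Sum>i<k. f i else 0)" for f :: "nat \<Rightarrow> real"
    have ms [measurable]: "(\<lambda>f. \<Sum>i<j. f i) \<in> borel_measurable (PiM {..<k} (\<lambda>_. borel :: real measure))" if "j \<le> k" for j
      by (intro borel_measurable_sum measurable_component_singleton) (use that in auto)
    have gm: "g \<in> borel_measurable (PiM {..<k} (\<lambda>_. borel))"
      unfolding g_def by measurable
    have geq: "g (\<lambda>i\<in>{..<k}. Z i \<omega>) = (if G k \<omega> then S k \<omega> else 0)" for \<omega>
    proof -
      have "(\<Sum>i<j. (\<lambda>i\<in>{..<k}. Z i \<omega>) i) = S j \<omega>" if "j \<le> k" for j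
        unfolding S_def by (intro sum.cong) (use that in auto)
      then have "(\<Sum>i<k. (\<lambda>i\<in>{..<k}. Z i \<omega>) i) = S k \<omega>"
        "(\<forall>j\<le>k. \<bar>\<Sum>i<j. (\<lambda>i\<in>{..<k}. Z i \<omega>) i\<bar> < \<epsilon>) \<longleftrightarrow> G k \<omega>"
        by (auto simp: G_def simp del: restrict_apply)
      then show ?thesis unfolding g_def by simp
    qed
    have gint: "integrable M (\<lambda>\<omega>. g (\<lambda>i\<in>{..<k}. Z i \<omega>))"
      unfolding geq
      by (rule integrable_const_bound[where B = \<epsilon>]) (use \<epsilon> in \<open>auto simp: G_def less_imp_le\<close>)
    note o = indep_past_times_centered[OF ind Z1 Z(2) gm gint, unfolded geq]
    have i2: "integrable M (\<lambda>\<omega>. if G k \<omega> then (Z k \<omega>)\<^sup>2 else 0)"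
      by (rule Bochner_Integration.integrable_bound[OF Z(1)[of k]]) auto
    have le2: "expectation (\<lambda>\<omega>. if G k \<omega> then (Z k \<omega>)\<^sup>2 else 0) \<le> expectation (\<lambda>\<omega>. (Z k \<omega>)\<^sup>2)"
      by (rule integral_mono[OF i2 Z(1)]) auto
    have eq: "(T (Suc k) \<omega>)\<^sup>2 = (T k \<omega>)\<^sup>2 + 2 * ((if G k \<omega> then S k \<omega> else 0) * Z k \<omega>) + (if G k \<omega> then (Z k \<omega>)\<^sup>2 else 0)" for \<omega>
      using TG[of k \<omega>] by (auto simp: T_def power2_sum)
    show ?case unfolding eq using Suc o i2 le2 by simp
  qed
  have "prob {\<omega>\<in>space M. \<exists>k\<le>n. \<epsilon> \<le> \<bar>S k \<omega>\<bar>} \<le> prob {\<omega>\<in>space M. (T n \<omega>)\<^sup>2 \<ge> \<epsilon>\<^sup>2}"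
  proof (rule finite_measure_mono)
    show "{\<omega>\<in>space M. \<exists>k\<le>n. \<epsilon> \<le> \<bar>S k \<omega>\<bar>} \<subseteq> {\<omega>\<in>space M. (T n \<omega>)\<^sup>2 \<ge> \<epsilon>\<^sup>2}"
    proof safe
      fix \<omega> k assume "k \<le> n" "\<epsilon> \<le> \<bar>S k \<omega>\<bar>"
      then have "\<not> G n \<omega>" by (force simp: G_def)
      then have "\<epsilon> \<le> \<bar>T n \<omega>\<bar>" using TG[of n \<omega>] by simp
      then show "\<epsilon>\<^sup>2 \<le> (T n \<omega>)\<^sup>2" using \<epsilon> by (simp add: abs_le_square_iff[symmetric])
    qed
  qed measurable
  also have "\<dots> \<le> expectation (\<lambda>\<omega>. (T n \<omega>)\<^sup>2) / \<epsilon>\<^sup>2"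
    using integral_Markov_inequality_measure[of M "\<lambda>\<omega>. (T n \<omega>)\<^sup>2" "{}" "\<epsilon>\<^sup>2"] ET[of n] \<epsilon> by simp
  also have "\<dots> \<le> (\<Sum>i<n. expectation (\<lambda>\<omega>. (Z i \<omega>)\<^sup>2)) / \<epsilon>\<^sup>2"
    using ET[of n] by (intro divide_right_mono) auto
  finally show ?thesis by (simp add: S_def)
qed

text \<open>With the first \<open>m\<close> terms replaced by zero, the maximal inequality bounds
  the probability that the sums after \<open>m\<close> ever move by \<open>\<epsilon>\<close>, in
  terms of a tail of the variance series. The tail vanishes as \<open>m\<close> grows, which forces
  the Cauchy property.\<close>

lemma (in prob_space) kolmogorov_series_convergence:
  fixes Z :: "nat \<Rightarrow> 'a \<Rightarrow> real"
  assumes ind: "indep_vars (\<lambda>_. borel) Z UNIV"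
    and Z: "\<And>k. integrable M (\<lambda>\<omega>. (Z k \<omega>)\<^sup>2)" "\<And>k. expectation (Z k) = 0"
    and sm: "summable (\<lambda>k. expectation (\<lambda>\<omega>. (Z k \<omega>)\<^sup>2))"
  shows "AE \<omega> in M. summable (\<lambda>k. Z k \<omega>)"
proof -
  let ?V = "\<lambda>k. expectation (\<lambda>\<omega>. (Z k \<omega>)\<^sup>2)"
  have [measurable]: "Z k \<in> borel_measurable M" for k
    using ind by (auto simp: indep_vars_def)
  define Y where "Y m i \<omega> = (if i < m then 0 else Z i \<omega>)" for m i \<omega>
  have [measurable]: "Y m i \<in> borel_measurable M" for m i by (simp add: Y_def[abs_def])
  have YS: "(\<Sum>i<n. Y m i \<omega>) = (\<Sum>i<n. Z i \<omega>) - (\<Sum>i<m. Z i \<omega>)" if "m \<le> n" for m n \<omega>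
    using that by (induction rule: dec_induct) (simp_all add: Y_def)
  have tail: "prob {\<omega>\<in>space M. \<exists>k. \<epsilon> \<le> \<bar>\<Sum>i<k. Y m i \<omega>\<bar>} \<le> (\<Sum>i. ?V (i + m)) / \<epsilon>\<^sup>2"
    if \<epsilon>: "0 < \<epsilon>" for \<epsilon> m
  proof -
    have ind': "indep_vars (\<lambda>_. borel) (Y m) UNIV"
      unfolding Y_def by (rule indep_vars_compose2[OF ind, of "\<lambda>i x. if i < m then 0 else x"]) auto
    have Y2: "expectation (\<lambda>\<omega>. (Y m i \<omega>)\<^sup>2) = (if i < m then 0 else ?V i)" for i
      by (simp add: Y_def)
    have Yc: "integrable M (\<lambda>\<omega>. (Y m i \<omega>)\<^sup>2)" "expectation (Y m i) = 0" for i
      using Z by (cases "i < m"; simp add: Y_def[abs_def])+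
    define A where "A n = {\<omega>\<in>space M. \<exists>k\<le>n. \<epsilon> \<le> \<bar>\<Sum>i<k. Y m i \<omega>\<bar>}" for n
    have An: "prob (A n) \<le> (\<Sum>i. ?V (i + m)) / \<epsilon>\<^sup>2" for n
    proof -
      have "prob (A n) \<le> (\<Sum>i<n. if i < m then 0 else ?V i) / \<epsilon>\<^sup>2"
        unfolding A_def Y2[symmetric] by (rule kolmogorov_maximal_inequality[OF ind' Yc \<epsilon>])
      \<comment> \<open>Subtraction is truncated: for \<open>n < m\<close> both sides are
        zero.\<close>
      also have "(\<Sum>i<n. if i < m then 0 else ?V i) = (\<Sum>i<n - m. ?V (i + m))"
        by (induction n) (auto simp: Suc_diff_le not_less)
      also have "\<dots> \<le> (\<Sum>i. ?V (i + m))"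
        by (rule sum_le_suminf) (use summable_ignore_initial_segment[OF sm, of m] in auto)
      finally show ?thesis using \<epsilon> by (simp add: divide_right_mono)
    qed
    have "range A \<subseteq> events" by (auto simp: A_def)
    moreover have "incseq A" unfolding A_def incseq_def by (auto intro: order_trans)
    ultimately have "(\<lambda>n. prob (A n)) \<longlonglongrightarrow> prob (\<Union>n. A n)"
      by (rule finite_Lim_measure_incseq)
    then have "prob (\<Union>n. A n) \<le> (\<Sum>i. ?V (i + m)) / \<epsilon>\<^sup>2"
      by (rule LIMSEQ_le_const2) (use An in auto)
    moreover have "(\<Union>n. A n) = {\<omega>\<in>space M. \<exists>k. \<epsilon> \<le> \<bar>\<Sum>i<k. Y m i \<omega>\<bar>}"
      by (auto simp: A_def)
    ultimately show ?thesis by simp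
  qed
  have lim: "(\<lambda>m. (\<Sum>i. ?V (i + m)) / \<epsilon>\<^sup>2) \<longlonglongrightarrow> 0" for \<epsilon>
    using tendsto_divide_zero[OF suminf_exist_split2[OF sm]] by simp
  have "AE \<omega> in M. \<exists>m. \<forall>k. \<bar>\<Sum>i<k. Y m i \<omega>\<bar> < \<epsilon>" if \<epsilon>: "0 < \<epsilon>" for \<epsilon>
  proof -
    let ?B = "{\<omega>\<in>space M. \<forall>m. \<exists>k. \<epsilon> \<le> \<bar>\<Sum>i<k. Y m i \<omega>\<bar>}"
    have "prob ?B \<le> (\<Sum>i. ?V (i + m)) / \<epsilon>\<^sup>2" for m
    proof -
      have "prob ?B \<le> prob {\<omega>\<in>space M. \<exists>k. \<epsilon> \<le> \<bar>\<Sum>i<k. Y m i \<omega>\<bar>}"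
        by (rule finite_measure_mono) auto
      then show ?thesis using tail[OF \<epsilon>, of m] by linarith
    qed
    then have "prob ?B \<le> 0" using LIMSEQ_le_const[OF lim] by blast
    then have "prob ?B = 0" by (simp add: measure_le_0_iff)
    then have "?B \<in> null_sets M" by (simp add: null_sets_def emeasure_eq_measure)
    then show ?thesis by (rule AE_I') (auto simp: not_less)
  qed
  \<comment> \<open>Countably many thresholds suffice for the Cauchy property and leave a single
    null set.\<close>
  then have "AE \<omega> in M. \<forall>j::nat. \<exists>m. \<forall>k. \<bar>\<Sum>i<k. Y m i \<omega>\<bar> < 1 / real (Suc j)"
    by (simp add: AE_all_countable)
  then show ?thesis
  proof (eventually_elim)
    case (elim \<omega>)
    show "summable (\<lambda>k. Z k \<omega>)"
      unfolding summable_iff_convergent Cauchy_convergent_iff[symmetric]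
    proof (rule metric_CauchyI)
      fix r :: real assume "0 < r"
      then obtain j where j: "1 / real (Suc j) < r / 2"
        using nat_approx_posE[of "r/2"] by auto
      from elim obtain m where m: "\<And>k. \<bar>\<Sum>i<k. Y m i \<omega>\<bar> < 1 / real (Suc j)" by blast
      have S: "\<bar>(\<Sum>i<n. Z i \<omega>) - (\<Sum>i<m. Z i \<omega>)\<bar> < r / 2" if "m \<le> n" for n
        using m[of n] j YS[OF that, of \<omega>] by linarith
      show "\<exists>N. \<forall>x\<ge>N. \<forall>n\<ge>N. dist (\<Sum>i<x. Z i \<omega>) (\<Sum>i<n. Z i \<omega>) < r"
      proof (intro exI[of _ m] allI impI)
        fix x n assume "m \<le> x" "m \<le> n"
        then show "dist (\<Sum>i<x. Z i \<omega>) (\<Sum>i<n. Z i \<omega>) < r"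
          using S[of x] S[of n] unfolding dist_real_def by linarith
      qed
    qed
  qed
qed

section \<open>Passage to the limit in second moments and means\<close>

lemma nn_integral_square_limit_le:
  fixes D :: "nat \<Rightarrow> 'a \<Rightarrow> real"
  assumes [measurable]: "\<And>q. D q \<in> borel_measurable M"
    and conv: "AE \<omega> in M. (\<lambda>q. D q \<omega>) \<longlonglongrightarrow> Z \<omega>"
    and le: "\<And>q. (\<integral>\<^sup>+\<omega>. ennreal ((D q \<omega>)\<^sup>2) \<partial>M) \<le> B"
  shows "(\<integral>\<^sup>+\<omega>. ennreal ((Z \<omega>)\<^sup>2) \<partial>M) \<le> B"
proof -
  have "(\<integral>\<^sup>+\<omega>. ennreal ((Z \<omega>)\<^sup>2) \<partial>M) \<le> (\<integral>\<^sup>+\<omega>. liminf (\<lambda>q. ennreal ((D q \<omega>)\<^sup>2)) \<partial>M)"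
  proof (rule nn_integral_mono_AE)
    show "AE \<omega> in M. ennreal ((Z \<omega>)\<^sup>2) \<le> liminf (\<lambda>q. ennreal ((D q \<omega>)\<^sup>2))"
      using conv
    proof eventually_elim
      case (elim \<omega>)
      have "(\<lambda>q. ennreal ((D q \<omega>)\<^sup>2)) \<longlonglongrightarrow> ennreal ((Z \<omega>)\<^sup>2)"
        by (intro tendsto_ennrealI tendsto_power elim)
      then show ?case using lim_imp_Liminf[OF sequentially_bot] by fastforce
    qed
  qed
  also have "\<dots> \<le> liminf (\<lambda>q. \<integral>\<^sup>+\<omega>. ennreal ((D q \<omega>)\<^sup>2) \<partial>M)"
    by (rule nn_integral_liminf) measurable
  also have "\<dots> \<le> liminf (\<lambda>q. B)" by (intro Liminf_mono always_eventually allI le)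
  also have "\<dots> = B" by (simp add: Liminf_const)
  finally show ?thesis .
qed

text \<open>Fatou's lemma controls the second moment but not the mean. For the mean,
  \<open>Z - D q\<close> is cut off at \<open>K\<close>: the cut-off part tends to zero by dominated
  convergence, and the rest is at most \<open>(Z - D q)^2 / K\<close>, with expectation at most
  \<open>4 * v / K\<close> for every \<open>K > 0\<close>.\<close>

lemma (in prob_space) centered_L2_limit:
  fixes D :: "nat \<Rightarrow> 'a \<Rightarrow> real"
  assumes D [measurable]: "\<And>q. D q \<in> borel_measurable M" and Z [measurable]: "Z \<in> borel_measurable M"
    and conv: "AE \<omega> in M. (\<lambda>q. D q \<omega>) \<longlonglongrightarrow> Z \<omega>"
    and Di: "\<And>q. integrable M (\<lambda>\<omega>. (D q \<omega>)\<^sup>2)" "\<And>q. expectation (D q) = 0"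
    and le: "\<And>q. expectation (\<lambda>\<omega>. (D q \<omega>)\<^sup>2) \<le> v"
  shows "integrable M (\<lambda>\<omega>. (Z \<omega>)\<^sup>2)" "expectation (\<lambda>\<omega>. (Z \<omega>)\<^sup>2) \<le> v" "expectation Z = 0"
proof -
  have v: "0 \<le> v" by (rule order_trans[OF Bochner_Integration.integral_nonneg le[of 0]]) simp
  have nn: "(\<integral>\<^sup>+\<omega>. ennreal ((Z \<omega>)\<^sup>2) \<partial>M) \<le> ennreal v"
    by (rule nn_integral_square_limit_le[OF D conv])
       (simp add: nn_integral_eq_integral[OF Di(1)] ennreal_leI le)
  show Zi: "integrable M (\<lambda>\<omega>. (Z \<omega>)\<^sup>2)"
    by (rule integrableI_nonneg) (auto intro: order.strict_trans1[OF nn])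
  show Ev: "expectation (\<lambda>\<omega>. (Z \<omega>)\<^sup>2) \<le> v"
    using nn v by (simp add: nn_integral_eq_integral[OF Zi])
  have Z1: "integrable M Z" "integrable M (D q)" for q
    by (rule integrable_of_square[OF finite_measure_axioms]; use Zi Di in simp)+
  have "\<bar>expectation Z\<bar> \<le> 4 * v / K" if K: "0 < K" for K
  proof -
    define h where "h q \<omega> = min \<bar>Z \<omega> - D q \<omega>\<bar> K" for q \<omega>
    have [measurable]: "h q \<in> borel_measurable M" for q unfolding h_def by measurable
    have hi: "integrable M (h q)" for q
      by (rule integrable_const_bound[where B = K]) (use K in \<open>auto simp: h_def\<close>)
    have bd: "\<bar>expectation Z\<bar> \<le> expectation (h q) + 4 * v / K" for q
    proof -
      have "\<bar>expectation Z\<bar> = \<bar>expectation (\<lambda>\<omega>. Z \<omega> - D q \<omega>)\<bar>"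
        using Z1 Di(2) by simp
      also have "\<dots> \<le> expectation (\<lambda>\<omega>. \<bar>Z \<omega> - D q \<omega>\<bar>)"
        by (rule integral_abs_bound)
      also have "\<dots> \<le> expectation (\<lambda>\<omega>. h q \<omega> + (2 * (Z \<omega>)\<^sup>2 + 2 * (D q \<omega>)\<^sup>2) / K)"
      proof (rule integral_mono)
        fix \<omega>
        have "(Z \<omega> - D q \<omega>)\<^sup>2 \<le> 2 * (Z \<omega>)\<^sup>2 + 2 * (D q \<omega>)\<^sup>2"
          using zero_le_power2[of "Z \<omega> + D q \<omega>"] by (simp add: power2_sum power2_diff)
        moreover have "\<bar>Z \<omega> - D q \<omega>\<bar> \<le> h q \<omega> + (Z \<omega> - D q \<omega>)\<^sup>2 / K"
        proof (cases "\<bar>Z \<omega> - D q \<omega>\<bar> \<le> K")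
          case True
          then show ?thesis using K by (simp add: h_def)
        next
          case False
          then have "K * \<bar>Z \<omega> - D q \<omega>\<bar> \<le> \<bar>Z \<omega> - D q \<omega>\<bar> * \<bar>Z \<omega> - D q \<omega>\<bar>"
            by (intro mult_right_mono) auto
          then have "\<bar>Z \<omega> - D q \<omega>\<bar> \<le> (Z \<omega> - D q \<omega>)\<^sup>2 / K"
            using K by (simp add: power2_eq_square pos_le_divide_eq mult.commute)
          then show ?thesis using K by (simp add: h_def)
        qed
        ultimately show "\<bar>Z \<omega> - D q \<omega>\<bar> \<le> h q \<omega> + (2 * (Z \<omega>)\<^sup>2 + 2 * (D q \<omega>)\<^sup>2) / K"
          using K divide_right_mono[of "(Z \<omega> - D q \<omega>)\<^sup>2" "2 * (Z \<omega>)\<^sup>2 + 2 * (D q \<omega>)\<^sup>2" K] by linarith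
      qed (use Z1 hi Zi Di in auto)
      also have "\<dots> = expectation (h q) + (2 * expectation (\<lambda>\<omega>. (Z \<omega>)\<^sup>2) + 2 * expectation (\<lambda>\<omega>. (D q \<omega>)\<^sup>2)) / K"
        using hi Zi Di by simp
      also have "\<dots> \<le> expectation (h q) + 4 * v / K"
        using Ev le[of q] K by (intro add_left_mono divide_right_mono) auto
      finally show ?thesis .
    qed
    have "(\<lambda>q. expectation (h q)) \<longlonglongrightarrow> expectation (\<lambda>\<omega>. 0)"
    proof (rule integral_dominated_convergence[where w = "\<lambda>_. K"])
      show "AE \<omega> in M. (\<lambda>q. h q \<omega>) \<longlonglongrightarrow> 0"
        using conv
      proof eventually_elim
        case (elim \<omega>)
        have "(\<lambda>q. min \<bar>Z \<omega> - D q \<omega>\<bar> K) \<longlonglongrightarrow> min \<bar>Z \<omega> - Z \<omega>\<bar> K"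
          by (intro tendsto_intros elim)
        then show ?case using K by (simp add: h_def)
      qed
      show "AE \<omega> in M. norm (h q \<omega>) \<le> K" for q using K by (auto simp: h_def)
    qed auto
    then have "(\<lambda>q. expectation (h q) + 4 * v / K) \<longlonglongrightarrow> 0 + 4 * v / K"
      by (intro tendsto_intros) simp
    from LIMSEQ_le_const[OF this, of "\<bar>expectation Z\<bar>"] show ?thesis using bd by auto
  qed
  note bound = this
  have "\<bar>expectation Z\<bar> \<le> 0"
  proof (rule field_le_epsilon)
    fix r :: real assume "0 < r"
    \<comment> \<open>This is the choice of \<open>K\<close>; the added one keeps it positive when
      \<open>v = 0\<close>.\<close>
    have "4 * v / ((4 * v + 1) / r) \<le> r"
      using \<open>0 < r\<close> v by (simp add: field_simps)
    moreover have "0 < (4 * v + 1) / r" using \<open>0 < r\<close> v by simp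
    ultimately show "\<bar>expectation Z\<bar> \<le> 0 + r" using bound[of "(4 * v + 1) / r"] by linarith
  qed
  then show "expectation Z = 0" by simp
qed

text \<open>\<open>\<Lambda>\<close> is controlled on continuous paths only and need not be
  measurable on the space of all paths. The functional \<open>h\<close>, defined by
  \<open>lim\<close> from finite increment sums, is measurable for the product sigma-algebra, so
  independence of the paths passes to the values \<open>Y n\<close>. Almost surely, for all
  \<open>n\<close> at once, these agree with \<open>\<Lambda>\<close> of the paths.\<close>

lemma (in prob_space) fbm_functional_series:
  fixes w :: "nat \<Rightarrow> real \<Rightarrow> 'a \<Rightarrow> real" and \<phi> :: "nat \<Rightarrow> real" and \<Lambda> :: "(real \<Rightarrow> real) \<Rightarrow> real"
    and g a b :: "nat \<Rightarrow> nat \<Rightarrow> real" and K :: "nat \<Rightarrow> nat"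
  assumes fbm: "\<And>n. is_fbm M H (w n)"
    and ind: "indep_vars (\<lambda>_. Pi\<^sub>M UNIV (\<lambda>_. borel)) (\<lambda>n \<omega> t. w n t \<omega>) UNIV"
    and ab: "\<And>q l. l < K q \<Longrightarrow> 0 \<le> a q l" "\<And>q l. l < K q \<Longrightarrow> 0 \<le> b q l"
    and conv: "\<And>p. continuous_on {0..} p \<Longrightarrow> (\<lambda>q. \<Sum>l<K q. g q l * (p (b q l) - p (a q l))) \<longlonglongrightarrow> \<Lambda> p"
    and le: "\<And>n q. expectation (\<lambda>\<omega>. (\<Sum>l<K q. g q l * (w n (b q l) \<omega> - w n (a q l) \<omega>))\<^sup>2) \<le> v"
    and \<phi>: "summable (\<lambda>n. (\<phi> n)\<^sup>2)"
  shows "\<exists>Z. Z \<in> borel_measurable M \<and> (AE \<omega> in M. (\<lambda>n. \<phi> n * \<Lambda> (\<lambda>t. w n t \<omega>)) sums Z \<omega>) \<and>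
    (\<integral>\<^sup>+\<omega>. ennreal ((Z \<omega>)\<^sup>2) \<partial>M) \<le> ennreal (v * (\<Sum>n. (\<phi> n)\<^sup>2))"
proof -
  define D where "D q p = (\<Sum>l<K q. g q l * (p (b q l) - p (a q l)))" for q and p :: "real \<Rightarrow> real"
  define h where "h p = lim (\<lambda>q. D q p)" for p
  define Y where "Y n \<omega> = h (\<lambda>t. w n t \<omega>)" for n \<omega>
  have Dm [measurable]: "D q \<in> borel_measurable (Pi\<^sub>M UNIV (\<lambda>_. borel))" for q
    unfolding D_def by (intro borel_measurable_sum borel_measurable_times borel_measurable_diff
        measurable_component_singleton) auto
  have hm: "h \<in> borel_measurable (Pi\<^sub>M UNIV (\<lambda>_. borel))"
    unfolding h_def by measurable
  have P [measurable]: "(\<lambda>\<omega> t. w n t \<omega>) \<in> measurable M (Pi\<^sub>M UNIV (\<lambda>_. borel))" for n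
    using ind by (auto simp: indep_vars_def)
  have Ym [measurable]: "Y n \<in> borel_measurable M" for n
    unfolding Y_def using measurable_compose[OF P hm] by simp
  have cont: "AE \<omega> in M. \<forall>n. continuous_on {0..} (\<lambda>t. w n t \<omega>)"
    using fbm by (auto simp: AE_all_countable is_fbm_def)
  have Yc: "AE \<omega> in M. (\<lambda>q. D q (\<lambda>t. w n t \<omega>)) \<longlonglongrightarrow> Y n \<omega>" for n
    using cont
  proof eventually_elim
    case (elim \<omega>)
    then have "(\<lambda>q. D q (\<lambda>t. w n t \<omega>)) \<longlonglongrightarrow> \<Lambda> (\<lambda>t. w n t \<omega>)"
      using conv[of "\<lambda>t. w n t \<omega>"] by (simp add: D_def)
    moreover from limI[OF this] have "Y n \<omega> = \<Lambda> (\<lambda>t. w n t \<omega>)" by (simp add: Y_def h_def)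
    ultimately show ?case by simp
  qed
  have Y\<Lambda>: "AE \<omega> in M. \<forall>n. Y n \<omega> = \<Lambda> (\<lambda>t. w n t \<omega>)"
    using cont
  proof eventually_elim
    case (elim \<omega>)
    then show ?case using conv unfolding Y_def h_def D_def by (auto dest: limI)
  qed
  note fm = fbm_incr_sum_moments[OF fbm ab]
  have DM: "(\<lambda>\<omega>. D q (\<lambda>t. w n t \<omega>)) \<in> borel_measurable M" for q n
    unfolding D_def by (rule fm(1))
  have Y: "integrable M (\<lambda>\<omega>. (Y n \<omega>)\<^sup>2)" "expectation (\<lambda>\<omega>. (Y n \<omega>)\<^sup>2) \<le> v" "expectation (Y n) = 0" for n
    using centered_L2_limit[OF DM Ym Yc, where v = v] fm(4) fm(3) le by (auto simp: D_def)
  define Z where "Z n \<omega> = \<phi> n * Y n \<omega>" for n \<omega>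
  have indZ: "indep_vars (\<lambda>_. borel) Z UNIV"
    unfolding Z_def Y_def
    by (rule indep_vars_compose2[OF ind, of "\<lambda>n p. \<phi> n * h p"]) (use hm in measurable)
  have Zm [measurable]: "Z n \<in> borel_measurable M" for n unfolding Z_def by measurable
  have Zi: "integrable M (\<lambda>\<omega>. (Z n \<omega>)\<^sup>2)" "expectation (Z n) = 0" for n
    using Y by (simp_all add: Z_def[abs_def] power_mult_distrib)
  have Zv: "expectation (\<lambda>\<omega>. (Z n \<omega>)\<^sup>2) \<le> v * (\<phi> n)\<^sup>2" for n
    using mult_left_mono[OF Y(2)[of n], of "(\<phi> n)\<^sup>2"] by (simp add: Z_def power_mult_distrib mult.commute)
  have v: "0 \<le> v" by (rule order_trans[OF Bochner_Integration.integral_nonneg Y(2)[of 0]]) simp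
  have vs: "summable (\<lambda>n. v * (\<phi> n)\<^sup>2)" using \<phi> by (rule summable_mult)
  have "summable (\<lambda>n. expectation (\<lambda>\<omega>. (Z n \<omega>)\<^sup>2))"
    by (rule summable_comparison_test'[OF vs]) (use Zv in auto)
  from kolmogorov_series_convergence[OF indZ Zi this]
  have sm: "AE \<omega> in M. summable (\<lambda>n. Z n \<omega>)" .
  show ?thesis
  proof (intro exI[of _ "\<lambda>\<omega>. \<Sum>n. Z n \<omega>"] conjI)
    show "(\<lambda>\<omega>. \<Sum>n. Z n \<omega>) \<in> borel_measurable M" by measurable
    show "AE \<omega> in M. (\<lambda>n. \<phi> n * \<Lambda> (\<lambda>t. w n t \<omega>)) sums (\<Sum>n. Z n \<omega>)"
      using sm Y\<Lambda>
    proof eventually_elim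
      case (elim \<omega>)
      then show ?case using summable_sums[OF elim(1)] by (simp add: Z_def)
    qed
    show "(\<integral>\<^sup>+\<omega>. ennreal ((\<Sum>n. Z n \<omega>)\<^sup>2) \<partial>M) \<le> ennreal (v * (\<Sum>n. (\<phi> n)\<^sup>2))"
    proof (rule nn_integral_square_limit_le[where D = "\<lambda>q \<omega>. \<Sum>n<q. Z n \<omega>"])
      show "AE \<omega> in M. (\<lambda>q. \<Sum>n<q. Z n \<omega>) \<longlonglongrightarrow> (\<Sum>n. Z n \<omega>)"
        using sm by eventually_elim (rule summable_LIMSEQ)
      fix q
      have *: "integrable M (\<lambda>\<omega>. (\<Sum>n<q. Z n \<omega>)\<^sup>2)"
        "expectation (\<lambda>\<omega>. (\<Sum>n<q. Z n \<omega>)\<^sup>2) = (\<Sum>n<q. expectation (\<lambda>\<omega>. (Z n \<omega>)\<^sup>2))"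
        using indep_sum_L2[OF indZ Zi, of q] by auto
      have "(\<Sum>n<q. expectation (\<lambda>\<omega>. (Z n \<omega>)\<^sup>2)) \<le> (\<Sum>n<q. v * (\<phi> n)\<^sup>2)"
        by (intro sum_mono Zv)
      also have "\<dots> \<le> (\<Sum>n. v * (\<phi> n)\<^sup>2)"
        by (rule sum_le_suminf[OF vs]) (use v in auto)
      also have "\<dots> = v * (\<Sum>n. (\<phi> n)\<^sup>2)" using \<phi> by (rule suminf_mult)
      finally show "(\<integral>\<^sup>+\<omega>. ennreal ((\<Sum>n<q. Z n \<omega>)\<^sup>2) \<partial>M) \<le> ennreal (v * (\<Sum>n. (\<phi> n)\<^sup>2))"
        using * by (simp add: nn_integral_eq_integral ennreal_leI)
    qed measurable
  qed
qed

section \<open>Series for the stochastic convolution\<close>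

text \<open>The single-cell case with constant sequences. The scheme uses each noise increment as a
  \<open>suminf\<close>, and recombining these series over the time steps requires that each of them
  converges.\<close>

lemma (in prob_space) fbm_increment_series:
  fixes w :: "nat \<Rightarrow> real \<Rightarrow> 'a \<Rightarrow> real" and \<phi> :: "nat \<Rightarrow> real"
  assumes fbm: "\<And>n. is_fbm M H (w n)"
    and ind: "indep_vars (\<lambda>_. Pi\<^sub>M UNIV (\<lambda>_. borel)) (\<lambda>n \<omega> t. w n t \<omega>) UNIV"
    and ab: "0 \<le> a" "0 \<le> b" and \<phi>: "summable (\<lambda>n. (\<phi> n)\<^sup>2)"
  shows "AE \<omega> in M. summable (\<lambda>n. \<phi> n * (w n b \<omega> - w n a \<omega>))"
proof -
  have "\<exists>Z. Z \<in> borel_measurable M \<and> (AE \<omega> in M. (\<lambda>n. \<phi> n * ((\<lambda>p. p b - p a) (\<lambda>t. w n t \<omega>))) sums Z \<omega>) \<and>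
    (\<integral>\<^sup>+\<omega>. ennreal ((Z \<omega>)\<^sup>2) \<partial>M) \<le> ennreal (\<bar>b - a\<bar> powr (2*H) * (\<Sum>n. (\<phi> n)\<^sup>2))"
    by (rule fbm_functional_series[OF fbm ind, where K = "\<lambda>_. 1" and g = "\<lambda>_ _. 1" and a = "\<lambda>_ _. a" and b = "\<lambda>_ _. b"])
       (use ab \<phi> in \<open>simp_all add: fbm_incr_L2(2)[OF fbm]\<close>)
  then show ?thesis by (auto elim!: AE_mp simp: sums_iff)
qed

text \<open>Interpolation between the short-time bound and the stationary bound, with the cases
  separated at \<open>l * h = 1\<close>, where the two powers coincide. For
  \<open>2*\<rho> - 2*H = \<beta> - 1\<close> the power of \<open>l\<close> becomes the
  Hilbert-Schmidt weight.\<close>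

lemma powr_interpolation:
  fixes l h H \<rho> :: real
  assumes "0 < l" "0 < h" "0 \<le> \<rho>" "\<rho> \<le> H" "E \<le> h powr (2*H)" "E \<le> 4 * l powr (-2*H)"
  shows "E \<le> 4 * h powr (2*\<rho>) * l powr (2*\<rho> - 2*H)"
proof (cases "l * h \<le> 1")
  case True
  have "E \<le> h powr (2*\<rho>) * h powr (2*H - 2*\<rho>)" using assms by (simp add: powr_add[symmetric])
  also have "h powr (2*H - 2*\<rho>) \<le> (1 / l) powr (2*H - 2*\<rho>)"
    using True assms by (intro powr_mono2) (auto simp: field_simps)
  also have "(1 / l) powr (2*H - 2*\<rho>) = l powr (2*\<rho> - 2*H)"
    using assms by (simp add: powr_divide powr_minus_divide[symmetric])
  finally have *: "E \<le> h powr (2*\<rho>) * l powr (2*\<rho> - 2*H)" by (simp add: mult_left_mono)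
  have "0 \<le> h powr (2*\<rho>) * l powr (2*\<rho> - 2*H)" by simp
  then show ?thesis using * by linarith
next
  case False
  have "4 * l powr (-2*H) = 4 * l powr (-2*\<rho>) * l powr (2*\<rho> - 2*H)"
    by (simp add: powr_add[symmetric])
  also have "l powr (-2*\<rho>) = (1 / l) powr (2*\<rho>)"
    using assms by (simp add: powr_divide powr_minus_divide)
  also have "(1 / l) powr (2*\<rho>) \<le> h powr (2*\<rho>)"
    using False assms by (intro powr_mono2) (auto simp: field_simps)
  finally show ?thesis using assms by (simp add: mult_right_mono)
qed

text \<open>The two terms of the minimum come from the two ways to dominate the kernel: by its
  exponential decay, and by one.\<close>

lemma (in prob_space) fbm_wexp_series:
  fixes w :: "nat \<Rightarrow> real \<Rightarrow> 'a \<Rightarrow> real" and \<phi> :: "nat \<Rightarrow> real"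
  assumes fbm: "\<And>n. is_fbm M H (w n)" and H: "1/2 < H" "H \<le> 1"
    and ind: "indep_vars (\<lambda>_. Pi\<^sub>M UNIV (\<lambda>_. borel)) (\<lambda>n \<omega> t. w n t \<omega>) UNIV"
    and st: "0 \<le> s" "s \<le> t" and l: "0 < l" and \<phi>: "summable (\<lambda>n. (\<phi> n)\<^sup>2)"
  shows "\<exists>Z. Z \<in> borel_measurable M \<and> (AE \<omega> in M. (\<lambda>n. \<phi> n * wexp l s t (\<lambda>r. w n r \<omega>)) sums Z \<omega>) \<and>
    (\<integral>\<^sup>+\<omega>. ennreal ((Z \<omega>)\<^sup>2) \<partial>M) \<le>
      ennreal (min ((t - s) powr (2*H)) (4 * l powr (-2*H)) * (\<Sum>n. (\<phi> n)\<^sup>2))"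
proof (cases "s = t")
  case True
  then show ?thesis by (intro exI[of _ "\<lambda>_. 0"]) auto
next
  case False
  then have st': "s < t" using st by simp
  define \<delta> where "\<delta> q = (t - s) / real (Suc q)" for q
  define x where "x q k = s + real k * \<delta> q" for q k
  have \<delta>: "0 < \<delta> q" for q using st' by (simp add: \<delta>_def)
  have mono: "mono (x q)" for q
    unfolding x_def mono_def using \<delta>[of q] by auto
  have xN: "x q (Suc q) = t" for q by (simp add: x_def \<delta>_def del: of_nat_Suc)
  show ?thesis
  proof (rule fbm_functional_series[OF fbm ind, where K = Suc and g = "\<lambda>q k. exp (- l * (t - x q k))"
        and a = x and b = "\<lambda>q k. x q (Suc k)"])
    show "0 \<le> x q k" "0 \<le> x q (Suc k)" for q k
      using st \<delta>[of q] by (auto simp: x_def)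
    show "(\<lambda>q. \<Sum>k<Suc q. exp (- l * (t - x q k)) * (p (x q (Suc k)) - p (x q k))) \<longlonglongrightarrow> wexp l s t p"
      if "continuous_on {0..} p" for p
      using riemann_sum_tendsto_wexp[OF that _ st, of l Suc] l filterlim_Suc
      by (simp add: x_def \<delta>_def)
    fix n q
    have g: "exp (- l * (t - x q k)) = exp (- (l * \<delta> q) * real (Suc q - k))" if "k < Suc q" for k
    proof -
      have "t - x q k = real (Suc q - k) * \<delta> q"
        using that unfolding xN[of q, symmetric] x_def by (simp add: of_nat_diff algebra_simps)
      then show ?thesis by simp
    qed
    let ?E = "expectation (\<lambda>\<omega>. (\<Sum>k<Suc q. exp (- l * (t - x q k)) * (w n (x q (Suc k)) \<omega> - w n (x q k) \<omega>))\<^sup>2)"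
    \<comment> \<open>The decay per cell is \<open>l * \<delta> q\<close>, so mesh over rate is
      \<open>1 / l\<close> for every refinement.\<close>
    have "?E \<le> 4 * 1\<^sup>2 * (\<delta> q / (l * \<delta> q)) powr (2*H)"
      unfolding x_def
      by (rule fbm_dominated_sum_L2[OF fbm H \<delta>])
         (use st l \<delta>[of q] g in \<open>auto simp: x_def\<close>)
    also have "\<dots> = 4 * l powr (-2*H)"
      using \<delta>[of q] l by (simp add: powr_divide powr_minus_divide)
    finally have 1: "?E \<le> 4 * l powr (-2*H)" .
    have "?E \<le> (x q (Suc q) - x q 0) powr (2*H)"
    proof (rule fbm_bounded_sum_L2[OF fbm H(1) mono])
      show "0 \<le> x q 0" using st by (simp add: x_def)
      show "\<bar>exp (- l * (t - x q k))\<bar> \<le> 1" if "k < Suc q" for k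
        using l monoD[OF mono, of k "Suc q" q] that xN[of q] by (simp add: mult_nonneg_nonneg)
    qed
    then have 2: "?E \<le> (t - s) powr (2*H)" by (simp add: xN) (simp add: x_def)
    show "?E \<le> min ((t - s) powr (2*H)) (4 * l powr (-2*H))"
      using 1 2 by simp
  qed (rule \<phi>)
qed

section \<open>Comparison of the continuous and the discrete convolution on common grids\<close>

text \<open>A weight that is constant on coarse cells gives the same sum on every refinement, so the
  discrete convolution can be written on the grids that approximate the Wiener integral.\<close>

lemma sum_piecewise_constant_telescope:
  fixes G :: "nat \<Rightarrow> real" and f :: "nat \<Rightarrow> real"
  assumes "0 < q"
  shows "(\<Sum>l<m*q. G (l div q) * (f (Suc l) - f l)) = (\<Sum>k<m. G k * (f (Suc k * q) - f (k * q)))"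
proof -
  have "(\<Sum>l<m*q. G (l div q) * (f (Suc l) - f l)) =
      (\<Sum>k<m. \<Sum>l\<in>{k*q..<k*q+q}. G (l div q) * (f (Suc l) - f l))"
    by (rule sum.nat_group[symmetric])
  also have "\<dots> = (\<Sum>k<m. \<Sum>l\<in>{k*q..<k*q+q}. G k * (f (Suc l) - f l))"
  proof (intro sum.cong refl)
    fix k l assume "l \<in> {k*q..<k*q+q}"
    then have "l div q = k" using assms by (intro div_nat_eqI) (auto simp: mult.commute)
    then show "G (l div q) * (f (Suc l) - f l) = G k * (f (Suc l) - f l)" by simp
  qed
  also have "\<dots> = (\<Sum>k<m. G k * (f (Suc k * q) - f (k * q)))"
    by (intro sum.cong refl) (simp add: sum_distrib_left[symmetric] sum_Suc_diff' add.commute)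
  finally show ?thesis .
qed

text \<open>\<open>(m*q - k) / q\<close> is the time from the fine node \<open>k\<close> to the end,
  in units of the coarse step. It lies within one unit below \<open>m - k div q\<close>, which is
  what the kernel comparison requires of \<open>x\<close> and \<open>j\<close>.\<close>

lemma cell_index_bounds:
  fixes k m q :: nat
  assumes "0 < q" "k < m * q"
  shows "k div q < m" "real (m - k div q) - 1 \<le> real (m*q - k) / real q" "real (m*q - k) / real q \<le> real (m - k div q)"
proof -
  show d: "k div q < m" using assms by (simp add: less_mult_imp_div_less)
  have 1: "real k / real q = real (k div q) + real (k mod q) / real q"
    using assms by (simp add: field_simps flip: of_nat_mult of_nat_add)
  have 2: "0 \<le> real (k mod q) / real q" "real (k mod q) / real q \<le> 1"
    using assms by (auto intro: less_imp_le)
  have 3: "real (m*q - k) / real q = real m - real k / real q"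
    using assms by (simp add: of_nat_diff field_simps)
  show "real (m - k div q) - 1 \<le> real (m*q - k) / real q" "real (m*q - k) / real q \<le> real (m - k div q)"
    unfolding 3 1 using 2 d by (auto simp: of_nat_diff)
qed

text \<open>For \<open>z = \<tau> * l \<le> 1\<close> the difference of the kernels is small of
  order \<open>z\<close>. For larger \<open>z\<close> nothing is gained from the difference, and
  both convolutions are estimated separately by a multiple of \<open>l powr (-2*H)\<close>. Both
  cases fit under \<open>z powr (2*\<rho>)\<close> because
  \<open>0 \<le> 2*\<rho> \<le> 2\<close>.\<close>

lemma (in prob_space) wexp_resolvent_grid_error:
  fixes m q :: nat
  assumes fbm: "is_fbm M H w" and H: "1/2 < H" "H \<le> 1" and l: "0 < l" and \<tau>: "0 < \<tau>" and q: "0 < q"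
    and \<rho>: "0 \<le> \<rho>" "\<rho> \<le> H"
  defines "g \<equiv> \<lambda>k. exp (- l * (real m * \<tau> - real k * (\<tau> / real q))) - (1 / (1 + \<tau> * l)) ^ (m - k div q)"
  shows "expectation (\<lambda>\<omega>. (\<Sum>k<m*q. g k * (w (real (Suc k) * (\<tau> / real q)) \<omega> - w (real k * (\<tau> / real q)) \<omega>))\<^sup>2)
    \<le> 1024 * \<tau> powr (2*\<rho>) * l powr (2*\<rho> - 2*H)"
proof -
  define z where "z = \<tau> * l"
  define \<delta> where "\<delta> = \<tau> / real q"
  have z: "0 < z" and \<delta>: "0 < \<delta>" using l \<tau> q by (auto simp: z_def \<delta>_def)
  define \<Delta> where "\<Delta> k \<omega> = w (real (Suc k) * \<delta>) \<omega> - w (real k * \<delta>) \<omega>" for k \<omega>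
  have e: "exp (- l * (real m * \<tau> - real k * \<delta>)) = exp (- z * (real (m*q - k) / real q))"
    if "k < m * q" for k
  proof -
    have "l * (real m * \<tau> - real k * \<delta>) = z * (real (m*q - k) / real q)"
      using that q by (simp add: \<delta>_def z_def of_nat_diff field_simps)
    then show ?thesis by (simp only: mult_minus_left)
  qed
  have dom: "expectation (\<lambda>\<omega>. (\<Sum>k<m*q. f k * \<Delta> k \<omega>)\<^sup>2) \<le> 4 * K\<^sup>2 * (\<delta> / c) powr (2*H)"
    if "\<And>k. k < m*q \<Longrightarrow> \<bar>f k\<bar> \<le> K * exp (- c * real (m*q - k))" "0 < c" "0 \<le> K" for f c K
    using fbm_dominated_sum_L2[OF fbm H \<delta> that(2) order_refl that(1,3)] by (simp add: \<Delta>_def)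
  have lz: "l powr (-2*H) * z powr (2*\<rho>) = \<tau> powr (2*\<rho>) * l powr (2*\<rho> - 2*H)"
  proof -
    have "l powr (-2*H) * z powr (2*\<rho>) = \<tau> powr (2*\<rho>) * (l powr (2*\<rho>) * l powr (-2*H))"
      using l \<tau> by (simp add: z_def powr_mult)
    then show ?thesis by (simp add: powr_add[symmetric])
  qed
  have "expectation (\<lambda>\<omega>. (\<Sum>k<m*q. g k * \<Delta> k \<omega>)\<^sup>2) \<le> 1024 * (l powr (-2*H) * z powr (2*\<rho>))"
  proof (cases "z \<le> 1")
    case True
    have "\<bar>g k\<bar> \<le> 4 * z * exp (- (z / (4 * real q)) * real (m*q - k))" if k: "k < m*q" for k
    proof -
      note b = cell_index_bounds[OF q k]
      have "\<bar>g k\<bar> \<le> 4 * z * exp (- z * real (m - k div q) / 4)"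
        unfolding g_def \<delta>_def[symmetric] e[OF k] z_def[symmetric]
        by (rule exp_resolvent_diff_small) (use z True b in auto)
      also have "\<dots> \<le> 4 * z * exp (- (z / (4 * real q)) * real (m*q - k))"
        using mult_left_mono[OF b(3), of z] z by (intro mult_left_mono) (auto simp: field_simps)
      finally show ?thesis .
    qed
    from dom[OF this] z q
    have "expectation (\<lambda>\<omega>. (\<Sum>k<m*q. g k * \<Delta> k \<omega>)\<^sup>2) \<le> 4 * (4 * z)\<^sup>2 * (\<delta> / (z / (4 * real q))) powr (2*H)"
      by simp
    also have "\<delta> / (z / (4 * real q)) = 4 / l"
      using q \<tau> l by (simp add: \<delta>_def z_def field_simps)
    also have "(4 / l) powr (2*H) \<le> 16 * l powr (-2*H)"
    proof -
      have "(4::real) powr (2*H) \<le> 4 powr 2" using H by (intro powr_mono) auto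
      then show ?thesis using l by (simp add: powr_divide powr_minus_divide divide_right_mono)
    qed
    \<comment> \<open>The constant is \<open>4 * 16 * 16\<close>: from the exponentially weighted
      sum, from the square of the bound \<open>4 * z\<close>, and from
      \<open>4 powr (2*H) \<le> 16\<close>, the cost of the quarter in the decay rate.\<close>
    also have "4 * (4 * z)\<^sup>2 * (16 * l powr (-2*H)) = 1024 * (l powr (-2*H) * z\<^sup>2)"
      by (simp add: power2_eq_square)
    also have "z\<^sup>2 \<le> z powr (2*\<rho>)"
      using powr_mono'[of "2*\<rho>" 2 z] z True \<rho> H by simp
    finally show ?thesis by (simp add: mult_left_mono)
  next
    case False
    define f1 where "f1 k = exp (- l * (real m * \<tau> - real k * \<delta>))" for k
    define f2 where "f2 k = (1 / (1 + z)) ^ (m - k div q)" for k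
    let ?S = "\<lambda>f \<omega>. \<Sum>k<m*q. f k * \<Delta> k \<omega>"
    have i: "integrable M (\<lambda>\<omega>. (?S f \<omega>)\<^sup>2)" for f
      unfolding \<Delta>_def by (rule fbm_incr_sum_moments(4)[OF fbm]) (use \<delta> in auto)
    have "expectation (\<lambda>\<omega>. (?S g \<omega>)\<^sup>2) \<le> expectation (\<lambda>\<omega>. 2 * (?S f1 \<omega>)\<^sup>2 + 2 * (?S f2 \<omega>)\<^sup>2)"
    proof (rule integral_mono)
      fix \<omega>
      have "?S g \<omega> = ?S f1 \<omega> - ?S f2 \<omega>"
        unfolding sum_subtractf[symmetric]
        by (intro sum.cong refl) (simp add: g_def f1_def f2_def z_def \<delta>_def algebra_simps)
      moreover have "(a - b)\<^sup>2 \<le> 2 * a\<^sup>2 + 2 * b\<^sup>2" for a b :: real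
        using zero_le_power2[of "a + b"] by (simp add: power2_sum power2_diff)
      ultimately show "(?S g \<omega>)\<^sup>2 \<le> 2 * (?S f1 \<omega>)\<^sup>2 + 2 * (?S f2 \<omega>)\<^sup>2" by simp
    qed (use i in auto)
    also have "\<dots> = 2 * expectation (\<lambda>\<omega>. (?S f1 \<omega>)\<^sup>2) + 2 * expectation (\<lambda>\<omega>. (?S f2 \<omega>)\<^sup>2)"
      using i[of f1] i[of f2] by simp
    also have "expectation (\<lambda>\<omega>. (?S f1 \<omega>)\<^sup>2) \<le> 4 * l powr (-2*H)"
    proof -
      have "expectation (\<lambda>\<omega>. (?S f1 \<omega>)\<^sup>2) \<le> 4 * 1\<^sup>2 * (\<delta> / (z / real q)) powr (2*H)"
      proof (rule dom)
        fix k assume k: "k < m*q"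
        show "\<bar>f1 k\<bar> \<le> 1 * exp (- (z / real q) * real (m*q - k))"
          unfolding f1_def e[OF k] by simp
      qed (use z q in auto)
      also have "\<delta> / (z / real q) = 1 / l" using q \<tau> l by (simp add: \<delta>_def z_def field_simps)
      finally show ?thesis using l by (simp add: powr_divide powr_minus_divide)
    qed
    also have "expectation (\<lambda>\<omega>. (?S f2 \<omega>)\<^sup>2) \<le> 64 * l powr (-2*H)"
    proof -
      have "expectation (\<lambda>\<omega>. (?S f2 \<omega>)\<^sup>2) \<le> 4 * (2 / (1 + z))\<^sup>2 * (\<delta> / (ln 2 / real q)) powr (2*H)"
      proof (rule dom)
        fix k assume k: "k < m*q"
        note b = cell_index_bounds[OF q k]
        have "\<bar>f2 k\<bar> \<le> 2 / (1 + z) * exp (- ln 2 * real (m - k div q))"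
          using resolvent_power_large[of z "m - k div q"] False b(1) z by (simp add: f2_def)
        also have "\<dots> \<le> 2 / (1 + z) * exp (- (ln 2 / real q) * real (m*q - k))"
          using mult_left_mono[OF b(3), of "ln 2"] z
          by (intro mult_left_mono) auto
        finally show "\<bar>f2 k\<bar> \<le> 2 / (1 + z) * exp (- (ln 2 / real q) * real (m*q - k))" .
      qed (use z q in auto)
      also have "\<delta> / (ln 2 / real q) = \<tau> / ln 2" using q by (simp add: \<delta>_def)
      also have "(\<tau> / ln 2) powr (2*H) \<le> (2 * \<tau>) powr (2*H)"
      proof (rule powr_mono2)
        have "1 / 2 \<le> ln (2::real)" using ln2_ge_two_thirds by simp
        then show "\<tau> / ln 2 \<le> 2 * \<tau>" using \<tau> by (simp add: field_simps)
      qed (use H \<tau> in auto)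
      also have "(2 * \<tau>) powr (2*H) \<le> 4 * \<tau> powr (2*H)"
      proof -
        have "(2::real) powr (2*H) \<le> 2 powr 2" using H by (intro powr_mono) auto
        then show ?thesis using \<tau> by (simp add: powr_mult mult_right_mono)
      qed
      also have "(2 / (1 + z))\<^sup>2 \<le> (2 / z)\<^sup>2"
        using z by (intro power_mono divide_left_mono) auto
      also have "4 * (2 / z)\<^sup>2 * (4 * \<tau> powr (2*H)) = 64 * (z powr (-2) * \<tau> powr (2*H))"
        using z by (simp add: powr_minus_divide power_divide)
      \<comment> \<open>Here the factor \<open>1 / (1 + z)\<close> kept in
        \<open>resolvent_power_large\<close> pays: since \<open>H \<le> 1\<close>, its square
        converts \<open>\<tau> powr (2*H)\<close> into \<open>l powr (-2*H)\<close>.\<close>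
      also have "z powr (-2) \<le> z powr (-2*H)" using False H by (intro powr_mono) auto
      also have "z powr (-2*H) * \<tau> powr (2*H) = l powr (-2*H)"
      proof -
        have "\<tau> powr (-2*H) * \<tau> powr (2*H) = 1" using \<tau> by (simp add: powr_add[symmetric])
        then show ?thesis using \<tau> l by (simp add: z_def powr_mult)
      qed
      finally show ?thesis by (simp add: mult_left_mono mult_right_mono)
    qed
    also have "2 * (4 * l powr (-2*H)) + 2 * (64 * l powr (-2*H)) \<le> 1024 * (l powr (-2*H) * 1)"
      using powr_ge_zero[of l "-2*H"] by linarith
    also have "\<dots> \<le> 1024 * (l powr (-2*H) * z powr (2*\<rho>))"
      using False \<rho> by (intro mult_left_mono ge_one_powr_ge_zero) auto
    finally show ?thesis by simp
  qed
  then show ?thesis unfolding lz \<Delta>_def \<delta>_def by simp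
qed

text \<open>On the grids of \<open>m * Suc q\<close> cells the exponential part converges to the
  Wiener integral, while the resolvent part does not change with \<open>q\<close>. For
  \<open>m = 0\<close> there is no grid and both convolutions vanish.\<close>

lemma (in prob_space) fbm_scheme_error_series:
  fixes w :: "nat \<Rightarrow> real \<Rightarrow> 'a \<Rightarrow> real" and \<phi> :: "nat \<Rightarrow> real" and m :: nat
  assumes fbm: "\<And>n. is_fbm M H (w n)" and H: "1/2 < H" "H \<le> 1"
    and ind: "indep_vars (\<lambda>_. Pi\<^sub>M UNIV (\<lambda>_. borel)) (\<lambda>n \<omega> t. w n t \<omega>) UNIV"
    and l: "0 < l" and \<tau>: "0 < \<tau>" and \<phi>: "summable (\<lambda>n. (\<phi> n)\<^sup>2)" and \<rho>: "0 \<le> \<rho>" "\<rho> \<le> H"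
  shows "\<exists>Z. Z \<in> borel_measurable M \<and>
    (AE \<omega> in M. (\<lambda>n. \<phi> n * (wexp l 0 (real m * \<tau>) (\<lambda>r. w n r \<omega>) -
      (\<Sum>k<m. (1 / (1 + \<tau> * l)) ^ (m - k) * (w n (real (Suc k) * \<tau>) \<omega> - w n (real k * \<tau>) \<omega>)))) sums Z \<omega>) \<and>
    (\<integral>\<^sup>+\<omega>. ennreal ((Z \<omega>)\<^sup>2) \<partial>M) \<le>
      ennreal (1024 * \<tau> powr (2*\<rho>) * l powr (2*\<rho> - 2*H) * (\<Sum>n. (\<phi> n)\<^sup>2))"
proof (cases "m = 0")
  case True
  then show ?thesis by (intro exI[of _ "\<lambda>_. 0"]) auto
next
  case False
  define x where "x q k = real k * (\<tau> / real (Suc q))" for q k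
  define g where "g q k = exp (- l * (real m * \<tau> - x q k)) - (1 / (1 + \<tau> * l)) ^ (m - k div Suc q)" for q k
  show ?thesis
  proof (rule fbm_functional_series[OF fbm ind, where K = "\<lambda>q. m * Suc q" and g = g and a = x and b = "\<lambda>q k. x q (Suc k)"
        and \<Lambda> = "\<lambda>p. wexp l 0 (real m * \<tau>) p -
      (\<Sum>k<m. (1 / (1 + \<tau> * l)) ^ (m - k) * (p (real (Suc k) * \<tau>) - p (real k * \<tau>)))"])
    show "0 \<le> x q k" "0 \<le> x q (Suc k)" for q k
      using \<tau> by (auto simp: x_def)
    show "expectation (\<lambda>\<omega>. (\<Sum>k<m * Suc q. g q k * (w n (x q (Suc k)) \<omega> - w n (x q k) \<omega>))\<^sup>2)
      \<le> 1024 * \<tau> powr (2*\<rho>) * l powr (2*\<rho> - 2*H)" for n q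
      using wexp_resolvent_grid_error[OF fbm H l \<tau> _ \<rho>, of "Suc q" m n] by (simp add: g_def x_def del: of_nat_Suc)
    fix p :: "real \<Rightarrow> real" assume p: "continuous_on {0..} p"
    have xx: "0 + real k * ((real m * \<tau> - 0) / real (m * Suc q)) = x q k" for q k
      using False unfolding x_def of_nat_mult by (simp del: of_nat_Suc)
    have "filterlim (\<lambda>q. m * Suc q) at_top sequentially"
      using False by (intro filterlim_at_top_mono[OF filterlim_Suc] always_eventually) (simp del: mult_Suc_right)
    from riemann_sum_tendsto_wexp[OF p _ order_refl _ this, of l "real m * \<tau>"] l \<tau>
    have "(\<lambda>q. \<Sum>k<m * Suc q. exp (- l * (real m * \<tau> - x q k)) * (p (x q (Suc k)) - p (x q k)))
        \<longlonglongrightarrow> wexp l 0 (real m * \<tau>) p"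
      unfolding xx by simp
    moreover have "(\<Sum>k<m * Suc q. g q k * (p (x q (Suc k)) - p (x q k))) =
        (\<Sum>k<m * Suc q. exp (- l * (real m * \<tau> - x q k)) * (p (x q (Suc k)) - p (x q k))) -
        (\<Sum>k<m. (1 / (1 + \<tau> * l)) ^ (m - k) * (p (real (Suc k) * \<tau>) - p (real k * \<tau>)))" for q
    proof -
      have "(\<Sum>k<m * Suc q. (1 / (1 + \<tau> * l)) ^ (m - k div Suc q) * (p (x q (Suc k)) - p (x q k))) =
          (\<Sum>k<m. (1 / (1 + \<tau> * l)) ^ (m - k) * (p (x q (Suc k * Suc q)) - p (x q (k * Suc q))))"
        by (rule sum_piecewise_constant_telescope) simp
      also have "\<dots> = (\<Sum>k<m. (1 / (1 + \<tau> * l)) ^ (m - k) * (p (real (Suc k) * \<tau>) - p (real k * \<tau>)))"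
      proof -
        have "x q (k * Suc q) = real k * \<tau>" for k
          unfolding x_def of_nat_mult by simp
        then show ?thesis by (simp only:)
      qed
      finally show ?thesis by (simp add: g_def left_diff_distrib sum_subtractf)
    qed
    ultimately show "(\<lambda>q. \<Sum>k<m * Suc q. g q k * (p (x q (Suc k)) - p (x q k))) \<longlonglongrightarrow>
        wexp l 0 (real m * \<tau>) p -
        (\<Sum>k<m. (1 / (1 + \<tau> * l)) ^ (m - k) * (p (real (Suc k) * \<tau>) - p (real k * \<tau>)))"
      by (auto intro!: tendsto_intros)
  qed (rule \<phi>)
qed

section \<open>Drift integrals and Gronwall inequalities\<close>

lemma ennreal_add_square_le: "(a + b)\<^sup>2 \<le> 2 * a\<^sup>2 + 2 * b\<^sup>2" for a b :: ennreal
proof (cases a; cases b)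
  fix x y :: real assume xy: "0 \<le> x" "a = ennreal x" "0 \<le> y" "b = ennreal y"
  have "(x + y)\<^sup>2 \<le> 2 * x\<^sup>2 + 2 * y\<^sup>2"
    using zero_le_power2[of "x - y"] by (simp add: power2_sum power2_diff)
  then have "ennreal ((x + y)\<^sup>2) \<le> ennreal (2 * x\<^sup>2 + 2 * y\<^sup>2)" by (rule ennreal_leI)
  also have "\<dots> = 2 * a\<^sup>2 + 2 * b\<^sup>2"
    using xy by (simp add: ennreal_mult ennreal_power)
  also have "ennreal ((x + y)\<^sup>2) = (a + b)\<^sup>2"
    using xy by (simp add: ennreal_power[symmetric])
  finally show ?thesis .
qed (auto simp: power2_eq_square ennreal_mult_top ennreal_top_mult)

lemma nn_integral_weighted_square_le:
  fixes k f :: "'a \<Rightarrow> real"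
  assumes [measurable]: "k \<in> borel_measurable M" "f \<in> borel_measurable M" and k: "\<And>x. 0 \<le> k x"
  shows "(\<integral>\<^sup>+x. ennreal (k x * \<bar>f x\<bar>) \<partial>M)\<^sup>2 \<le> (\<integral>\<^sup>+x. ennreal (k x) \<partial>M) * (\<integral>\<^sup>+x. ennreal (k x) * ennreal ((f x)\<^sup>2) \<partial>M)"
proof -
  have "(\<integral>\<^sup>+x. ennreal (k x * \<bar>f x\<bar>) \<partial>M) = (\<integral>\<^sup>+x. ennreal (sqrt (k x)) * ennreal (sqrt (k x) * \<bar>f x\<bar>) \<partial>M)"
    using k by (intro nn_integral_cong) (simp add: ennreal_mult[symmetric] mult.assoc[symmetric])
  also have "\<dots>\<^sup>2 \<le> (\<integral>\<^sup>+x. (ennreal (sqrt (k x)))\<^sup>2 \<partial>M) * (\<integral>\<^sup>+x. (ennreal (sqrt (k x) * \<bar>f x\<bar>))\<^sup>2 \<partial>M)"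
    by (rule Cauchy_Schwarz_nn_integral) measurable
  also have "\<dots> = (\<integral>\<^sup>+x. ennreal (k x) \<partial>M) * (\<integral>\<^sup>+x. ennreal (k x) * ennreal ((f x)\<^sup>2) \<partial>M)"
    using k by (simp add: ennreal_power power_mult_distrib ennreal_mult')
  finally show ?thesis .
qed

text \<open>No measurability or absolute integrability of \<open>G\<close> is needed: a Henstock--Kurzweil integral
  is dominated by the Lebesgue integral of any measurable majorant, even if the latter is infinite.\<close>

lemma has_integral_le_nn_integral:
  fixes G h :: "real \<Rightarrow> real"
  assumes G: "(G has_integral Y) S" and [measurable]: "h \<in> borel_measurable borel" "S \<in> sets borel"
    and h: "\<And>s. 0 \<le> h s" and le: "\<And>s. s \<in> S \<Longrightarrow> \<bar>G s\<bar> \<le> h s"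
  shows "ennreal \<bar>Y\<bar> \<le> (\<integral>\<^sup>+s\<in>S. ennreal (h s) \<partial>lborel)"
proof (cases "(\<integral>\<^sup>+s\<in>S. ennreal (h s) \<partial>lborel)")
  case (real r)
  have eq: "(\<integral>\<^sup>+s. ennreal (h s * indicator S s) \<partial>lborel) = ennreal r"
    unfolding real(2)[symmetric] by (intro nn_integral_cong) (auto simp: indicator_def)
  have "((\<lambda>s. h s * indicator S s) has_integral r) UNIV"
    by (rule nn_integral_has_integral[OF _ _ eq]) (use real h in auto)
  moreover have "((\<lambda>s. if s \<in> S then G s else 0) has_integral Y) UNIV"
    using G by simp
  moreover have "norm (if s \<in> S then G s else 0) \<le> (h s * indicator S s) \<bullet> 1" for s
    using le[of s] by (auto simp: indicator_def)
  ultimately have "norm Y \<le> r \<bullet> 1"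
    using has_integral_norm_bound_integral_component[of "\<lambda>s. if s \<in> S then G s else 0" Y UNIV
        "\<lambda>s. h s * indicator S s" r 1] by blast
  then have "\<bar>Y\<bar> \<le> r" by simp
  then show ?thesis unfolding real(2) by (rule ennreal_leI)
qed simp

text \<open>\<open>k1\<close> is meant for a difference of kernels against the drift,
  \<open>k2\<close> for a bounded kernel against a difference of drifts. Cauchy-Schwarz is taken in
  the measure with density \<open>k\<close>, and Tonelli moves the expectation inside; only the
  integral of the kernel has to be finite, not that of its square.\<close>

lemma (in prob_space) drift_L2_bound:
  fixes k1 k2 :: "real \<Rightarrow> real" and f1 f2 G :: "real \<Rightarrow> 'a \<Rightarrow> real"
  assumes k [measurable]: "k1 \<in> borel_measurable borel" "k2 \<in> borel_measurable borel"
    and f [measurable]: "(\<lambda>p. f1 (fst p) (snd p)) \<in> borel_measurable (lborel \<Otimes>\<^sub>M M)"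
      "(\<lambda>p. f2 (fst p) (snd p)) \<in> borel_measurable (lborel \<Otimes>\<^sub>M M)"
    and k0: "\<And>s. 0 \<le> k1 s" "\<And>s. 0 \<le> k2 s"
    and G: "AE \<omega> in M. ((\<lambda>s. G s \<omega>) has_integral Y \<omega>) {0..t}"
    and le: "\<And>s \<omega>. s \<in> {0..t} \<Longrightarrow> \<bar>G s \<omega>\<bar> \<le> k1 s * \<bar>f1 s \<omega>\<bar> + k2 s * \<bar>f2 s \<omega>\<bar>"
  shows "(\<integral>\<^sup>+\<omega>. ennreal ((Y \<omega>)\<^sup>2) \<partial>M) \<le>
    2 * ((\<integral>\<^sup>+s\<in>{0..t}. ennreal (k1 s) \<partial>lborel) *
      (\<integral>\<^sup>+s\<in>{0..t}. ennreal (k1 s) * (\<integral>\<^sup>+\<omega>. ennreal ((f1 s \<omega>)\<^sup>2) \<partial>M) \<partial>lborel)) +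
    2 * ((\<integral>\<^sup>+s\<in>{0..t}. ennreal (k2 s) \<partial>lborel) *
      (\<integral>\<^sup>+s\<in>{0..t}. ennreal (k2 s) * (\<integral>\<^sup>+\<omega>. ennreal ((f2 s \<omega>)\<^sup>2) \<partial>M) \<partial>lborel))"
proof -
  interpret L: pair_sigma_finite lborel M ..
  have sec: "(\<lambda>s. f s \<omega>) \<in> borel_measurable lborel"
    if "(\<lambda>p. f (fst p) (snd p)) \<in> borel_measurable (lborel \<Otimes>\<^sub>M M)" "\<omega> \<in> space M" for f \<omega>
    using measurable_compose[OF measurable_Pair2'[OF that(2), of lborel] that(1)] by simp
  define W where "W k f \<omega> = (\<integral>\<^sup>+s\<in>{0..t}. ennreal (k s) \<partial>lborel) * (\<integral>\<^sup>+s\<in>{0..t}. ennreal (k s) * ennreal ((f s \<omega>)\<^sup>2) \<partial>lborel)"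
    for k :: "real \<Rightarrow> real" and f :: "real \<Rightarrow> 'a \<Rightarrow> real" and \<omega>
  have one: "(\<integral>\<^sup>+s\<in>{0..t}. ennreal (k s * \<bar>f s \<omega>\<bar>) \<partial>lborel)\<^sup>2 \<le> W k f \<omega>"
    if [measurable]: "k \<in> borel_measurable borel" "(\<lambda>s. f s \<omega>) \<in> borel_measurable lborel" and "\<And>s. 0 \<le> k s" for k f \<omega>
  proof -
    have [measurable]: "(\<lambda>s. f s \<omega>) \<in> borel_measurable borel" using that(2) by simp
    have "(\<integral>\<^sup>+s. ennreal ((indicator {0..t} s * k s) * \<bar>f s \<omega>\<bar>) \<partial>lborel)\<^sup>2 \<le>
        (\<integral>\<^sup>+s. ennreal (indicator {0..t} s * k s) \<partial>lborel) *
        (\<integral>\<^sup>+s. ennreal (indicator {0..t} s * k s) * ennreal ((f s \<omega>)\<^sup>2) \<partial>lborel)"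
      by (rule nn_integral_weighted_square_le) (use that in auto)
    also have "(\<integral>\<^sup>+s. ennreal (indicator {0..t} s * k s) \<partial>lborel) = (\<integral>\<^sup>+s\<in>{0..t}. ennreal (k s) \<partial>lborel)"
      by (intro nn_integral_cong) (auto simp: indicator_def)
    also have "(\<integral>\<^sup>+s. ennreal (indicator {0..t} s * k s) * ennreal ((f s \<omega>)\<^sup>2) \<partial>lborel) =
        (\<integral>\<^sup>+s\<in>{0..t}. ennreal (k s) * ennreal ((f s \<omega>)\<^sup>2) \<partial>lborel)"
      by (intro nn_integral_cong) (auto simp: indicator_def)
    also have "(\<integral>\<^sup>+s. ennreal ((indicator {0..t} s * k s) * \<bar>f s \<omega>\<bar>) \<partial>lborel) =
        (\<integral>\<^sup>+s\<in>{0..t}. ennreal (k s * \<bar>f s \<omega>\<bar>) \<partial>lborel)"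
      by (intro nn_integral_cong) (auto simp: indicator_def)
    finally show ?thesis by (simp add: W_def)
  qed
  have Wint: "(\<integral>\<^sup>+\<omega>. W k f \<omega> \<partial>M) = (\<integral>\<^sup>+s\<in>{0..t}. ennreal (k s) \<partial>lborel) *
      (\<integral>\<^sup>+s\<in>{0..t}. ennreal (k s) * (\<integral>\<^sup>+\<omega>. ennreal ((f s \<omega>)\<^sup>2) \<partial>M) \<partial>lborel)"
    and Wm: "W k f \<in> borel_measurable M"
    if [measurable]: "k \<in> borel_measurable borel" "(\<lambda>p. f (fst p) (snd p)) \<in> borel_measurable (lborel \<Otimes>\<^sub>M M)" for k f
  proof -
    have m: "(\<lambda>p. ennreal (k (fst p)) * ennreal ((f (fst p) (snd p))\<^sup>2) * indicator {0..t} (fst p))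
        \<in> borel_measurable (lborel \<Otimes>\<^sub>M M)"
      by measurable
    then have m': "(\<lambda>p. ennreal (k (snd p)) * ennreal ((f (snd p) (fst p))\<^sup>2) * indicator {0..t} (snd p))
        \<in> borel_measurable (M \<Otimes>\<^sub>M lborel)"
      using measurable_compose[OF measurable_pair_swap' m] by (simp add: case_prod_beta)
    have m2: "(\<lambda>\<omega>. \<integral>\<^sup>+s\<in>{0..t}. ennreal (k s) * ennreal ((f s \<omega>)\<^sup>2) \<partial>lborel) \<in> borel_measurable M"
      using lborel.borel_measurable_nn_integral_fst[OF m'] by simp
    then show "W k f \<in> borel_measurable M" unfolding W_def by measurable
    have "(\<integral>\<^sup>+\<omega>. (\<integral>\<^sup>+s\<in>{0..t}. ennreal (k s) * ennreal ((f s \<omega>)\<^sup>2) \<partial>lborel) \<partial>M) =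
        (\<integral>\<^sup>+s. (\<integral>\<^sup>+\<omega>. ennreal (k s) * ennreal ((f s \<omega>)\<^sup>2) * indicator {0..t} s \<partial>M) \<partial>lborel)"
      using L.Fubini[OF m] by simp
    also have "\<dots> = (\<integral>\<^sup>+s\<in>{0..t}. ennreal (k s) * (\<integral>\<^sup>+\<omega>. ennreal ((f s \<omega>)\<^sup>2) \<partial>M) \<partial>lborel)"
    proof (intro nn_integral_cong)
      fix s :: real
      have [measurable]: "f s \<in> borel_measurable M"
        using measurable_compose[OF measurable_Pair1'[of s lborel M] that(2)] by simp
      show "(\<integral>\<^sup>+\<omega>. ennreal (k s) * ennreal ((f s \<omega>)\<^sup>2) * indicator {0..t} s \<partial>M) =
          ennreal (k s) * (\<integral>\<^sup>+\<omega>. ennreal ((f s \<omega>)\<^sup>2) \<partial>M) * indicator {0..t} s"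
        by (simp add: nn_integral_multc nn_integral_cmult)
    qed
    finally show "(\<integral>\<^sup>+\<omega>. W k f \<omega> \<partial>M) = (\<integral>\<^sup>+s\<in>{0..t}. ennreal (k s) \<partial>lborel) *
      (\<integral>\<^sup>+s\<in>{0..t}. ennreal (k s) * (\<integral>\<^sup>+\<omega>. ennreal ((f s \<omega>)\<^sup>2) \<partial>M) \<partial>lborel)"
      using m2 by (simp add: W_def nn_integral_cmult)
  qed
  have "(\<integral>\<^sup>+\<omega>. ennreal ((Y \<omega>)\<^sup>2) \<partial>M) \<le> (\<integral>\<^sup>+\<omega>. 2 * W k1 f1 \<omega> + 2 * W k2 f2 \<omega> \<partial>M)"
  proof (rule nn_integral_mono_AE)
    show "AE \<omega> in M. ennreal ((Y \<omega>)\<^sup>2) \<le> 2 * W k1 f1 \<omega> + 2 * W k2 f2 \<omega>"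
      using G
    proof (rule AE_mp, intro AE_I2 impI)
      fix \<omega> assume \<omega>: "\<omega> \<in> space M" and G\<omega>: "((\<lambda>s. G s \<omega>) has_integral Y \<omega>) {0..t}"
      note s1 [measurable] = sec[OF f(1) \<omega>] and s2 [measurable] = sec[OF f(2) \<omega>]
      have [measurable]: "(\<lambda>s. f1 s \<omega>) \<in> borel_measurable borel" "(\<lambda>s. f2 s \<omega>) \<in> borel_measurable borel"
        using s1 s2 by auto
      have "ennreal \<bar>Y \<omega>\<bar> \<le> (\<integral>\<^sup>+s\<in>{0..t}. ennreal (k1 s * \<bar>f1 s \<omega>\<bar> + k2 s * \<bar>f2 s \<omega>\<bar>) \<partial>lborel)"
        by (rule has_integral_le_nn_integral[OF G\<omega>]) (use k0 le in auto)
      also have "\<dots> = (\<integral>\<^sup>+s\<in>{0..t}. ennreal (k1 s * \<bar>f1 s \<omega>\<bar>) \<partial>lborel) + (\<integral>\<^sup>+s\<in>{0..t}. ennreal (k2 s * \<bar>f2 s \<omega>\<bar>) \<partial>lborel)"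
        using k0 by (subst nn_integral_add[symmetric]) (auto simp: ennreal_plus distrib_right intro!: nn_integral_cong)
      finally have "ennreal \<bar>Y \<omega>\<bar> ^ 2 \<le>
          ((\<integral>\<^sup>+s\<in>{0..t}. ennreal (k1 s * \<bar>f1 s \<omega>\<bar>) \<partial>lborel) + (\<integral>\<^sup>+s\<in>{0..t}. ennreal (k2 s * \<bar>f2 s \<omega>\<bar>) \<partial>lborel))\<^sup>2"
        by (rule power_mono) simp
      also have "\<dots> \<le> 2 * (\<integral>\<^sup>+s\<in>{0..t}. ennreal (k1 s * \<bar>f1 s \<omega>\<bar>) \<partial>lborel)\<^sup>2 + 2 * (\<integral>\<^sup>+s\<in>{0..t}. ennreal (k2 s * \<bar>f2 s \<omega>\<bar>) \<partial>lborel)\<^sup>2"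
        by (rule ennreal_add_square_le)
      also have "\<dots> \<le> 2 * W k1 f1 \<omega> + 2 * W k2 f2 \<omega>"
        by (intro add_mono mult_left_mono one k s1 s2 k0) auto
      finally show "ennreal ((Y \<omega>)\<^sup>2) \<le> 2 * W k1 f1 \<omega> + 2 * W k2 f2 \<omega>"
        by (simp add: ennreal_power)
    qed
  qed
  also have "\<dots> = 2 * (\<integral>\<^sup>+\<omega>. W k1 f1 \<omega> \<partial>M) + 2 * (\<integral>\<^sup>+\<omega>. W k2 f2 \<omega> \<partial>M)"
    using Wm[OF k(1) f(1)] Wm[OF k(2) f(2)] by (simp add: nn_integral_add nn_integral_cmult)
  finally show ?thesis unfolding Wint[OF k(1) f(1)] Wint[OF k(2) f(2)] .
qed

text \<open>Since \<open>\<phi>\<close> is bounded a priori, its supremum with respect to the weight \<open>exp (-2bt)\<close> is finite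
  and can be absorbed.\<close>

lemma gronwall_ennreal:
  fixes \<phi> :: "real \<Rightarrow> ennreal"
  assumes b: "0 < b" and a: "0 \<le> a" and bdd: "\<And>t. t \<in> {0..T} \<Longrightarrow> \<phi> t \<le> ennreal B"
    and le: "\<And>t. t \<in> {0..T} \<Longrightarrow> \<phi> t \<le> ennreal a + ennreal b * (\<integral>\<^sup>+s\<in>{0..t}. \<phi> s \<partial>lborel)"
    and t: "t \<in> {0..T}"
  shows "\<phi> t \<le> ennreal (2 * a * exp (2 * b * T))"
proof -
  define \<psi> where "\<psi> = (SUP t\<in>{0..T}. ennreal (exp (- 2 * b * t)) * \<phi> t)"
  have "\<psi> \<le> ennreal B"
    unfolding \<psi>_def
  proof (rule SUP_least)
    fix t assume t: "t \<in> {0..T}"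
    have "ennreal (exp (- 2 * b * t)) * \<phi> t \<le> 1 * ennreal B"
      using b t by (intro mult_mono bdd) (auto simp: mult_nonneg_nonneg)
    then show "ennreal (exp (- 2 * b * t)) * \<phi> t \<le> ennreal B" by simp
  qed
  then obtain p where p: "0 \<le> p" "\<psi> = ennreal p"
    by (cases \<psi>) (auto simp: top_unique)
  have up: "\<phi> s \<le> ennreal (p * exp (2 * b * s))" if "s \<in> {0..T}" for s
  proof -
    have "ennreal (exp (- 2 * b * s)) * \<phi> s \<le> ennreal p"
      unfolding p(2)[symmetric] \<psi>_def using that by (intro SUP_upper)
    then have "ennreal (exp (2 * b * s)) * (ennreal (exp (- 2 * b * s)) * \<phi> s) \<le> ennreal (exp (2 * b * s)) * ennreal p"
      by (intro mult_left_mono) auto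
    moreover have "ennreal (exp (2 * b * s)) * ennreal (exp (- 2 * b * s)) = 1"
      by (simp add: ennreal_mult[symmetric] mult_exp_exp)
    ultimately have "\<phi> s \<le> ennreal (exp (2 * b * s)) * ennreal p" by (simp add: mult.assoc[symmetric])
    then show ?thesis using p(1) by (simp add: ennreal_mult mult.commute[of p])
  qed
  \<comment> \<open>The weight grows at rate \<open>2 * b\<close> while the inequality carries the
    factor \<open>b\<close>, so integration returns only half of \<open>p\<close>.\<close>
  have st: "ennreal (exp (- 2 * b * t)) * \<phi> t \<le> ennreal (a + p / 2)" if t: "t \<in> {0..T}" for t
  proof -
    have "(\<integral>\<^sup>+s\<in>{0..t}. \<phi> s \<partial>lborel) \<le> (\<integral>\<^sup>+s\<in>{0..t}. ennreal (p * exp (2 * b * s)) \<partial>lborel)"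
      using t by (intro nn_integral_mono) (auto simp: indicator_def up)
    also have "\<dots> = ennreal (p * exp (2 * b * t) / (2 * b) - p * exp (2 * b * 0) / (2 * b))"
    proof (rule nn_integral_FTC_Icc)
      fix x show "((\<lambda>s. p * exp (2 * b * s) / (2 * b)) has_real_derivative p * exp (2 * b * x)) (at x)"
        using b by (auto intro!: derivative_eq_intros)
    qed (use p t in auto)
    also have "\<dots> \<le> ennreal (p * exp (2 * b * t) / (2 * b))"
      using p b by (intro ennreal_leI) auto
    finally have I: "(\<integral>\<^sup>+s\<in>{0..t}. \<phi> s \<partial>lborel) \<le> ennreal (p * exp (2 * b * t) / (2 * b))" .
    have "\<phi> t \<le> ennreal a + ennreal b * ennreal (p * exp (2 * b * t) / (2 * b))"
      by (rule order_trans[OF le[OF t]]) (intro add_left_mono mult_left_mono I, simp)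
    also have "\<dots> = ennreal (a + p * exp (2 * b * t) / 2)"
      using b a p by (simp add: ennreal_mult[symmetric] ennreal_plus[symmetric] del: ennreal_plus)
    finally have "ennreal (exp (- 2 * b * t)) * \<phi> t \<le> ennreal (exp (- 2 * b * t)) * ennreal (a + p * exp (2 * b * t) / 2)"
      by (intro mult_left_mono) auto
    also have "\<dots> = ennreal (exp (- 2 * b * t) * a + p / 2)"
    proof -
      have "exp (- 2 * b * t) * (a + p * exp (2 * b * t) / 2) = exp (- 2 * b * t) * a + p * (exp (- 2 * b * t) * exp (2 * b * t)) / 2"
        by (simp add: algebra_simps)
      then show ?thesis by (simp add: ennreal_mult'[symmetric] mult_exp_exp)
    qed
    also have "\<dots> \<le> ennreal (a + p / 2)"
    proof (rule ennreal_leI)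
      have "exp (- 2 * b * t) * a \<le> 1 * a" using b t a by (intro mult_right_mono) auto
      then show "exp (- 2 * b * t) * a + p / 2 \<le> a + p / 2" by (simp only: mult_1 add_le_cancel_right)
    qed
    finally show ?thesis .
  qed
  then have "\<psi> \<le> ennreal (a + p / 2)" unfolding \<psi>_def by (intro SUP_least)
  then have "p \<le> a + p / 2" unfolding p(2) by (rule ennreal_le_iff[THEN iffD1, rotated]) (use a p(1) in auto)
  then have p2: "p \<le> 2 * a" by simp
  have "\<phi> t \<le> ennreal (p * exp (2 * b * t))" by (rule up[OF t])
  also have "\<dots> \<le> ennreal (2 * a * exp (2 * b * T))"
    using p p2 b t by (intro ennreal_leI mult_mono) auto
  finally show ?thesis .
qed

lemma discrete_gronwall_ennreal:
  fixes \<epsilon> :: "nat \<Rightarrow> ennreal"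
  assumes a: "0 \<le> a" and b: "0 \<le> b"
    and le: "\<And>m. m \<le> n \<Longrightarrow> \<epsilon> m \<le> ennreal a + ennreal b * (\<Sum>k<m. \<epsilon> k)"
  shows "m \<le> n \<Longrightarrow> \<epsilon> m \<le> ennreal (a * (1 + b) ^ m)"
proof (induction m rule: less_induct)
  case (less m)
  have "\<epsilon> m \<le> ennreal a + ennreal b * (\<Sum>k<m. \<epsilon> k)" using less.prems by (rule le)
  also have "\<dots> \<le> ennreal a + ennreal b * (\<Sum>k<m. ennreal (a * (1 + b) ^ k))"
    by (intro add_left_mono mult_left_mono sum_mono) (use less in auto)
  also have "(\<Sum>k<m. ennreal (a * (1 + b) ^ k)) = ennreal (\<Sum>k<m. a * (1 + b) ^ k)"
    using a b by (intro sum_ennreal) auto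
  also have "ennreal a + ennreal b * \<dots> = ennreal (a + b * (\<Sum>k<m. a * (1 + b) ^ k))"
    using a b by (simp add: ennreal_mult ennreal_plus sum_nonneg)
  also have "a + b * (\<Sum>k<m. a * (1 + b) ^ k) = a * (1 + b) ^ m"
    by (induction m) (simp_all add: algebra_simps)
  finally show ?case .
qed

section \<open>Step functions on the time grid\<close>

lemma nat_floor_cell:
  fixes \<tau> s :: real
  assumes "0 < \<tau>" "real k * \<tau> \<le> s" "s < real (Suc k) * \<tau>"
  shows "nat \<lfloor>s / \<tau>\<rfloor> = k"
proof -
  have "\<lfloor>s / \<tau>\<rfloor> = int k"
    using assms by (intro floor_unique) (auto simp: field_simps)
  then show ?thesis by simp
qed

lemma nat_floor_bounds:
  fixes \<tau> s :: real
  assumes "0 < \<tau>" "0 \<le> s"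
  shows "real (nat \<lfloor>s / \<tau>\<rfloor>) * \<tau> \<le> s" "s < real (Suc (nat \<lfloor>s / \<tau>\<rfloor>)) * \<tau>"
proof -
  have "0 \<le> \<lfloor>s / \<tau>\<rfloor>" using assms by simp
  then have eq: "real (nat \<lfloor>s / \<tau>\<rfloor>) = of_int \<lfloor>s / \<tau>\<rfloor>" by simp
  show "real (nat \<lfloor>s / \<tau>\<rfloor>) * \<tau> \<le> s"
    unfolding eq by (rule pos_le_divide_eq[THEN iffD1, OF assms(1) of_int_floor_le])
  show "s < real (Suc (nat \<lfloor>s / \<tau>\<rfloor>)) * \<tau>"
    unfolding of_nat_Suc eq
    by (rule pos_divide_less_eq[THEN iffD1, OF assms(1)]) (use floor_correct[of "s / \<tau>"] in linarith)
qed

text \<open>Turns the drift sum of the scheme into an integral over the same interval as the drift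
  of the solution. At the right end of a cell the floor jumps, which affects one point only.\<close>

lemma has_integral_step_function:
  fixes c :: "nat \<Rightarrow> real"
  assumes \<tau>: "0 < \<tau>"
  shows "((\<lambda>s. c (nat \<lfloor>s / \<tau>\<rfloor>)) has_integral (\<Sum>k<m. \<tau> * c k)) {0..real m * \<tau>}"
proof (induction m)
  case (Suc m)
  have "((\<lambda>s. c m) has_integral \<tau> * c m) {real m * \<tau>..real (Suc m) * \<tau>}"
    using has_integral_const_real[of "c m" "real m * \<tau>" "real (Suc m) * \<tau>"] \<tau> by (simp add: algebra_simps)
  then have "((\<lambda>s. c (nat \<lfloor>s / \<tau>\<rfloor>)) has_integral \<tau> * c m) {real m * \<tau>..real (Suc m) * \<tau>}"
  proof (rule has_integral_spike[rotated 2])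
    show "negligible {real (Suc m) * \<tau>}" by simp
    fix s assume "s \<in> {real m * \<tau>..real (Suc m) * \<tau>} - {real (Suc m) * \<tau>}"
    then have "nat \<lfloor>s / \<tau>\<rfloor> = m" by (intro nat_floor_cell[OF \<tau>]) auto
    then show "c (nat \<lfloor>s / \<tau>\<rfloor>) = c m" by simp
  qed
  then show ?case
    using has_integral_combine[OF _ _ Suc, of "real (Suc m) * \<tau>"] \<tau> by simp
qed (auto intro: has_integral_refl)

lemma nn_integral_step_function:
  fixes c :: "nat \<Rightarrow> ennreal"
  assumes \<tau>: "0 < \<tau>"
  shows "(\<integral>\<^sup>+s\<in>{0..real m * \<tau>}. c (nat \<lfloor>s / \<tau>\<rfloor>) \<partial>lborel) = (\<Sum>k<m. ennreal \<tau> * c k)"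
proof -
  have "(\<integral>\<^sup>+s\<in>{0..real m * \<tau>}. c (nat \<lfloor>s / \<tau>\<rfloor>) \<partial>lborel) =
      (\<integral>\<^sup>+s. (\<Sum>k<m. c k * indicator {real k * \<tau>..<real (Suc k) * \<tau>} s) \<partial>lborel)"
  proof (rule nn_integral_cong_AE)
    show "AE s in lborel. c (nat \<lfloor>s / \<tau>\<rfloor>) * indicator {0..real m * \<tau>} s =
        (\<Sum>k<m. c k * indicator {real k * \<tau>..<real (Suc k) * \<tau>} s)"
      using AE_lborel_singleton[of "real m * \<tau>"]
    proof eventually_elim
      case (elim s)
      show ?case
      proof (cases "s \<in> {0..real m * \<tau>}")
        case True
        define j where "j = nat \<lfloor>s / \<tau>\<rfloor>"
        have b: "real j * \<tau> \<le> s" "s < real (Suc j) * \<tau>"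
          using nat_floor_bounds[OF \<tau>] True by (auto simp: j_def)
        have "real j * \<tau> < real m * \<tau>" using b(1) True elim by auto
        then have "j < m" using \<tau> by simp
        have "(\<Sum>k<m. c k * indicator {real k * \<tau>..<real (Suc k) * \<tau>} s) =
            (\<Sum>k<m. if k = j then c j else 0)"
        proof (intro sum.cong refl)
          fix k
          show "c k * indicator {real k * \<tau>..<real (Suc k) * \<tau>} s = (if k = j then c j else 0)"
          proof (cases "k = j")
            case True
            then have "s \<in> {real k * \<tau>..<real (Suc k) * \<tau>}" using b by simp
            then show ?thesis using True by (simp only: indicator_simps) simp
          next
            case False
            then have "s \<notin> {real k * \<tau>..<real (Suc k) * \<tau>}"
              using nat_floor_cell[OF \<tau>, of k s] unfolding j_def by auto
            then show ?thesis using False by (simp only: indicator_simps) simp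
          qed
        qed
        also have "\<dots> = c j" using \<open>j < m\<close> by simp
        finally show ?thesis unfolding j_def using True by (simp only: indicator_simps) simp
      next
        case False
        have "s \<notin> {real k * \<tau>..<real (Suc k) * \<tau>}" if "k < m" for k
        proof
          assume s: "s \<in> {real k * \<tau>..<real (Suc k) * \<tau>}"
          have "real (Suc k) * \<tau> \<le> real m * \<tau>" using that \<tau> by (intro mult_right_mono) auto
          moreover have "0 \<le> real k * \<tau>" using \<tau> by simp
          ultimately show False using s False by (auto simp del: of_nat_Suc)
        qed
        then have "(\<Sum>k<m. c k * indicator {real k * \<tau>..<real (Suc k) * \<tau>} s) = 0"
          by (intro sum.neutral ballI) (simp only: lessThan_iff indicator_simps(2) mult_zero_right not_False_eq_True)
        moreover have "indicator {0..real m * \<tau>} s = (0::ennreal)" using False by (rule indicator_simps(2))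
        ultimately show ?thesis by (simp only: mult_zero_right)
      qed
    qed
  qed
  also have "\<dots> = (\<Sum>k<m. c k * ennreal \<tau>)"
  proof -
    have step: "real (Suc k) * \<tau> - real k * \<tau> = \<tau>" for k
      unfolding left_diff_distrib[symmetric] by simp
    have em: "emeasure lborel {real k * \<tau>..<real (Suc k) * \<tau>} = ennreal \<tau>" for k
      using emeasure_lborel_Ico[of "real k * \<tau>" "real (Suc k) * \<tau>"] mult_right_mono[of "real k" "real (Suc k)" \<tau>] \<tau> unfolding step by simp
    have one: "(\<integral>\<^sup>+s. c k * indicator {real k * \<tau>..<real (Suc k) * \<tau>} s \<partial>lborel) = c k * ennreal \<tau>" for k
      by (subst nn_integral_cmult_indicator, simp, simp only: em)
    show ?thesis
      unfolding one[symmetric] by (rule nn_integral_sum) measurable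
  qed
  finally show ?thesis by (simp add: mult.commute)
qed

lemma nn_integral_singular_kernel_le:
  fixes \<rho> t T :: real
  assumes \<rho>: "0 \<le> \<rho>" "\<rho> < 1" and t: "0 \<le> t" "t \<le> T"
  shows "(\<integral>\<^sup>+s\<in>{0..t}. ennreal ((t - s) powr (- \<rho>)) \<partial>lborel) \<le> ennreal (T powr (1 - \<rho>) / (1 - \<rho>))"
proof -
  have "((\<lambda>s. s powr (- \<rho>)) has_integral (t powr (- \<rho> + 1) / (- \<rho> + 1))) {0..t}"
    by (rule has_integral_powr_from_0) (use \<rho> t in auto)
  then have "(\<integral>\<^sup>+s\<in>{0..t}. ennreal (s powr (- \<rho>)) \<partial>lborel) = ennreal (t powr (- \<rho> + 1) / (- \<rho> + 1))"
    by (intro nn_integral_has_integral_lebesgue') auto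
  moreover have "(\<integral>\<^sup>+s\<in>{0..t}. ennreal ((t - s) powr (- \<rho>)) \<partial>lborel) = (\<integral>\<^sup>+s\<in>{0..t}. ennreal (s powr (- \<rho>)) \<partial>lborel)"
    by (subst nn_integral_real_affine[where c = "-1" and t = t])
       (auto intro!: nn_integral_cong simp: indicator_def)
  moreover have "t powr (1 - \<rho>) / (1 - \<rho>) \<le> T powr (1 - \<rho>) / (1 - \<rho>)"
    using \<rho> t by (intro divide_right_mono powr_mono2) auto
  ultimately show ?thesis by (simp add: ennreal_leI)
qed

section \<open>Componentwise second moments\<close>

text \<open>The squared \<open>L2\<close> norm of a random vector with \<open>N\<close> coordinates,
  in extended reals so that it can be handled before it is known to be finite.\<close>

definition msq :: "'b measure \<Rightarrow> nat \<Rightarrow> (nat \<Rightarrow> 'b \<Rightarrow> real) \<Rightarrow> ennreal" where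
  "msq M N Z = (\<integral>\<^sup>+\<omega>. ennreal (\<Sum>i<N. (Z i \<omega>)\<^sup>2) \<partial>M)"

lemma msq_eq_sum:
  assumes "\<And>i. i < N \<Longrightarrow> Z i \<in> borel_measurable M"
  shows "msq M N Z = (\<Sum>i<N. \<integral>\<^sup>+\<omega>. ennreal ((Z i \<omega>)\<^sup>2) \<partial>M)"
proof -
  have "msq M N Z = (\<integral>\<^sup>+\<omega>. (\<Sum>i<N. ennreal ((Z i \<omega>)\<^sup>2)) \<partial>M)"
    unfolding msq_def by (intro nn_integral_cong) (simp add: sum_ennreal)
  also have "\<dots> = (\<Sum>i<N. \<integral>\<^sup>+\<omega>. ennreal ((Z i \<omega>)\<^sup>2) \<partial>M)"
    using assms by (intro nn_integral_sum) auto
  finally show ?thesis .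
qed

lemma msq_mono_AE:
  assumes "AE \<omega> in M. (\<Sum>i<N. (Z i \<omega>)\<^sup>2) \<le> (\<Sum>i<N. (W i \<omega>)\<^sup>2)"
  shows "msq M N Z \<le> msq M N W"
  unfolding msq_def
proof (rule nn_integral_mono_AE)
  show "AE \<omega> in M. ennreal (\<Sum>i<N. (Z i \<omega>)\<^sup>2) \<le> ennreal (\<Sum>i<N. (W i \<omega>)\<^sup>2)"
    using assms by eventually_elim (rule ennreal_leI)
qed

lemma msq_add3_le:
  assumes [measurable]: "\<And>i. i < N \<Longrightarrow> A i \<in> borel_measurable M" "\<And>i. i < N \<Longrightarrow> B i \<in> borel_measurable M"
      "\<And>i. i < N \<Longrightarrow> C i \<in> borel_measurable M"
    and eq: "\<And>i. i < N \<Longrightarrow> AE \<omega> in M. Z i \<omega> = A i \<omega> + B i \<omega> + C i \<omega>"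
  shows "msq M N Z \<le> 3 * (msq M N A + msq M N B + msq M N C)"
proof -
  have AE: "AE \<omega> in M. \<forall>i\<in>{..<N}. Z i \<omega> = A i \<omega> + B i \<omega> + C i \<omega>"
    using eq by (intro AE_finite_allI) auto
  have "msq M N Z \<le> (\<integral>\<^sup>+\<omega>. 3 * (ennreal (\<Sum>i<N. (A i \<omega>)\<^sup>2) + ennreal (\<Sum>i<N. (B i \<omega>)\<^sup>2) + ennreal (\<Sum>i<N. (C i \<omega>)\<^sup>2)) \<partial>M)"
    unfolding msq_def
  proof (rule nn_integral_mono_AE)
    show "AE \<omega> in M. ennreal (\<Sum>i<N. (Z i \<omega>)\<^sup>2) \<le>
        3 * (ennreal (\<Sum>i<N. (A i \<omega>)\<^sup>2) + ennreal (\<Sum>i<N. (B i \<omega>)\<^sup>2) + ennreal (\<Sum>i<N. (C i \<omega>)\<^sup>2))"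
      using AE
    proof eventually_elim
      case (elim \<omega>)
      have sq: "(x + y + z)\<^sup>2 \<le> 3 * (x\<^sup>2 + y\<^sup>2 + z\<^sup>2)" for x y z :: real
        using zero_le_power2[of "x - y"] zero_le_power2[of "y - z"] zero_le_power2[of "x - z"]
        by (simp add: power2_eq_square algebra_simps)
      have "(\<Sum>i<N. (Z i \<omega>)\<^sup>2) \<le> (\<Sum>i<N. 3 * ((A i \<omega>)\<^sup>2 + (B i \<omega>)\<^sup>2 + (C i \<omega>)\<^sup>2))"
        using elim sq by (intro sum_mono) auto
      also have "\<dots> = 3 * ((\<Sum>i<N. (A i \<omega>)\<^sup>2) + (\<Sum>i<N. (B i \<omega>)\<^sup>2) + (\<Sum>i<N. (C i \<omega>)\<^sup>2))"
        by (simp add: sum_distrib_left[symmetric] sum.distrib)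
      finally have "ennreal (\<Sum>i<N. (Z i \<omega>)\<^sup>2) \<le> ennreal (3 * ((\<Sum>i<N. (A i \<omega>)\<^sup>2) + (\<Sum>i<N. (B i \<omega>)\<^sup>2) + (\<Sum>i<N. (C i \<omega>)\<^sup>2)))"
        by (rule ennreal_leI)
      then show ?case by (simp add: ennreal_mult sum_nonneg)
    qed
  qed
  also have "\<dots> = 3 * (msq M N A + msq M N B + msq M N C)"
    unfolding msq_def by (simp add: nn_integral_cmult nn_integral_add)
  finally show ?thesis .
qed

lemma msq_zero [simp]: "msq M N (\<lambda>i \<omega>. 0) = 0"
  by (simp add: msq_def)

lemma msq_add_le:
  assumes "\<And>i. i < N \<Longrightarrow> A i \<in> borel_measurable M" "\<And>i. i < N \<Longrightarrow> B i \<in> borel_measurable M"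
    and "\<And>i. i < N \<Longrightarrow> AE \<omega> in M. Z i \<omega> = A i \<omega> + B i \<omega>"
  shows "msq M N Z \<le> 3 * (msq M N A + msq M N B)"
  using msq_add3_le[OF assms(1,2), where C = "\<lambda>_ _. 0" and Z = Z] assms by simp

text \<open>The kernels do not depend on the coordinate, so the sum over \<open>i\<close> passes
  under the time integral and becomes the moment of the whole vector, to which growth and Lipschitz
  bounds of \<open>F\<close> apply.\<close>

lemma (in prob_space) drift_msq_bound:
  fixes k1 k2 :: "real \<Rightarrow> real" and f1 f2 G :: "nat \<Rightarrow> real \<Rightarrow> 'a \<Rightarrow> real"
  assumes k [measurable]: "k1 \<in> borel_measurable borel" "k2 \<in> borel_measurable borel"
    and f: "\<And>i. i < N \<Longrightarrow> (\<lambda>p. f1 i (fst p) (snd p)) \<in> borel_measurable (lborel \<Otimes>\<^sub>M M)"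
      "\<And>i. i < N \<Longrightarrow> (\<lambda>p. f2 i (fst p) (snd p)) \<in> borel_measurable (lborel \<Otimes>\<^sub>M M)"
    and Y: "\<And>i. i < N \<Longrightarrow> Y i \<in> borel_measurable M"
    and k0: "\<And>s. 0 \<le> k1 s" "\<And>s. 0 \<le> k2 s"
    and G: "\<And>i. i < N \<Longrightarrow> AE \<omega> in M. ((\<lambda>s. G i s \<omega>) has_integral Y i \<omega>) {0..t}"
    and le: "\<And>i s \<omega>. i < N \<Longrightarrow> s \<in> {0..t} \<Longrightarrow> \<bar>G i s \<omega>\<bar> \<le> k1 s * \<bar>f1 i s \<omega>\<bar> + k2 s * \<bar>f2 i s \<omega>\<bar>"
  shows "msq M N Y \<le>
    2 * ((\<integral>\<^sup>+s\<in>{0..t}. ennreal (k1 s) \<partial>lborel) *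
      (\<integral>\<^sup>+s\<in>{0..t}. ennreal (k1 s) * msq M N (\<lambda>i. f1 i s) \<partial>lborel)) +
    2 * ((\<integral>\<^sup>+s\<in>{0..t}. ennreal (k2 s) \<partial>lborel) *
      (\<integral>\<^sup>+s\<in>{0..t}. ennreal (k2 s) * msq M N (\<lambda>i. f2 i s) \<partial>lborel))"
proof -
  have sec: "f s \<in> borel_measurable M"
    if "(\<lambda>p. f (fst p) (snd p)) \<in> borel_measurable (lborel \<Otimes>\<^sub>M M)" for f :: "real \<Rightarrow> 'a \<Rightarrow> real" and s
    using measurable_compose[OF measurable_Pair1'[of s lborel M] that] by simp
  have em: "(\<lambda>s. \<integral>\<^sup>+\<omega>. ennreal ((f s \<omega>)\<^sup>2) \<partial>M) \<in> borel_measurable lborel"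
    if [measurable]: "(\<lambda>p. f (fst p) (snd p)) \<in> borel_measurable (lborel \<Otimes>\<^sub>M M)" for f :: "real \<Rightarrow> 'a \<Rightarrow> real"
  proof -
    have "(\<lambda>p. ennreal ((f (fst p) (snd p))\<^sup>2)) \<in> borel_measurable (lborel \<Otimes>\<^sub>M M)" by measurable
    from borel_measurable_nn_integral_fst[OF this] show ?thesis by simp
  qed
  have swap: "(\<Sum>i<N. (\<integral>\<^sup>+s\<in>{0..t}. ennreal (k s) \<partial>lborel) *
      (\<integral>\<^sup>+s\<in>{0..t}. ennreal (k s) * (\<integral>\<^sup>+\<omega>. ennreal ((f i s \<omega>)\<^sup>2) \<partial>M) \<partial>lborel)) =
    (\<integral>\<^sup>+s\<in>{0..t}. ennreal (k s) \<partial>lborel) * (\<integral>\<^sup>+s\<in>{0..t}. ennreal (k s) * msq M N (\<lambda>i. f i s) \<partial>lborel)"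
    if [measurable]: "k \<in> borel_measurable borel" and f: "\<And>i. i < N \<Longrightarrow> (\<lambda>p. f i (fst p) (snd p)) \<in> borel_measurable (lborel \<Otimes>\<^sub>M M)"
    for k :: "real \<Rightarrow> real" and f
  proof -
    have m: "(\<lambda>s. ennreal (k s) * (\<integral>\<^sup>+\<omega>. ennreal ((f i s \<omega>)\<^sup>2) \<partial>M) * indicator {0..t} s) \<in> borel_measurable lborel" if "i < N" for i
      using em[of "f i", OF f[OF that]] by measurable
    have "(\<integral>\<^sup>+s\<in>{0..t}. ennreal (k s) * msq M N (\<lambda>i. f i s) \<partial>lborel) =
        (\<integral>\<^sup>+s. (\<Sum>i<N. ennreal (k s) * (\<integral>\<^sup>+\<omega>. ennreal ((f i s \<omega>)\<^sup>2) \<partial>M) * indicator {0..t} s) \<partial>lborel)"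
    proof (intro nn_integral_cong)
      fix s
      have "msq M N (\<lambda>i. f i s) = (\<Sum>i<N. \<integral>\<^sup>+\<omega>. ennreal ((f i s \<omega>)\<^sup>2) \<partial>M)"
        by (rule msq_eq_sum, rule sec, rule f)
      then show "ennreal (k s) * msq M N (\<lambda>i. f i s) * indicator {0..t} s =
          (\<Sum>i<N. ennreal (k s) * (\<integral>\<^sup>+\<omega>. ennreal ((f i s \<omega>)\<^sup>2) \<partial>M) * indicator {0..t} s)"
        by (simp add: sum_distrib_left sum_distrib_right)
    qed
    also have "\<dots> = (\<Sum>i<N. \<integral>\<^sup>+s\<in>{0..t}. ennreal (k s) * (\<integral>\<^sup>+\<omega>. ennreal ((f i s \<omega>)\<^sup>2) \<partial>M) \<partial>lborel)"
      by (rule nn_integral_sum) (use m in auto)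
    finally show ?thesis by (simp add: sum_distrib_left)
  qed
  have "msq M N Y = (\<Sum>i<N. \<integral>\<^sup>+\<omega>. ennreal ((Y i \<omega>)\<^sup>2) \<partial>M)" by (rule msq_eq_sum) (rule Y)
  also have "\<dots> \<le> (\<Sum>i<N. 2 * ((\<integral>\<^sup>+s\<in>{0..t}. ennreal (k1 s) \<partial>lborel) *
      (\<integral>\<^sup>+s\<in>{0..t}. ennreal (k1 s) * (\<integral>\<^sup>+\<omega>. ennreal ((f1 i s \<omega>)\<^sup>2) \<partial>M) \<partial>lborel)) +
    2 * ((\<integral>\<^sup>+s\<in>{0..t}. ennreal (k2 s) \<partial>lborel) *
      (\<integral>\<^sup>+s\<in>{0..t}. ennreal (k2 s) * (\<integral>\<^sup>+\<omega>. ennreal ((f2 i s \<omega>)\<^sup>2) \<partial>M) \<partial>lborel)))"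
    by (intro sum_mono drift_L2_bound[OF k f k0 G le]) auto
  also have "\<dots> = 2 * ((\<integral>\<^sup>+s\<in>{0..t}. ennreal (k1 s) \<partial>lborel) *
      (\<integral>\<^sup>+s\<in>{0..t}. ennreal (k1 s) * msq M N (\<lambda>i. f1 i s) \<partial>lborel)) +
    2 * ((\<integral>\<^sup>+s\<in>{0..t}. ennreal (k2 s) \<partial>lborel) *
      (\<integral>\<^sup>+s\<in>{0..t}. ennreal (k2 s) * msq M N (\<lambda>i. f2 i s) \<partial>lborel))"
    unfolding sum.distrib sum_distrib_left[symmetric] by (simp only: swap[OF k(1) f(1), unfolded sum_distrib_left[symmetric]]
        swap[OF k(2) f(2), unfolded sum_distrib_left[symmetric]])
  finally show ?thesis .
qed

text \<open>After factoring out \<open>exp (- t * l)\<close> the integrand no longer depends on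
  \<open>t\<close>, and an indefinite integral is continuous. Integrability at the single time
  \<open>T\<close> covers all earlier times.\<close>

lemma continuous_on_exp_convolution:
  fixes f :: "real \<Rightarrow> real"
  assumes "(\<lambda>s. exp (- (T - s) * l) * f s) integrable_on {0..T}"
  shows "continuous_on {0..T} (\<lambda>t. integral {0..t} (\<lambda>s. exp (- (t - s) * l) * f s))"
proof -
  have "(\<lambda>s. exp (T * l) * (exp (- (T - s) * l) * f s)) integrable_on {0..T}"
    using assms by (rule integrable_on_mult_right)
  also have "(\<lambda>s. exp (T * l) * (exp (- (T - s) * l) * f s)) = (\<lambda>s. exp (s * l) * f s)"
  proof
    fix s
    have "exp (T * l) * exp (- (T - s) * l) = exp (s * l)" unfolding mult_exp_exp by (simp add: algebra_simps)
    then show "exp (T * l) * (exp (- (T - s) * l) * f s) = exp (s * l) * f s"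
      by (simp only: mult.assoc[symmetric])
  qed
  finally have "continuous_on {0..T} (\<lambda>t. integral {0..t} (\<lambda>s. exp (s * l) * f s))"
    by (rule indefinite_integral_continuous_1)
  then have "continuous_on {0..T} (\<lambda>t. exp (- t * l) * integral {0..t} (\<lambda>s. exp (s * l) * f s))"
    by (intro continuous_intros)
  also have "(\<lambda>t. exp (- t * l) * integral {0..t} (\<lambda>s. exp (s * l) * f s)) =
      (\<lambda>t. integral {0..t} (\<lambda>s. exp (- (t - s) * l) * f s))"
  proof
    fix t
    have "exp (- t * l) * exp (s * l) = exp (- (t - s) * l)" for s unfolding mult_exp_exp by (simp add: algebra_simps)
    then show "exp (- t * l) * integral {0..t} (\<lambda>s. exp (s * l) * f s) =
        integral {0..t} (\<lambda>s. exp (- (t - s) * l) * f s)"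
      unfolding integral_mult_right[symmetric] by (simp only: mult.assoc[symmetric])
  qed
  finally show ?thesis .
qed

text \<open>The target space is not assumed to be second countable as a type, so sums of measurable
  functions need not be measurable automatically; here simple functions help.\<close>

lemma borel_measurable_sum_scaleR:
  fixes v :: "nat \<Rightarrow> 'a::real_normed_vector" and y :: "nat \<Rightarrow> 'b \<Rightarrow> real"
  assumes "\<And>i. i < N \<Longrightarrow> y i \<in> borel_measurable M"
  shows "(\<lambda>\<omega>. \<Sum>i<N. y i \<omega> *\<^sub>R v i) \<in> borel_measurable M"
proof -
  have "\<exists>Y. \<forall>i<N. (\<forall>k. simple_function M (Y i k)) \<and> (\<forall>x\<in>space M. (\<lambda>k. Y i k x) \<longlonglongrightarrow> y i x)"
  proof -
    have "\<forall>i\<in>{..<N}. \<exists>Yi. (\<forall>k. simple_function M (Yi k)) \<and> (\<forall>x\<in>space M. (\<lambda>k. Yi k x) \<longlonglongrightarrow> y i x)"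
      using borel_measurable_implies_sequence_metric[OF assms, of _ 0] by blast
    from bchoice[OF this] show ?thesis by blast
  qed
  then obtain Y where Y: "\<And>i k. i < N \<Longrightarrow> simple_function M (Y i k)"
    "\<And>i x. i < N \<Longrightarrow> x \<in> space M \<Longrightarrow> (\<lambda>k. Y i k x) \<longlonglongrightarrow> y i x" by blast
  show ?thesis
  proof (rule borel_measurable_LIMSEQ_metric[where f = "\<lambda>k \<omega>. \<Sum>i<N. Y i k \<omega> *\<^sub>R v i"])
    show "(\<lambda>\<omega>. \<Sum>i<N. Y i k \<omega> *\<^sub>R v i) \<in> borel_measurable M" for k
    proof (intro borel_measurable_simple_function simple_function_sum)
      fix i assume "i \<in> {..<N}"
      then show "simple_function M (\<lambda>\<omega>. Y i k \<omega> *\<^sub>R v i)"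
        using simple_function_compose1[OF Y(1)[of i k], of "\<lambda>r. r *\<^sub>R v i"] by simp
    qed
    show "(\<lambda>k. \<Sum>i<N. Y i k x *\<^sub>R v i) \<longlonglongrightarrow> (\<Sum>i<N. y i x *\<^sub>R v i)" if "x \<in> space M" for x
      by (intro tendsto_intros Y) (use that in auto)
  qed
qed

section \<open>Coordinates in the orthonormal basis\<close>

locale orthonormal_basis =
  fixes e :: "nat \<Rightarrow> 'a::{real_inner,complete_space}"
  assumes ortho: "\<forall>i j. e i \<bullet> e j = (if i = j then 1 else 0)"
    and complete: "\<forall>x. (\<lambda>i. (x \<bullet> e i) *\<^sub>R e i) sums x"
begin

lemma inner_sum_basis: "(\<Sum>i<N. c i *\<^sub>R e i) \<bullet> e j = (if j < N then c j else 0)"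
  by (simp add: inner_sum_left ortho if_distrib[of "\<lambda>x. _ * x"] cong: if_cong)

lemma norm_sum_basis: "(norm (\<Sum>i<N. c i *\<^sub>R e i))\<^sup>2 = (\<Sum>i<N. (c i)\<^sup>2)"
  unfolding power2_norm_eq_inner by (simp add: inner_sum_right inner_sum_basis power2_eq_square)

lemma bessel: "(\<Sum>i<N. (x \<bullet> e i)\<^sup>2) \<le> (norm x)\<^sup>2"
proof -
  let ?p = "\<Sum>i<N. (x \<bullet> e i) *\<^sub>R e i"
  have "x \<bullet> ?p = (\<Sum>i<N. (x \<bullet> e i)\<^sup>2)" by (simp add: inner_sum_right power2_eq_square)
  moreover have "?p \<bullet> ?p = (\<Sum>i<N. (x \<bullet> e i)\<^sup>2)" by (simp add: power2_norm_eq_inner[symmetric] norm_sum_basis)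
  moreover have "0 \<le> (x - ?p) \<bullet> (x - ?p)" by simp
  ultimately show ?thesis
    by (simp add: inner_diff_left inner_diff_right inner_commute[of ?p x] power2_norm_eq_inner)
qed

lemma finite_expansion:
  assumes "\<And>i. N \<le> i \<Longrightarrow> x \<bullet> e i = 0"
  shows "x = (\<Sum>i<N. (x \<bullet> e i) *\<^sub>R e i)"
proof -
  have "(\<lambda>i. (x \<bullet> e i) *\<^sub>R e i) sums (\<Sum>i<N. (x \<bullet> e i) *\<^sub>R e i)"
    by (rule sums_finite) (use assms in \<open>auto simp: not_less\<close>)
  moreover have "(\<lambda>i. (x \<bullet> e i) *\<^sub>R e i) sums x" using complete by blast
  ultimately show ?thesis by (rule sums_unique2[rotated])
qed

lemma norm_finite_expansion:
  assumes "\<And>i. N \<le> i \<Longrightarrow> x \<bullet> e i = 0"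
  shows "(norm x)\<^sup>2 = (\<Sum>i<N. (x \<bullet> e i)\<^sup>2)"
  by (subst finite_expansion[OF assms]) (auto simp: norm_sum_basis)

lemma projN_inner: "projN e N x \<bullet> e i = (if i < N then x \<bullet> e i else 0)"
  by (simp add: projN_def inner_sum_basis)

lemma semigroupN_projN_inner:
  "semigroupN e lam N t (projN e N x) \<bullet> e i = (if i < N then exp (- t * lam i) * (x \<bullet> e i) else 0)"
  by (simp add: semigroupN_def inner_add_left inner_diff_left inner_sum_basis projN_inner)

lemma resolvN_inner:
  "resolvN e lam N \<tau> x \<bullet> e i = (if i < N then (x \<bullet> e i) / (1 + \<tau> * lam i) else x \<bullet> e i)"
  by (simp add: resolvN_def inner_add_left inner_diff_left inner_sum_basis projN_inner)

lemma borel_measurable_inner_basis: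
  "f \<in> borel_measurable N \<Longrightarrow> (\<lambda>x. f x \<bullet> e i) \<in> borel_measurable N"
  by (rule measurable_compose[of f], assumption, rule borel_measurable_continuous_onI) (intro continuous_intros)

end

section \<open>The Galerkin solution\<close>

locale galerkin_setting = prob_space M + orthonormal_basis e
  for M :: "'b measure" and e :: "nat \<Rightarrow> 'a::{real_inner,complete_space}" +
  fixes lam :: "nat \<Rightarrow> real" and F \<Phi> :: "'a \<Rightarrow> 'a" and L H \<beta> T :: real
    and w :: "nat \<Rightarrow> real \<Rightarrow> 'b \<Rightarrow> real" and \<xi> :: "'b \<Rightarrow> 'a" and X :: "nat \<Rightarrow> real \<Rightarrow> 'b \<Rightarrow> 'a"
  assumes lam0_pos: "0 < lam 0" and lam_mono: "mono lam"
    and F_growth: "\<forall>u. norm (F u) \<le> L * (norm u + 1)"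
    and F_lip: "\<forall>u v. norm (F u - F v) \<le> L * norm (u - v)"
    and H: "1/2 < H" "H < 1" and \<beta>: "1 - 2*H < \<beta>" "\<beta> \<le> 1" and T: "0 < T"
    and fbm: "\<And>n. is_fbm M H (w n)"
    and indep: "indep_vars (\<lambda>_. Pi\<^sub>M UNIV (\<lambda>_. borel)) (\<lambda>n \<omega> t. w n t \<omega>) UNIV"
    and \<Phi>_HS: "(\<Sum>n. Vnorm2 e lam (\<beta> - 1) (\<Phi> (e n))) < \<infinity>"
    and \<xi>_meas: "\<xi> \<in> borel_measurable M"
    and \<xi>_L2: "(\<integral>\<^sup>+\<omega>. Vnorm2 e lam (2*H + \<beta> - 1) (\<xi> \<omega>) \<partial>M) < \<infinity>"
    and mild: "\<forall>N. galerkin_mild M e lam F \<Phi> w \<xi> T N (X N)"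
begin

definition \<rho> :: real where "\<rho> = (2*H + \<beta> - 1) / 2"

definition \<phi> :: "nat \<Rightarrow> nat \<Rightarrow> real" where "\<phi> i n = \<Phi> (e n) \<bullet> e i"

text \<open>The squared norm of the \<open>i\<close>-th row of the matrix of \<open>\<Phi>\<close>,
  that is, the variance factor of the \<open>i\<close>-th coordinate of the noise.\<close>

definition noise_weight :: "nat \<Rightarrow> real" where "noise_weight i = (\<Sum>n. (\<phi> i n)\<^sup>2)"

text \<open>The squared Hilbert-Schmidt norm of \<open>\<Phi>\<close> with weight
  \<open>\<beta> - 1\<close>, as a real number.\<close>

definition HS :: real where "HS = enn2real (\<Sum>n. Vnorm2 e lam (\<beta> - 1) (\<Phi> (e n)))"

definition \<Xi> :: real where "\<Xi> = enn2real (\<integral>\<^sup>+\<omega>. Vnorm2 e lam (2*\<rho>) (\<xi> \<omega>) \<partial>M)"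

lemma rho: "0 < \<rho>" "\<rho> \<le> H" "\<rho> < 1" "0 \<le> \<rho>" "\<rho> \<le> 1" "2*\<rho> - 2*H = \<beta> - 1"
  using H \<beta> unfolding \<rho>_def by (simp_all add: field_simps)

lemma lam_pos: "0 < lam i"
  using lam0_pos monoD[OF lam_mono, of 0 i] by simp

lemma L_nonneg: "0 \<le> L"
  using order_trans[OF norm_ge_zero F_growth[rule_format, of 0]] by simp

lemma HS_nonneg: "0 \<le> HS" and \<Xi>_nonneg: "0 \<le> \<Xi>"
  by (auto simp: HS_def \<Xi>_def)

text \<open>The double series is exchanged so that the rows of \<open>\<phi>\<close>, one for each
  eigendirection, replace the columns \<open>\<Phi> (e n)\<close>; in \<open>ennreal\<close> this
  needs no convergence argument.\<close>

lemma noise_weight_partial: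
  "(\<Sum>i<N. \<Sum>n. ennreal (lam i powr (\<beta> - 1) * (\<phi> i n)\<^sup>2)) \<le> ennreal HS"
proof -
  have "(\<Sum>i<N. \<Sum>n. ennreal (lam i powr (\<beta> - 1) * (\<phi> i n)\<^sup>2)) =
      (\<Sum>n. \<Sum>i<N. ennreal (lam i powr (\<beta> - 1) * (\<phi> i n)\<^sup>2))"
    by (rule suminf_sum[symmetric]) auto
  also have "\<dots> \<le> (\<Sum>n. Vnorm2 e lam (\<beta> - 1) (\<Phi> (e n)))"
    unfolding Vnorm2_def \<phi>_def by (intro suminf_le sum_le_suminf allI) auto
  also have "\<dots> = ennreal HS" using \<Phi>_HS by (simp add: HS_def)
  finally show ?thesis .
qed

lemma \<phi>_summable: "summable (\<lambda>n. (\<phi> i n)\<^sup>2)"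
  and noise_weight_ennreal: "(\<Sum>n. ennreal (lam i powr (\<beta> - 1) * (\<phi> i n)\<^sup>2)) = ennreal (lam i powr (\<beta> - 1) * noise_weight i)"
proof -
  have "(\<Sum>n. ennreal (lam i powr (\<beta> - 1) * (\<phi> i n)\<^sup>2)) \<le>
      (\<Sum>j<Suc i. \<Sum>n. ennreal (lam j powr (\<beta> - 1) * (\<phi> j n)\<^sup>2))"
    by (rule member_le_sum) auto
  also have "\<dots> \<le> ennreal HS" by (rule noise_weight_partial)
  finally have fin: "(\<Sum>n. ennreal (lam i powr (\<beta> - 1) * (\<phi> i n)\<^sup>2)) \<noteq> top"
    by (auto simp: top_unique)
  have s: "summable (\<lambda>n. lam i powr (\<beta> - 1) * (\<phi> i n)\<^sup>2)"
    by (rule summable_suminf_not_top[OF _ fin]) simp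
  have "lam i powr (\<beta> - 1) \<noteq> 0" using lam_pos[of i] by simp
  then show s': "summable (\<lambda>n. (\<phi> i n)\<^sup>2)" using s by (simp add: summable_cmult_iff)
  show "(\<Sum>n. ennreal (lam i powr (\<beta> - 1) * (\<phi> i n)\<^sup>2)) = ennreal (lam i powr (\<beta> - 1) * noise_weight i)"
    unfolding noise_weight_def suminf_mult[OF s', symmetric] by (rule suminf_ennreal2[OF _ s]) simp
qed

lemma noise_weight_nonneg: "0 \<le> noise_weight i"
  unfolding noise_weight_def by (rule suminf_nonneg[OF \<phi>_summable]) simp

lemma noise_weight_sum: "(\<Sum>i<N. lam i powr (\<beta> - 1) * noise_weight i) \<le> HS"
  using noise_weight_partial[of N] HS_nonneg
  by (simp add: noise_weight_ennreal sum_ennreal noise_weight_nonneg)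

text \<open>A coordinatewise estimate with the weight \<open>lam i powr (\<beta> - 1)\<close> sums
  to a bound independent of \<open>N\<close>; the noise estimates are brought into this
  form.\<close>

lemma msq_noise_bound:
  assumes "\<And>i. i < N \<Longrightarrow> Z i \<in> borel_measurable M" and c: "0 \<le> c"
    and le: "\<And>i. i < N \<Longrightarrow> (\<integral>\<^sup>+\<omega>. ennreal ((Z i \<omega>)\<^sup>2) \<partial>M) \<le> ennreal (c * lam i powr (\<beta> - 1) * noise_weight i)"
  shows "msq M N Z \<le> ennreal (c * HS)"
proof -
  have "msq M N Z \<le> (\<Sum>i<N. ennreal (c * lam i powr (\<beta> - 1) * noise_weight i))"
    by (subst msq_eq_sum[OF assms(1)]) (auto intro!: sum_mono le)
  also have "\<dots> = ennreal (c * (\<Sum>i<N. lam i powr (\<beta> - 1) * noise_weight i))"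
    using c by (simp add: sum_ennreal noise_weight_nonneg sum_distrib_left mult.assoc)
  also have "\<dots> \<le> ennreal (c * HS)" using c by (intro ennreal_leI mult_left_mono noise_weight_sum)
  finally show ?thesis .
qed

lemma \<xi>_inner_measurable [measurable]: "(\<lambda>\<omega>. \<xi> \<omega> \<bullet> e i) \<in> borel_measurable M"
  by (rule borel_measurable_inner_basis[OF \<xi>_meas])

lemma msq_initial_bound:
  assumes c: "\<And>i \<omega>. i < N \<Longrightarrow> (Z i \<omega>)\<^sup>2 \<le> c * lam i powr (2*\<rho>) * (\<xi> \<omega> \<bullet> e i)\<^sup>2" and c0: "0 \<le> c"
  shows "msq M N Z \<le> ennreal (c * \<Xi>)"
proof -
  have "msq M N Z \<le> (\<integral>\<^sup>+\<omega>. ennreal c * Vnorm2 e lam (2*\<rho>) (\<xi> \<omega>) \<partial>M)"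
    unfolding msq_def
  proof (rule nn_integral_mono)
    fix \<omega>
    have "ennreal (\<Sum>i<N. (Z i \<omega>)\<^sup>2) \<le> ennreal (\<Sum>i<N. c * (lam i powr (2*\<rho>) * (\<xi> \<omega> \<bullet> e i)\<^sup>2))"
      by (intro ennreal_leI sum_mono) (use c in \<open>auto simp: mult.assoc\<close>)
    also have "\<dots> = ennreal c * (\<Sum>i<N. ennreal (lam i powr (2*\<rho>) * (\<xi> \<omega> \<bullet> e i)\<^sup>2))"
      unfolding sum_distrib_left[symmetric] using c0 by (subst sum_ennreal) (auto simp: ennreal_mult sum_nonneg)
    also have "\<dots> \<le> ennreal c * Vnorm2 e lam (2*\<rho>) (\<xi> \<omega>)"
      unfolding Vnorm2_def by (intro mult_left_mono sum_le_suminf) auto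
    finally show "ennreal (\<Sum>i<N. (Z i \<omega>)\<^sup>2) \<le> ennreal c * Vnorm2 e lam (2*\<rho>) (\<xi> \<omega>)" .
  qed
  also have "\<dots> = ennreal c * (\<integral>\<^sup>+\<omega>. Vnorm2 e lam (2*\<rho>) (\<xi> \<omega>) \<partial>M)"
    unfolding Vnorm2_def by (intro nn_integral_cmult) measurable
  also have "(\<integral>\<^sup>+\<omega>. Vnorm2 e lam (2*\<rho>) (\<xi> \<omega>) \<partial>M) = ennreal \<Xi>"
  proof -
    have "2 * \<rho> = 2 * H + \<beta> - 1" by (simp add: \<rho>_def)
    then show ?thesis using \<xi>_L2 unfolding \<Xi>_def by (simp add: less_top)
  qed
  finally show ?thesis using c0 \<Xi>_nonneg by (simp add: ennreal_mult)
qed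

text \<open>A measurable version of the \<open>i\<close>-th coordinate of the stochastic convolution
  over \<open>{s..t}\<close>. It is chosen because the defining series is controlled only along
  continuous paths and is not known to be measurable as it stands.\<close>

definition conv :: "nat \<Rightarrow> real \<Rightarrow> real \<Rightarrow> 'b \<Rightarrow> real" where
  "conv i s t = (SOME Z. Z \<in> borel_measurable M \<and>
    (AE \<omega> in M. (\<lambda>n. \<phi> i n * wexp (lam i) s t (\<lambda>r. w n r \<omega>)) sums Z \<omega>) \<and>
    (\<integral>\<^sup>+\<omega>. ennreal ((Z \<omega>)\<^sup>2) \<partial>M) \<le>
      ennreal (min ((t - s) powr (2*H)) (4 * lam i powr (-2*H)) * noise_weight i))"

lemma conv:
  assumes "0 \<le> s" "s \<le> t"
  shows "conv i s t \<in> borel_measurable M"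
    "AE \<omega> in M. (\<lambda>n. \<phi> i n * wexp (lam i) s t (\<lambda>r. w n r \<omega>)) sums conv i s t \<omega>"
    "(\<integral>\<^sup>+\<omega>. ennreal ((conv i s t \<omega>)\<^sup>2) \<partial>M) \<le>
      ennreal (min ((t - s) powr (2*H)) (4 * lam i powr (-2*H)) * noise_weight i)"
proof -
  have "\<exists>Z. Z \<in> borel_measurable M \<and>
    (AE \<omega> in M. (\<lambda>n. \<phi> i n * wexp (lam i) s t (\<lambda>r. w n r \<omega>)) sums Z \<omega>) \<and>
    (\<integral>\<^sup>+\<omega>. ennreal ((Z \<omega>)\<^sup>2) \<partial>M) \<le>
      ennreal (min ((t - s) powr (2*H)) (4 * lam i powr (-2*H)) * noise_weight i)"
    unfolding noise_weight_def
    by (rule fbm_wexp_series[OF fbm H(1) less_imp_le[OF H(2)] indep assms lam_pos \<phi>_summable])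
  from someI_ex[OF this, folded conv_def]
  show "conv i s t \<in> borel_measurable M"
    "AE \<omega> in M. (\<lambda>n. \<phi> i n * wexp (lam i) s t (\<lambda>r. w n r \<omega>)) sums conv i s t \<omega>"
    "(\<integral>\<^sup>+\<omega>. ennreal ((conv i s t \<omega>)\<^sup>2) \<partial>M) \<le>
      ennreal (min ((t - s) powr (2*H)) (4 * lam i powr (-2*H)) * noise_weight i)"
    by auto
qed

lemma conv_bound:
  assumes "0 \<le> s" "s < t"
  shows "(\<integral>\<^sup>+\<omega>. ennreal ((conv i s t \<omega>)\<^sup>2) \<partial>M) \<le>
    ennreal (4 * (t - s) powr (2*\<rho>) * lam i powr (\<beta> - 1) * noise_weight i)"
proof -
  have "min ((t - s) powr (2*H)) (4 * lam i powr (-2*H)) \<le> 4 * (t - s) powr (2*\<rho>) * lam i powr (2*\<rho> - 2*H)"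
    by (rule powr_interpolation[OF lam_pos _ rho(4,2)]) (use assms in auto)
  then show ?thesis
    using conv(3)[of s t i] assms noise_weight_nonneg[of i]
    by (intro order_trans[OF conv(3)]) (auto simp: rho(6) intro!: ennreal_leI mult_right_mono)
qed

text \<open>The drift integral read off from the mild equation as a difference. This makes it
  measurable by construction; that it is an integral holds almost surely at each time.\<close>

definition drift_int :: "nat \<Rightarrow> nat \<Rightarrow> real \<Rightarrow> 'b \<Rightarrow> real" where
  "drift_int N i t \<omega> = X N t \<omega> \<bullet> e i - exp (- t * lam i) * (\<xi> \<omega> \<bullet> e i) - conv i 0 t \<omega>"

lemma X_joint: "(\<lambda>p. X N (fst p) (snd p)) \<in> borel_measurable (lborel \<Otimes>\<^sub>M M)"
  using mild by (auto simp: galerkin_mild_def)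

lemma X_measurable: "X N t \<in> borel_measurable M"
  using measurable_compose[OF measurable_Pair1'[of t lborel M] X_joint] by simp

lemma continuous_F: "continuous_on UNIV F"
proof (rule continuous_onI)
  fix x and r :: real assume "0 < r"
  show "\<exists>d>0. \<forall>x'\<in>UNIV. dist x' x < d \<longrightarrow> dist (F x') (F x) \<le> r"
  proof (intro exI[of _ "r / (L + 1)"] conjI ballI impI)
    show "0 < r / (L + 1)" using \<open>0 < r\<close> L_nonneg by simp
    fix x' assume d: "dist x' x < r / (L + 1)"
    have "dist (F x') (F x) \<le> L * dist x' x" using F_lip by (simp add: dist_norm)
    also have "\<dots> \<le> (L + 1) * dist x' x" by (intro mult_right_mono) auto
    also have "\<dots> \<le> r" using d L_nonneg by (simp add: field_simps)
    finally show "dist (F x') (F x) \<le> r" .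
  qed
qed

lemma F_inner_measurable: "f \<in> borel_measurable N \<Longrightarrow> (\<lambda>x. F (f x) \<bullet> e i) \<in> borel_measurable N"
  by (intro borel_measurable_inner_basis measurable_compose[OF _ borel_measurable_continuous_onI[OF continuous_F]])

lemma X_inner_measurable [measurable]: "(\<lambda>\<omega>. X N t \<omega> \<bullet> e i) \<in> borel_measurable M"
  by (rule borel_measurable_inner_basis[OF X_measurable])

lemma FX_joint: "(\<lambda>p. F (X N (fst p) (snd p)) \<bullet> e i) \<in> borel_measurable (lborel \<Otimes>\<^sub>M M)"
  by (rule F_inner_measurable[OF X_joint])

lemma conv_measurable: "0 \<le> t \<Longrightarrow> conv i 0 t \<in> borel_measurable M"
  by (rule conv) auto

lemma drift_int_measurable: "0 \<le> t \<Longrightarrow> drift_int N i t \<in> borel_measurable M"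
  unfolding drift_int_def using conv_measurable[of t i] by measurable

lemma stoch_conv_inner:
  assumes "0 \<le> t"
  shows "AE \<omega> in M. \<forall>i. stoch_convN e lam \<Phi> w N t \<omega> \<bullet> e i = (if i < N then conv i 0 t \<omega> else 0)"
proof -
  have "AE \<omega> in M. \<forall>i. (\<lambda>n. \<phi> i n * wexp (lam i) 0 t (\<lambda>r. w n r \<omega>)) sums conv i 0 t \<omega>"
    using conv(2)[of 0 t] assms by (simp add: AE_all_countable)
  then show ?thesis
  proof eventually_elim
    case (elim \<omega>)
    then have "(\<Sum>n. (\<Phi> (e n) \<bullet> e i) * wiener_exp (lam i) t (w n) \<omega>) = conv i 0 t \<omega>" for i
      by (simp add: wiener_exp_eq_wexp \<phi>_def sums_iff)
    then show ?case by (simp add: stoch_convN_def inner_sum_basis)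
  qed
qed

text \<open>The inner product with \<open>e i\<close> is a bounded linear functional and commutes
  with the integral. For \<open>i \<ge> N\<close> the other terms vanish, so at each time the
  solution almost surely lies in the span of the first \<open>N\<close> basis vectors.\<close>

lemma mild_components:
  assumes t: "t \<in> {0..T}"
  shows "AE \<omega> in M. \<forall>i<N. ((\<lambda>s. exp (- (t - s) * lam i) * (F (X N s \<omega>) \<bullet> e i)) has_integral drift_int N i t \<omega>) {0..t}"
    and "AE \<omega> in M. \<forall>i\<ge>N. X N t \<omega> \<bullet> e i = 0"
proof -
  have "AE \<omega> in M. ((\<lambda>s. semigroupN e lam N (t - s) (projN e N (F (X N s \<omega>)))) has_integral
           (X N t \<omega> - semigroupN e lam N t (projN e N (\<xi> \<omega>)) - stoch_convN e lam \<Phi> w N t \<omega>)) {0..t}"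
    using mild t by (auto simp: galerkin_mild_def)
  moreover have "AE \<omega> in M. \<forall>i. stoch_convN e lam \<Phi> w N t \<omega> \<bullet> e i = (if i < N then conv i 0 t \<omega> else 0)"
    using t by (intro stoch_conv_inner) auto
  ultimately have *: "AE \<omega> in M. (\<forall>i<N. ((\<lambda>s. exp (- (t - s) * lam i) * (F (X N s \<omega>) \<bullet> e i)) has_integral drift_int N i t \<omega>) {0..t})
      \<and> (\<forall>i\<ge>N. X N t \<omega> \<bullet> e i = 0)"
  proof eventually_elim
    case (elim \<omega>)
    have c: "((\<lambda>s. semigroupN e lam N (t - s) (projN e N (F (X N s \<omega>))) \<bullet> e i) has_integral
           (X N t \<omega> - semigroupN e lam N t (projN e N (\<xi> \<omega>)) - stoch_convN e lam \<Phi> w N t \<omega>) \<bullet> e i) {0..t}" for i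
      using has_integral_linear[OF elim(1) bounded_linear_inner_left[of "e i"]] by (simp add: comp_def)
    show ?case
    proof (intro conjI allI impI)
      fix i assume i: "i < N"
      show "((\<lambda>s. exp (- (t - s) * lam i) * (F (X N s \<omega>) \<bullet> e i)) has_integral drift_int N i t \<omega>) {0..t}"
        using c[of i] i elim(2) by (simp add: semigroupN_projN_inner inner_diff_left drift_int_def)
    next
      fix i assume i: "N \<le> i"
      have "((\<lambda>s. 0) has_integral X N t \<omega> \<bullet> e i) {0..t}"
        using c[of i] i elim(2) by (simp add: semigroupN_projN_inner inner_diff_left)
      then show "X N t \<omega> \<bullet> e i = 0" by (simp add: has_integral_0_eq)
    qed
  qed
  then show "AE \<omega> in M. \<forall>i<N. ((\<lambda>s. exp (- (t - s) * lam i) * (F (X N s \<omega>) \<bullet> e i)) has_integral drift_int N i t \<omega>) {0..t}"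
    "AE \<omega> in M. \<forall>i\<ge>N. X N t \<omega> \<bullet> e i = 0" by (auto elim!: AE_mp)
qed

text \<open>\<open>F u\<close> may leave the span, which Bessel's inequality tolerates; for
  \<open>u\<close> itself equality of norm and coordinates is needed, hence the hypothesis.\<close>

lemma F_growth_components:
  assumes "\<And>i. N \<le> i \<Longrightarrow> u \<bullet> e i = 0"
  shows "(\<Sum>i<N. (F u \<bullet> e i)\<^sup>2) \<le> 2 * L\<^sup>2 * (1 + (\<Sum>i<N. (u \<bullet> e i)\<^sup>2))"
proof -
  have "(\<Sum>i<N. (F u \<bullet> e i)\<^sup>2) \<le> (norm (F u))\<^sup>2" by (rule bessel)
  also have "\<dots> \<le> (L * (norm u + 1))\<^sup>2" using F_growth by (intro power_mono) auto
  also have "\<dots> \<le> 2 * L\<^sup>2 * (1 + (norm u)\<^sup>2)"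
  proof -
    have "(norm u + 1)\<^sup>2 \<le> 2 * (1 + (norm u)\<^sup>2)"
      using zero_le_power2[of "norm u - 1"] by (simp add: power2_sum power2_diff)
    then have "L\<^sup>2 * (norm u + 1)\<^sup>2 \<le> L\<^sup>2 * (2 * (1 + (norm u)\<^sup>2))" by (intro mult_left_mono) auto
    then show ?thesis unfolding power_mult_distrib by linarith
  qed
  also have "(norm u)\<^sup>2 = (\<Sum>i<N. (u \<bullet> e i)\<^sup>2)" by (rule norm_finite_expansion) (rule assms)
  finally show ?thesis .
qed

lemma F_lipschitz_components:
  assumes "\<And>i. N \<le> i \<Longrightarrow> u \<bullet> e i = 0" "\<And>i. N \<le> i \<Longrightarrow> v \<bullet> e i = 0"
  shows "(\<Sum>i<N. (F u \<bullet> e i - F v \<bullet> e i)\<^sup>2) \<le> L\<^sup>2 * (\<Sum>i<N. (u \<bullet> e i - v \<bullet> e i)\<^sup>2)"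
proof -
  have "(\<Sum>i<N. (F u \<bullet> e i - F v \<bullet> e i)\<^sup>2) \<le> (norm (F u - F v))\<^sup>2"
    using bessel[where x = "F u - F v"] by (simp add: inner_diff_left)
  also have "\<dots> \<le> (L * norm (u - v))\<^sup>2" using F_lip by (intro power_mono) auto
  also have "\<dots> = L\<^sup>2 * (\<Sum>i<N. ((u - v) \<bullet> e i)\<^sup>2)"
    using assms by (subst norm_finite_expansion[of N "u - v", symmetric]) (auto simp: power_mult_distrib inner_diff_left)
  finally show ?thesis by (simp add: inner_diff_left)
qed

lemma initial_moment: "msq M N (\<lambda>i \<omega>. exp (- t * lam i) * (\<xi> \<omega> \<bullet> e i)) \<le> ennreal (lam 0 powr (-2*\<rho>) * \<Xi>)" if "0 \<le> t"
proof (rule msq_initial_bound)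
  fix i \<omega>
  \<comment> \<open>The eigenvalues are bounded below by \<open>lam 0\<close>, so the norm with
    exponent \<open>2*\<rho>\<close> controls the norm of the space.\<close>
  have "1 \<le> lam 0 powr (-2*\<rho>) * lam i powr (2*\<rho>)"
    using powr_mono2[of "2*\<rho>" "lam 0" "lam i"] monoD[OF lam_mono, of 0 i] rho lam0_pos
    by (simp add: powr_minus field_simps)
  moreover have "(exp (- t * lam i))\<^sup>2 \<le> 1"
    using that lam_pos[of i] by (simp add: power_le_one_iff mult_nonneg_nonneg less_imp_le)
  ultimately have "(exp (- t * lam i))\<^sup>2 \<le> lam 0 powr (-2*\<rho>) * lam i powr (2*\<rho>)" by linarith
  then show "(exp (- t * lam i) * (\<xi> \<omega> \<bullet> e i))\<^sup>2 \<le> lam 0 powr (-2*\<rho>) * lam i powr (2*\<rho>) * (\<xi> \<omega> \<bullet> e i)\<^sup>2"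
    unfolding power_mult_distrib by (rule mult_right_mono) simp
qed simp

lemma conv_moment: "msq M N (\<lambda>i. conv i 0 t) \<le> ennreal (4 * T powr (2*\<rho>) * HS)" if "t \<in> {0..T}"
proof (rule msq_noise_bound)
  fix i
  show "conv i 0 t \<in> borel_measurable M" using that by (intro conv_measurable) auto
  show "(\<integral>\<^sup>+\<omega>. ennreal ((conv i 0 t \<omega>)\<^sup>2) \<partial>M) \<le> ennreal (4 * T powr (2*\<rho>) * lam i powr (\<beta> - 1) * noise_weight i)"
  proof (cases "t = 0")
    case True
    then show ?thesis using conv(3)[of 0 t i] H by simp
  next
    case False
    have "4 * t powr (2*\<rho>) * lam i powr (\<beta> - 1) * noise_weight i \<le> 4 * T powr (2*\<rho>) * lam i powr (\<beta> - 1) * noise_weight i"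
      using that rho noise_weight_nonneg[of i] by (intro mult_right_mono mult_left_mono powr_mono2) auto
    then show ?thesis
      using conv_bound[of 0 t i] that False by (intro order_trans[OF conv_bound ennreal_leI]) auto
  qed
qed simp

end

section \<open>A priori moment bound\<close>

lemma (in prob_space) borel_measurable_msq:
  assumes [measurable]: "\<And>i. i < N \<Longrightarrow> (\<lambda>p. f i (fst p) (snd p)) \<in> borel_measurable (lborel \<Otimes>\<^sub>M M)"
  shows "(\<lambda>s. msq M N (\<lambda>i. f i s)) \<in> borel_measurable borel"
proof -
  have "(\<lambda>p. ennreal (\<Sum>i<N. (f i (fst p) (snd p))\<^sup>2)) \<in> borel_measurable (lborel \<Otimes>\<^sub>M M)"
    by measurable
  from borel_measurable_nn_integral_fst[OF this] show ?thesis by (simp add: msq_def)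
qed

lemma msq_indicator_le: "msq M N (\<lambda>i \<omega>. indicator A \<omega> * Z i \<omega>) \<le> msq M N Z"
proof (rule msq_mono_AE, rule AE_I2)
  show "(\<Sum>i<N. (indicator A \<omega> * Z i \<omega>)\<^sup>2) \<le> (\<Sum>i<N. (Z i \<omega>)\<^sup>2)" for \<omega>
    by (cases "\<omega> \<in> A") (auto intro: sum_nonneg)
qed

context galerkin_setting
begin

text \<open>A countable set of times shares one null set, outside of which \<open>drift_int\<close>
  is the restriction of a continuous indefinite integral. The last clause ties any further time to
  the same continuous path, wherever the mild equation holds at that time.\<close>

lemma drift_paths:
  assumes "countable D" "D \<subseteq> {0..T}"
  shows "AE \<omega> in M. \<forall>i<N. \<exists>B. continuous_on {0..T} B \<and> (\<forall>q\<in>D. drift_int N i q \<omega> = B q) \<and>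
    (\<forall>s\<in>{0..T}. ((\<lambda>r. exp (- (s - r) * lam i) * (F (X N r \<omega>) \<bullet> e i)) has_integral drift_int N i s \<omega>) {0..s} \<longrightarrow> drift_int N i s \<omega> = B s)"
proof -
  have "AE \<omega> in M. \<forall>q\<in>D. \<forall>i<N. ((\<lambda>s. exp (- (q - s) * lam i) * (F (X N s \<omega>) \<bullet> e i)) has_integral drift_int N i q \<omega>) {0..q}"
    by (subst AE_ball_countable[OF assms(1)]) (use assms(2) mild_components(1) in blast)
  moreover have "AE \<omega> in M. \<forall>i<N. ((\<lambda>s. exp (- (T - s) * lam i) * (F (X N s \<omega>) \<bullet> e i)) has_integral drift_int N i T \<omega>) {0..T}"
    using T by (intro mild_components(1)) auto
  ultimately show ?thesis
  proof eventually_elim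
    case (elim \<omega>)
    show ?case
    proof (intro allI impI)
      fix i assume i: "i < N"
      let ?B = "\<lambda>t. integral {0..t} (\<lambda>s. exp (- (t - s) * lam i) * (F (X N s \<omega>) \<bullet> e i))"
      have "continuous_on {0..T} ?B"
        by (rule continuous_on_exp_convolution) (use elim(2) i in blast)
      moreover have "\<forall>q\<in>D. drift_int N i q \<omega> = ?B q"
      proof
        fix q assume "q \<in> D"
        then show "drift_int N i q \<omega> = ?B q" using elim(1) i by (intro integral_unique[symmetric]) blast
      qed
      ultimately show "\<exists>B. continuous_on {0..T} B \<and> (\<forall>q\<in>D. drift_int N i q \<omega> = B q) \<and>
          (\<forall>s\<in>{0..T}. ((\<lambda>r. exp (- (s - r) * lam i) * (F (X N r \<omega>) \<bullet> e i)) has_integral drift_int N i s \<omega>) {0..s} \<longrightarrow> drift_int N i s \<omega> = B s)"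
        by (intro exI[of _ ?B] conjI ballI impI) (blast, blast, rule integral_unique[symmetric])
    qed
  qed
qed

text \<open>The events are defined through a countable dense set of times, which keeps them
  measurable. A continuous path is bounded, so almost every point lies in all late events;
  conversely, continuity carries the bound from the dense set to each fixed time.\<close>

lemma localising_events:
  obtains A :: "nat \<Rightarrow> 'b set" where "\<And>K. A K \<in> sets M" "AE \<omega> in M. \<exists>k. \<forall>K\<ge>k. \<omega> \<in> A K"
    "\<And>K \<omega> i. \<omega> \<in> A K \<Longrightarrow> i < N \<Longrightarrow> \<bar>\<xi> \<omega> \<bullet> e i\<bar> \<le> real K"
    "\<And>K s. s \<in> {0..T} \<Longrightarrow> AE \<omega> in M. \<omega> \<in> A K \<longrightarrow> (\<forall>i<N. \<bar>drift_int N i s \<omega>\<bar> \<le> real K)"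
proof -
  obtain D :: "real set" where D: "countable D" "D \<subseteq> {0..T}" "{0..T} \<subseteq> closure D"
    using separable[of "{0..T}"] by blast
  define A where "A K = {\<omega> \<in> space M. \<forall>i<N. \<bar>\<xi> \<omega> \<bullet> e i\<bar> \<le> real K \<and> (\<forall>q\<in>D. \<bar>drift_int N i q \<omega>\<bar> \<le> real K)}" for K :: nat
  have cl: "closure D = {0..T}"
    using D closure_minimal[of D "{0..T}"] by auto
  show thesis
  proof
    show "A K \<in> sets M" for K
    proof -
      have [measurable]: "drift_int N i q \<in> borel_measurable M" if "q \<in> D" for i q
        using that D(2) by (intro drift_int_measurable) auto
      have [measurable]: "Measurable.pred M (\<lambda>\<omega>. \<forall>q\<in>D. \<bar>drift_int N i q \<omega>\<bar> \<le> real K)" for i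
      proof -
        have "D \<noteq> {}" using D(3) T by auto
        then have n: "from_nat_into D n \<in> D" for n by (rule from_nat_into)
        have "(\<forall>q\<in>D. \<bar>drift_int N i q \<omega>\<bar> \<le> real K) \<longleftrightarrow> (\<forall>n. \<bar>drift_int N i (from_nat_into D n) \<omega>\<bar> \<le> real K)" for \<omega>
          using range_from_nat_into[OF \<open>D \<noteq> {}\<close> D(1)] by (metis n rangeE)
        then show ?thesis using n by simp
      qed
      show ?thesis unfolding A_def by measurable
    qed
    show "\<bar>\<xi> \<omega> \<bullet> e i\<bar> \<le> real K" if "\<omega> \<in> A K" "i < N" for K \<omega> i
      using that by (auto simp: A_def)
    show "AE \<omega> in M. \<exists>k. \<forall>K\<ge>k. \<omega> \<in> A K"
      using drift_paths[OF D(1,2), of N] AE_space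
    proof eventually_elim
      case (elim \<omega>)
      have "\<forall>i\<in>{..<N}. \<exists>b. \<bar>\<xi> \<omega> \<bullet> e i\<bar> \<le> b \<and> (\<forall>q\<in>D. \<bar>drift_int N i q \<omega>\<bar> \<le> b)"
      proof
        fix i assume "i \<in> {..<N}"
        then obtain B where B: "continuous_on {0..T} B" "\<And>q. q \<in> D \<Longrightarrow> drift_int N i q \<omega> = B q"
          using elim by blast
        have "compact (B ` {0..T})" using B(1) by (intro compact_continuous_image) auto
        then have "bounded (B ` {0..T})" by (rule compact_imp_bounded)
        then obtain c where c: "\<forall>y\<in>B ` {0..T}. norm y \<le> c" unfolding bounded_iff by blast
        show "\<exists>b. \<bar>\<xi> \<omega> \<bullet> e i\<bar> \<le> b \<and> (\<forall>q\<in>D. \<bar>drift_int N i q \<omega>\<bar> \<le> b)"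
        proof (intro exI[of _ "max \<bar>\<xi> \<omega> \<bullet> e i\<bar> c"] conjI ballI)
          fix q assume "q \<in> D"
          then have "B q \<in> B ` {0..T}" "drift_int N i q \<omega> = B q" using D(2) B(2) by auto
          then have "\<bar>drift_int N i q \<omega>\<bar> \<le> c" using c by (metis real_norm_def)
          then show "\<bar>drift_int N i q \<omega>\<bar> \<le> max \<bar>\<xi> \<omega> \<bullet> e i\<bar> c" by simp
        qed simp
      qed
      from bchoice[OF this] obtain b where
        "\<forall>i\<in>{..<N}. \<bar>\<xi> \<omega> \<bullet> e i\<bar> \<le> b i \<and> (\<forall>q\<in>D. \<bar>drift_int N i q \<omega>\<bar> \<le> b i)" ..
      then have b: "\<And>i. i < N \<Longrightarrow> \<bar>\<xi> \<omega> \<bullet> e i\<bar> \<le> b i"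
        "\<And>i q. i < N \<Longrightarrow> q \<in> D \<Longrightarrow> \<bar>drift_int N i q \<omega>\<bar> \<le> b i" by auto
      obtain k :: nat where k: "(\<Sum>i<N. b i) \<le> real k" using real_arch_simple by blast
      have b0: "0 \<le> b i" if "i < N" for i using b(1)[OF that] abs_ge_zero[of "\<xi> \<omega> \<bullet> e i"] by linarith
      have bi: "b i \<le> real K" if "i < N" "k \<le> K" for i K
      proof -
        have "b i \<le> (\<Sum>i<N. b i)" using that b0 by (intro member_le_sum) auto
        then show ?thesis using k that(2) of_nat_mono[OF that(2), where 'a = real] by linarith
      qed
      show ?case
      proof (intro exI[of _ k] allI impI)
        fix K assume "k \<le> K"
        then show "\<omega> \<in> A K"
          unfolding A_def using elim(2) order_trans[OF b(1) bi] order_trans[OF b(2) bi] by blast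
      qed
    qed
    fix K s assume s: "s \<in> {0..T}"
    show "AE \<omega> in M. \<omega> \<in> A K \<longrightarrow> (\<forall>i<N. \<bar>drift_int N i s \<omega>\<bar> \<le> real K)"
      using drift_paths[OF D(1,2), of N] mild_components(1)[OF s, of N]
    proof eventually_elim
      case (elim \<omega>)
      show ?case
      proof (intro impI allI)
        fix i assume A: "\<omega> \<in> A K" and i: "i < N"
        obtain B where B: "continuous_on {0..T} B" "\<And>q. q \<in> D \<Longrightarrow> drift_int N i q \<omega> = B q" "drift_int N i s \<omega> = B s"
          using elim s i by blast
        have "\<bar>B s\<bar> \<le> real K"
        proof (rule continuous_le_on_closure[where f = "\<lambda>s. \<bar>B s\<bar>" and S = D])
          show "continuous_on (closure D) (\<lambda>s. \<bar>B s\<bar>)" unfolding cl by (intro continuous_intros B)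
          show "s \<in> closure D" using cl s by simp
          show "\<bar>B q\<bar> \<le> real K" if "q \<in> D" for q
            using A i that unfolding B(2)[OF that, symmetric] A_def by blast
        qed
        then show "\<bar>drift_int N i s \<omega>\<bar> \<le> real K" using B(3) by simp
      qed
    qed
  qed
qed

text \<open>The value \<open>2 * a * exp (2 * b * T)\<close> of \<open>gronwall_ennreal\<close>. The
  coefficient \<open>12 * T * L^2\<close> in \<open>b\<close> is 3 from the splitting, 2 from the
  drift estimate and 2 from the growth of \<open>F\<close>; the added one keeps \<open>b\<close>
  positive for \<open>L = 0\<close>.\<close>

definition moment_bound :: real where
  "moment_bound = 2 * (1 + 3 * (lam 0 powr (-2*\<rho>) * \<Xi> + 4 * T powr (2*\<rho>) * HS)) * exp (2 * (12 * T * L\<^sup>2 + 1) * T)"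

text \<open>The indicator depends on the sample point only, so it commutes with the time integral
  and the localised second moment satisfies a closed inequality. The level \<open>K\<close> serves
  to make this moment finite and does not enter the bound.\<close>

lemma localised_moment:
  assumes A [measurable]: "A \<in> sets M"
    and A\<xi>: "\<And>\<omega> i. \<omega> \<in> A \<Longrightarrow> i < N \<Longrightarrow> \<bar>\<xi> \<omega> \<bullet> e i\<bar> \<le> K"
    and Ad: "\<And>s. s \<in> {0..T} \<Longrightarrow> AE \<omega> in M. \<omega> \<in> A \<longrightarrow> (\<forall>i<N. \<bar>drift_int N i s \<omega>\<bar> \<le> K)"
    and t: "t \<in> {0..T}"
  shows "msq M N (\<lambda>i \<omega>. indicator A \<omega> * (X N t \<omega> \<bullet> e i)) \<le> ennreal moment_bound"
proof -
  let ?x = "\<lambda>t i \<omega>. indicator A \<omega> * (X N t \<omega> \<bullet> e i)"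
  let ?F = "\<lambda>i s \<omega>. indicator A \<omega> * (F (X N s \<omega>) \<bullet> e i)"
  define K\<xi> where "K\<xi> = lam 0 powr (-2*\<rho>) * \<Xi>"
  define KO where "KO = 4 * T powr (2*\<rho>) * HS"
  have K0: "0 \<le> K\<xi>" "0 \<le> KO" using \<Xi>_nonneg HS_nonneg by (auto simp: K\<xi>_def KO_def)
  have dm: "\<And>t i. t \<in> {0..T} \<Longrightarrow> drift_int N i t \<in> borel_measurable M"
    and cm: "\<And>t i. t \<in> {0..T} \<Longrightarrow> conv i 0 t \<in> borel_measurable M"
    by (auto intro: drift_int_measurable conv_measurable)
  have split: "msq M N (?x t) \<le> 3 * (ennreal K\<xi> + ennreal KO + msq M N (\<lambda>i \<omega>. indicator A \<omega> * drift_int N i t \<omega>))"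
    if t: "t \<in> {0..T}" for t
  proof -
    have "msq M N (?x t) \<le> 3 * (msq M N (\<lambda>i \<omega>. indicator A \<omega> * (exp (- t * lam i) * (\<xi> \<omega> \<bullet> e i))) +
        msq M N (\<lambda>i \<omega>. indicator A \<omega> * conv i 0 t \<omega>) + msq M N (\<lambda>i \<omega>. indicator A \<omega> * drift_int N i t \<omega>))"
      by (rule msq_add3_le) (use dm[OF t] cm[OF t] in \<open>auto simp: drift_int_def algebra_simps\<close>)
    also have "msq M N (\<lambda>i \<omega>. indicator A \<omega> * (exp (- t * lam i) * (\<xi> \<omega> \<bullet> e i))) \<le> ennreal K\<xi>"
      unfolding K\<xi>_def using t by (intro order_trans[OF msq_indicator_le initial_moment]) auto
    also have "msq M N (\<lambda>i \<omega>. indicator A \<omega> * conv i 0 t \<omega>) \<le> ennreal KO"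
      unfolding KO_def using t by (intro order_trans[OF msq_indicator_le conv_moment]) auto
    finally show ?thesis by (simp add: mult_left_mono add_mono)
  qed
  have xjm: "(\<lambda>p. ?x (fst p) i (snd p)) \<in> borel_measurable (lborel \<Otimes>\<^sub>M M)" for i
    using borel_measurable_inner_basis[OF X_joint, of N i] by measurable
  have Fjm: "(\<lambda>p. ?F i (fst p) (snd p)) \<in> borel_measurable (lborel \<Otimes>\<^sub>M M)" for i
    using FX_joint[of N i] by measurable
  have Fx: "msq M N (\<lambda>i. ?F i s) \<le> ennreal (2 * L\<^sup>2) * (1 + msq M N (?x s))" if s: "s \<in> {0..T}" for s
  proof -
    have "msq M N (\<lambda>i. ?F i s) \<le> (\<integral>\<^sup>+\<omega>. ennreal (2 * L\<^sup>2) * (1 + ennreal (\<Sum>i<N. (?x s i \<omega>)\<^sup>2)) \<partial>M)"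
      unfolding msq_def
    proof (rule nn_integral_mono_AE)
      show "AE \<omega> in M. ennreal (\<Sum>i<N. (?F i s \<omega>)\<^sup>2) \<le> ennreal (2 * L\<^sup>2) * (1 + ennreal (\<Sum>i<N. (?x s i \<omega>)\<^sup>2))"
        using mild_components(2)[OF s, of N]
      proof eventually_elim
        case (elim \<omega>)
        have "(\<Sum>i<N. (?F i s \<omega>)\<^sup>2) \<le> 2 * L\<^sup>2 * (1 + (\<Sum>i<N. (?x s i \<omega>)\<^sup>2))"
          using F_growth_components[of N "X N s \<omega>"] elim by (cases "\<omega> \<in> A") auto
        then have "ennreal (\<Sum>i<N. (?F i s \<omega>)\<^sup>2) \<le> ennreal (2 * L\<^sup>2 * (1 + (\<Sum>i<N. (?x s i \<omega>)\<^sup>2)))"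
          by (rule ennreal_leI)
        also have "\<dots> = ennreal (2 * L\<^sup>2) * (1 + ennreal (\<Sum>i<N. (?x s i \<omega>)\<^sup>2))"
          by (subst ennreal_mult) (auto simp: sum_nonneg)
        finally show ?case .
      qed
    qed
    also have "\<dots> = ennreal (2 * L\<^sup>2) * (1 + msq M N (?x s))"
      unfolding msq_def by (subst nn_integral_cmult, measurable, subst nn_integral_add) (auto simp: emeasure_space_1)
    finally show ?thesis .
  qed
  \<comment> \<open>Adding one makes the growth bound linear in \<open>\<psi>\<close>.\<close>
  define \<psi> where "\<psi> s = 1 + msq M N (?x s)" for s
  have \<psi>m [measurable]: "\<psi> \<in> borel_measurable borel"
    unfolding \<psi>_def using borel_measurable_msq[of N "\<lambda>i t. ?x t i", OF xjm] by measurable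
  have "\<psi> t \<le> ennreal (2 * (1 + 3 * (K\<xi> + KO)) * exp (2 * (12 * T * L\<^sup>2 + 1) * T))"
  proof (rule gronwall_ennreal[OF _ _ _ _ t])
    show "0 < 12 * T * L\<^sup>2 + 1" using T by (simp add: add_nonneg_pos)
    show "0 \<le> 1 + 3 * (K\<xi> + KO)" using K0 by simp
    fix t assume t: "t \<in> {0..T}"
    have "msq M N (\<lambda>i \<omega>. indicator A \<omega> * drift_int N i t \<omega>) \<le> ennreal (real N * K\<^sup>2)"
    proof -
      have "msq M N (\<lambda>i \<omega>. indicator A \<omega> * drift_int N i t \<omega>) \<le> (\<integral>\<^sup>+\<omega>. ennreal (real N * K\<^sup>2) \<partial>M)"
        unfolding msq_def
      proof (rule nn_integral_mono_AE)
        show "AE \<omega> in M. ennreal (\<Sum>i<N. (indicator A \<omega> * drift_int N i t \<omega>)\<^sup>2) \<le> ennreal (real N * K\<^sup>2)"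
          using Ad[OF t]
        proof eventually_elim
          case (elim \<omega>)
          have "(\<Sum>i<N. (indicator A \<omega> * drift_int N i t \<omega>)\<^sup>2) \<le> (\<Sum>i<N. K\<^sup>2)"
          proof (rule sum_mono)
            fix i assume "i \<in> {..<N}"
            then show "(indicator A \<omega> * drift_int N i t \<omega>)\<^sup>2 \<le> K\<^sup>2"
              using elim power_mono[of "\<bar>drift_int N i t \<omega>\<bar>" K 2] by (cases "\<omega> \<in> A") auto
          qed
          then show ?case by (intro ennreal_leI) simp
        qed
      qed
      then show ?thesis by (simp add: emeasure_space_1)
    qed
    \<comment> \<open>The a priori bound demanded by \<open>gronwall_ennreal\<close>; it depends on
      \<open>N\<close> and \<open>K\<close>, but only its finiteness matters.\<close>
    then have "\<psi> t \<le> 1 + 3 * (ennreal K\<xi> + ennreal KO + ennreal (real N * K\<^sup>2))"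
      unfolding \<psi>_def by (intro add_left_mono order_trans[OF split[OF t]] mult_left_mono) auto
    also have "\<dots> = ennreal (1 + 3 * (K\<xi> + KO + real N * K\<^sup>2))"
      using K0 by (simp add: ennreal_mult)
    finally show "\<psi> t \<le> ennreal (1 + 3 * (K\<xi> + KO + real N * K\<^sup>2))" .
    have "msq M N (\<lambda>i \<omega>. indicator A \<omega> * drift_int N i t \<omega>) \<le>
      2 * ((\<integral>\<^sup>+s\<in>{0..t}. ennreal 1 \<partial>lborel) * (\<integral>\<^sup>+s\<in>{0..t}. ennreal 1 * msq M N (\<lambda>i. ?F i s) \<partial>lborel)) +
      2 * ((\<integral>\<^sup>+s\<in>{0..t}. ennreal 0 \<partial>lborel) * (\<integral>\<^sup>+s\<in>{0..t}. ennreal 0 * msq M N (\<lambda>i \<omega>. 0) \<partial>lborel))"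
    proof (rule drift_msq_bound[where ?f1.0 = ?F and ?f2.0 = "\<lambda>i s \<omega>. 0"
          and G = "\<lambda>i s \<omega>. indicator A \<omega> * (exp (- (t - s) * lam i) * (F (X N s \<omega>) \<bullet> e i))"])
      fix i assume i: "i < N"
      show "AE \<omega> in M. ((\<lambda>s. indicator A \<omega> * (exp (- (t - s) * lam i) * (F (X N s \<omega>) \<bullet> e i))) has_integral
          indicator A \<omega> * drift_int N i t \<omega>) {0..t}"
        using mild_components(1)[OF t, of N]
      proof eventually_elim
        case (elim \<omega>)
        then have "((\<lambda>s. exp (- (t - s) * lam i) * (F (X N s \<omega>) \<bullet> e i)) has_integral drift_int N i t \<omega>) {0..t}"
          using i by blast
        then show ?case by (rule has_integral_mult_right)
      qed
      fix s \<omega> assume s: "s \<in> {0..t}"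
      have "exp (- (t - s) * lam i) * \<bar>F (X N s \<omega>) \<bullet> e i\<bar> \<le> 1 * \<bar>F (X N s \<omega>) \<bullet> e i\<bar>"
        using s lam_pos[of i] by (intro mult_right_mono) (auto intro: mult_nonpos_nonneg)
      then show "\<bar>indicator A \<omega> * (exp (- (t - s) * lam i) * (F (X N s \<omega>) \<bullet> e i))\<bar> \<le> 1 * \<bar>?F i s \<omega>\<bar> + 0 * \<bar>0\<bar>"
        by (auto simp: indicator_def abs_mult)
    qed (use Fjm dm[OF t] in auto)
    also have "\<dots> = 2 * (ennreal t * (\<integral>\<^sup>+s\<in>{0..t}. msq M N (\<lambda>i. ?F i s) \<partial>lborel))"
      using t by simp
    also have "\<dots> \<le> 2 * (ennreal T * (\<integral>\<^sup>+s\<in>{0..t}. ennreal (2 * L\<^sup>2) * \<psi> s \<partial>lborel))"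
    proof (intro mult_left_mono mult_mono ennreal_leI, use t in simp, rule nn_integral_mono)
      fix s :: real
      show "msq M N (\<lambda>i. ?F i s) * indicator {0..t} s \<le> ennreal (2 * L\<^sup>2) * \<psi> s * indicator {0..t} s"
      proof (cases "s \<in> {0..t}")
        case True
        then have "s \<in> {0..T}" using t by auto
        then show ?thesis unfolding \<psi>_def by (intro mult_right_mono Fx) auto
      next
        case False
        then have "indicator {0..t} s = (0::ennreal)" by (rule indicator_simps(2))
        then show ?thesis by (simp only: mult_zero_right order_refl)
      qed
    qed auto
    also have "(\<integral>\<^sup>+s\<in>{0..t}. ennreal (2 * L\<^sup>2) * \<psi> s \<partial>lborel) = ennreal (2 * L\<^sup>2) * (\<integral>\<^sup>+s\<in>{0..t}. \<psi> s \<partial>lborel)"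
      unfolding mult.assoc by (rule nn_integral_cmult) measurable
    also have "2 * (ennreal T * (ennreal (2 * L\<^sup>2) * (\<integral>\<^sup>+s\<in>{0..t}. \<psi> s \<partial>lborel))) = ennreal (4 * T * L\<^sup>2) * (\<integral>\<^sup>+s\<in>{0..t}. \<psi> s \<partial>lborel)"
    proof -
      have "ennreal (4 * T * L\<^sup>2) = ennreal 2 * (ennreal T * ennreal (2 * L\<^sup>2))"
        using T by (simp only: ennreal_mult[symmetric] less_imp_le zero_le_power2 mult_nonneg_nonneg zero_le_numeral) (simp add: ac_simps)
      then show ?thesis by (simp add: mult.assoc)
    qed
    finally have D: "msq M N (\<lambda>i \<omega>. indicator A \<omega> * drift_int N i t \<omega>) \<le> ennreal (4 * T * L\<^sup>2) * (\<integral>\<^sup>+s\<in>{0..t}. \<psi> s \<partial>lborel)" .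
    have "\<psi> t \<le> 1 + 3 * (ennreal K\<xi> + ennreal KO + ennreal (4 * T * L\<^sup>2) * (\<integral>\<^sup>+s\<in>{0..t}. \<psi> s \<partial>lborel))"
      unfolding \<psi>_def[of t] by (intro add_left_mono order_trans[OF split[OF t]] mult_left_mono D) auto
    also have "\<dots> = ennreal (1 + 3 * (K\<xi> + KO)) + ennreal (12 * T * L\<^sup>2) * (\<integral>\<^sup>+s\<in>{0..t}. \<psi> s \<partial>lborel)"
    proof -
      have "ennreal (12 * T * L\<^sup>2) = 3 * ennreal (4 * T * L\<^sup>2)"
      proof -
        have "12 * T * L\<^sup>2 = 3 * (4 * T * L\<^sup>2)" by simp
        then show ?thesis using T by (simp only:) (subst ennreal_mult, auto)
      qed
      then show ?thesis using K0 by (simp add: ennreal_mult distrib_left mult.assoc add.assoc)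
    qed
    also have "\<dots> \<le> ennreal (1 + 3 * (K\<xi> + KO)) + ennreal (12 * T * L\<^sup>2 + 1) * (\<integral>\<^sup>+s\<in>{0..t}. \<psi> s \<partial>lborel)"
      by (intro add_left_mono mult_right_mono ennreal_leI) auto
    finally show "\<psi> t \<le> ennreal (1 + 3 * (K\<xi> + KO)) + ennreal (12 * T * L\<^sup>2 + 1) * (\<integral>\<^sup>+s\<in>{0..t}. \<psi> s \<partial>lborel)" .
  qed
  moreover have "msq M N (?x t) \<le> \<psi> t" by (simp add: \<psi>_def)
  ultimately show ?thesis unfolding moment_bound_def K\<xi>_def KO_def by (rule order_trans[rotated])
qed

text \<open>The indicators of the events tend to one almost surely, and Fatou's lemma removes them
  since the bound is the same for all events.\<close>

lemma solution_moment:
  assumes t: "t \<in> {0..T}"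
  shows "msq M N (\<lambda>i \<omega>. X N t \<omega> \<bullet> e i) \<le> ennreal moment_bound"
proof (rule localising_events[of N])
  fix A :: "nat \<Rightarrow> 'b set"
  assume A: "\<And>K. A K \<in> sets M" "AE \<omega> in M. \<exists>k. \<forall>K\<ge>k. \<omega> \<in> A K"
    "\<And>K \<omega> i. \<omega> \<in> A K \<Longrightarrow> i < N \<Longrightarrow> \<bar>\<xi> \<omega> \<bullet> e i\<bar> \<le> real K"
    "\<And>K s. s \<in> {0..T} \<Longrightarrow> AE \<omega> in M. \<omega> \<in> A K \<longrightarrow> (\<forall>i<N. \<bar>drift_int N i s \<omega>\<bar> \<le> real K)"
  let ?n = "\<lambda>\<omega>. sqrt (\<Sum>i<N. (X N t \<omega> \<bullet> e i)\<^sup>2)"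
  have "(\<integral>\<^sup>+\<omega>. ennreal ((?n \<omega>)\<^sup>2) \<partial>M) \<le> ennreal moment_bound"
  proof (rule nn_integral_square_limit_le[where D = "\<lambda>K \<omega>. indicator (A K) \<omega> * ?n \<omega>"])
    show "(\<lambda>\<omega>. indicator (A K) \<omega> * ?n \<omega>) \<in> borel_measurable M" for K
      using A(1)[of K] by measurable
    show "AE \<omega> in M. (\<lambda>K. indicator (A K) \<omega> * ?n \<omega>) \<longlonglongrightarrow> ?n \<omega>"
      using A(2)
    proof eventually_elim
      case (elim \<omega>)
      then obtain k where "\<And>K. k \<le> K \<Longrightarrow> \<omega> \<in> A K" by blast
      then have "\<forall>\<^sub>F K in sequentially. indicator (A K) \<omega> * ?n \<omega> = ?n \<omega>"
        by (auto simp: eventually_sequentially intro!: exI[of _ k])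
      then show ?case by (rule tendsto_eventually)
    qed
    have "(\<integral>\<^sup>+\<omega>. ennreal ((indicator (A K) \<omega> * ?n \<omega>)\<^sup>2) \<partial>M) = msq M N (\<lambda>i \<omega>. indicator (A K) \<omega> * (X N t \<omega> \<bullet> e i))" for K
      unfolding msq_def by (intro nn_integral_cong) (simp add: power_mult_distrib sum_nonneg sum_distrib_left)
    then show "(\<integral>\<^sup>+\<omega>. ennreal ((indicator (A K) \<omega> * ?n \<omega>)\<^sup>2) \<partial>M) \<le> ennreal moment_bound" for K
      using localised_moment[OF A(1) A(3) A(4) t] by simp
  qed
  then show "msq M N (\<lambda>i \<omega>. X N t \<omega> \<bullet> e i) \<le> ennreal moment_bound" by (simp add: msq_def sum_nonneg)
qed

end

section \<open>Temporal regularity\<close>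

lemma powr_square: "(x powr a)\<^sup>2 = x powr (2 * a)" for x a :: real
  by (simp add: power2_eq_square powr_add[symmetric])

lemma ennreal_triple_sum:
  assumes "0 \<le> a" "0 \<le> b" "0 \<le> c"
  shows "3 * (ennreal a + ennreal b + ennreal c) = ennreal (3 * (a + b + c))"
  using assms by (simp add: ennreal_mult)

context galerkin_setting
begin

lemma conv_split:
  assumes st: "0 \<le> s" "s \<le> t"
  shows "AE \<omega> in M. conv i 0 t \<omega> = exp (- lam i * (t - s)) * conv i 0 s \<omega> + conv i s t \<omega>"
proof -
  have "AE \<omega> in M. \<forall>n. continuous_on {0..} (\<lambda>t. w n t \<omega>)"
    using fbm by (auto simp: AE_all_countable is_fbm_def)
  moreover note conv(2)[OF order_refl order_trans[OF st], of i] conv(2)[OF order_refl st(1), of i] conv(2)[OF st, of i]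
  ultimately show ?thesis
  proof eventually_elim
    case (elim \<omega>)
    have "(\<lambda>n. exp (- lam i * (t - s)) * (\<phi> i n * wexp (lam i) 0 s (\<lambda>r. w n r \<omega>)) + \<phi> i n * wexp (lam i) s t (\<lambda>r. w n r \<omega>))
        sums (exp (- lam i * (t - s)) * conv i 0 s \<omega> + conv i s t \<omega>)"
      by (intro sums_add sums_mult elim)
    moreover have "exp (- lam i * (t - s)) * (\<phi> i n * wexp (lam i) 0 s (\<lambda>r. w n r \<omega>)) + \<phi> i n * wexp (lam i) s t (\<lambda>r. w n r \<omega>) =
        \<phi> i n * wexp (lam i) 0 t (\<lambda>r. w n r \<omega>)" for n
      using wexp_split[of "\<lambda>t. w n t \<omega>" s t "lam i"] elim st by (simp add: algebra_simps)
    ultimately have "(\<lambda>n. \<phi> i n * wexp (lam i) 0 t (\<lambda>r. w n r \<omega>)) sums (exp (- lam i * (t - s)) * conv i 0 s \<omega> + conv i s t \<omega>)"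
      by simp
    then show ?case using elim sums_unique2 by blast
  qed
qed

text \<open>The increment is the integral over \<open>{s..t}\<close> minus \<open>d\<close> times
  the earlier convolution. For the latter, \<open>d \<le> (lam i * (t - s)) powr \<rho>\<close> is
  combined with the stationary bound; each part contributes 8 to the constant.\<close>

lemma conv_increment:
  assumes st: "0 \<le> s" "s < t"
  shows "(\<integral>\<^sup>+\<omega>. ennreal ((conv i 0 t \<omega> - conv i 0 s \<omega>)\<^sup>2) \<partial>M) \<le>
    ennreal (16 * (t - s) powr (2*\<rho>) * lam i powr (\<beta> - 1) * noise_weight i)"
proof -
  define d where "d = 1 - exp (- (lam i * (t - s)))"
  define B where "B = (t - s) powr (2*\<rho>) * lam i powr (\<beta> - 1) * noise_weight i"
  have B: "0 \<le> B" using noise_weight_nonneg by (simp add: B_def)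
  have [measurable]: "conv i 0 s \<in> borel_measurable M" "conv i s t \<in> borel_measurable M"
    using st by (auto intro: conv)
  have "(\<integral>\<^sup>+\<omega>. ennreal ((conv i 0 t \<omega> - conv i 0 s \<omega>)\<^sup>2) \<partial>M) \<le>
      (\<integral>\<^sup>+\<omega>. 2 * ennreal ((conv i s t \<omega>)\<^sup>2) + ennreal (2 * d\<^sup>2) * ennreal ((conv i 0 s \<omega>)\<^sup>2) \<partial>M)"
  proof (rule nn_integral_mono_AE)
    show "AE \<omega> in M. ennreal ((conv i 0 t \<omega> - conv i 0 s \<omega>)\<^sup>2) \<le>
        2 * ennreal ((conv i s t \<omega>)\<^sup>2) + ennreal (2 * d\<^sup>2) * ennreal ((conv i 0 s \<omega>)\<^sup>2)"
      using conv_split[OF st(1) less_imp_le[OF st(2)], of i]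
    proof eventually_elim
      case (elim \<omega>)
      have "conv i 0 t \<omega> - conv i 0 s \<omega> = conv i s t \<omega> - d * conv i 0 s \<omega>"
        unfolding elim by (simp add: d_def algebra_simps)
      moreover have "(a - b)\<^sup>2 \<le> 2 * a\<^sup>2 + 2 * b\<^sup>2" for a b :: real
        using zero_le_power2[of "a + b"] by (simp add: power2_sum power2_diff)
      ultimately have "(conv i 0 t \<omega> - conv i 0 s \<omega>)\<^sup>2 \<le> 2 * (conv i s t \<omega>)\<^sup>2 + 2 * d\<^sup>2 * (conv i 0 s \<omega>)\<^sup>2"
        by (metis mult.assoc power_mult_distrib)
      then have "ennreal ((conv i 0 t \<omega> - conv i 0 s \<omega>)\<^sup>2) \<le> ennreal (2 * (conv i s t \<omega>)\<^sup>2 + 2 * d\<^sup>2 * (conv i 0 s \<omega>)\<^sup>2)"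
        by (rule ennreal_leI)
      also have "\<dots> = 2 * ennreal ((conv i s t \<omega>)\<^sup>2) + ennreal (2 * d\<^sup>2) * ennreal ((conv i 0 s \<omega>)\<^sup>2)"
        by (subst ennreal_plus) (auto simp: ennreal_mult)
      finally show ?case .
    qed
  qed
  also have "\<dots> = 2 * (\<integral>\<^sup>+\<omega>. ennreal ((conv i s t \<omega>)\<^sup>2) \<partial>M) + ennreal (2 * d\<^sup>2) * (\<integral>\<^sup>+\<omega>. ennreal ((conv i 0 s \<omega>)\<^sup>2) \<partial>M)"
    by (subst nn_integral_add) (auto simp: nn_integral_cmult)
  also have "\<dots> \<le> 2 * ennreal (4 * B) + ennreal (2 * d\<^sup>2) * ennreal (4 * lam i powr (-2*H) * noise_weight i)"
  proof (intro add_mono mult_left_mono)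
    show "(\<integral>\<^sup>+\<omega>. ennreal ((conv i s t \<omega>)\<^sup>2) \<partial>M) \<le> ennreal (4 * B)"
      using conv_bound[OF st, of i] by (simp add: B_def mult.assoc)
    have "min ((s - 0) powr (2*H)) (4 * lam i powr (-2*H)) * noise_weight i \<le> 4 * lam i powr (-2*H) * noise_weight i"
      by (intro mult_right_mono noise_weight_nonneg) auto
    then show "(\<integral>\<^sup>+\<omega>. ennreal ((conv i 0 s \<omega>)\<^sup>2) \<partial>M) \<le> ennreal (4 * lam i powr (-2*H) * noise_weight i)"
      by (intro order_trans[OF conv(3)[OF order_refl st(1), of i] ennreal_leI])
  qed auto
  also have "\<dots> = ennreal (2 * (4 * B) + 2 * d\<^sup>2 * (4 * lam i powr (-2*H) * noise_weight i))"
  proof -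
    have 1: "2 * ennreal (4 * B) = ennreal (2 * (4 * B))" using B by (subst ennreal_mult) auto
    have 2: "ennreal (2 * d\<^sup>2) * ennreal (4 * lam i powr (-2*H) * noise_weight i) =
        ennreal (2 * d\<^sup>2 * (4 * lam i powr (-2*H) * noise_weight i))"
      using noise_weight_nonneg[of i] by (intro ennreal_mult[symmetric]) auto
    show ?thesis unfolding 1 2 using B noise_weight_nonneg[of i] by (intro ennreal_plus[symmetric]) auto
  qed
  also have "\<dots> \<le> ennreal (16 * B)"
  proof (rule ennreal_leI)
    have "d\<^sup>2 \<le> ((lam i * (t - s)) powr \<rho>)\<^sup>2"
      unfolding d_def using one_minus_exp_le_powr[of "lam i * (t - s)" \<rho>] lam_pos[of i] st rho by (intro power_mono) auto
    also have "\<dots> = (t - s) powr (2*\<rho>) * lam i powr (2*\<rho>)"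
      unfolding powr_square using lam_pos[of i] st by (simp add: powr_mult mult.commute)
    finally have "d\<^sup>2 * (lam i powr (-2*H) * noise_weight i) \<le> (t - s) powr (2*\<rho>) * lam i powr (2*\<rho>) * (lam i powr (-2*H) * noise_weight i)"
      by (rule mult_right_mono) (simp add: noise_weight_nonneg)
    also have "\<dots> = (t - s) powr (2*\<rho>) * (lam i powr (2*\<rho>) * lam i powr (-2*H)) * noise_weight i"
      by (simp only: ac_simps)
    also have "lam i powr (2*\<rho>) * lam i powr (-2*H) = lam i powr (\<beta> - 1)"
      unfolding powr_add[symmetric] rho(6)[symmetric] by simp
    finally have "d\<^sup>2 * (lam i powr (-2*H) * noise_weight i) \<le> B" by (simp add: B_def)
    then show "2 * (4 * B) + 2 * d\<^sup>2 * (4 * lam i powr (-2*H) * noise_weight i) \<le> 16 * B" by simp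
  qed
  finally show ?thesis by (simp add: B_def mult.assoc)
qed

definition drift_bound :: real where "drift_bound = 2 * L\<^sup>2 * (1 + moment_bound)"

lemma moment_bound_nonneg: "0 \<le> moment_bound"
  unfolding moment_bound_def using \<Xi>_nonneg HS_nonneg by simp

lemma drift_bound_nonneg: "0 \<le> drift_bound"
  unfolding drift_bound_def using moment_bound_nonneg by simp

lemma drift_moment:
  assumes s: "s \<in> {0..T}"
  shows "msq M N (\<lambda>i \<omega>. F (X N s \<omega>) \<bullet> e i) \<le> ennreal drift_bound"
proof -
  have "msq M N (\<lambda>i \<omega>. F (X N s \<omega>) \<bullet> e i) \<le> (\<integral>\<^sup>+\<omega>. ennreal (2 * L\<^sup>2) * (1 + ennreal (\<Sum>i<N. (X N s \<omega> \<bullet> e i)\<^sup>2)) \<partial>M)"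
    unfolding msq_def
  proof (rule nn_integral_mono_AE)
    show "AE \<omega> in M. ennreal (\<Sum>i<N. (F (X N s \<omega>) \<bullet> e i)\<^sup>2) \<le> ennreal (2 * L\<^sup>2) * (1 + ennreal (\<Sum>i<N. (X N s \<omega> \<bullet> e i)\<^sup>2))"
      using mild_components(2)[OF s, of N]
    proof eventually_elim
      case (elim \<omega>)
      have "ennreal (\<Sum>i<N. (F (X N s \<omega>) \<bullet> e i)\<^sup>2) \<le> ennreal (2 * L\<^sup>2 * (1 + (\<Sum>i<N. (X N s \<omega> \<bullet> e i)\<^sup>2)))"
        by (rule ennreal_leI[OF F_growth_components]) (use elim in blast)
      also have "\<dots> = ennreal (2 * L\<^sup>2) * (1 + ennreal (\<Sum>i<N. (X N s \<omega> \<bullet> e i)\<^sup>2))"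
        by (subst ennreal_mult) (auto simp: sum_nonneg)
      finally show ?case .
    qed
  qed
  also have "\<dots> = ennreal (2 * L\<^sup>2) * (1 + msq M N (\<lambda>i \<omega>. X N s \<omega> \<bullet> e i))"
    unfolding msq_def by (subst nn_integral_cmult, measurable, subst nn_integral_add) (auto simp: emeasure_space_1)
  also have "\<dots> \<le> ennreal (2 * L\<^sup>2) * (1 + ennreal moment_bound)"
    by (intro mult_left_mono add_left_mono solution_moment s) auto
  also have "\<dots> = ennreal drift_bound"
    unfolding drift_bound_def using moment_bound_nonneg by (subst ennreal_mult) auto
  finally show ?thesis .
qed

lemma weighted_drift_moment:
  fixes k :: "real \<Rightarrow> real"
  assumes [measurable]: "k \<in> borel_measurable borel" and t: "t \<in> {0..T}"
    and \<kappa>: "(\<integral>\<^sup>+s\<in>{0..t}. ennreal (k s) \<partial>lborel) \<le> ennreal \<kappa>" "0 \<le> \<kappa>"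
  shows "(\<integral>\<^sup>+s\<in>{0..t}. ennreal (k s) \<partial>lborel) *
      (\<integral>\<^sup>+s\<in>{0..t}. ennreal (k s) * msq M N (\<lambda>i \<omega>. F (X N s \<omega>) \<bullet> e i) \<partial>lborel) \<le> ennreal (\<kappa>\<^sup>2 * drift_bound)"
proof -
  have "(\<integral>\<^sup>+s\<in>{0..t}. ennreal (k s) * msq M N (\<lambda>i \<omega>. F (X N s \<omega>) \<bullet> e i) \<partial>lborel) \<le>
      (\<integral>\<^sup>+s. (ennreal (k s) * indicator {0..t} s) * ennreal drift_bound \<partial>lborel)"
  proof (rule nn_integral_mono)
    fix s :: real
    show "ennreal (k s) * msq M N (\<lambda>i \<omega>. F (X N s \<omega>) \<bullet> e i) * indicator {0..t} s \<le> (ennreal (k s) * indicator {0..t} s) * ennreal drift_bound"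
      using drift_moment[of s N] t by (cases "s \<in> {0..t}") (auto intro: mult_left_mono)
  qed
  also have "\<dots> = (\<integral>\<^sup>+s\<in>{0..t}. ennreal (k s) \<partial>lborel) * ennreal drift_bound"
    by (rule nn_integral_multc) measurable
  also have "\<dots> \<le> ennreal \<kappa> * ennreal drift_bound" by (intro mult_right_mono \<kappa>) auto
  finally have "(\<integral>\<^sup>+s\<in>{0..t}. ennreal (k s) \<partial>lborel) *
      (\<integral>\<^sup>+s\<in>{0..t}. ennreal (k s) * msq M N (\<lambda>i \<omega>. F (X N s \<omega>) \<bullet> e i) \<partial>lborel) \<le> ennreal \<kappa> * (ennreal \<kappa> * ennreal drift_bound)"
    by (intro mult_mono \<kappa>) auto
  also have "\<dots> = ennreal (\<kappa>\<^sup>2 * drift_bound)"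
    using \<kappa>(2) drift_bound_nonneg by (simp add: ennreal_mult power2_eq_square mult.assoc)
  finally show ?thesis .
qed

text \<open>Before \<open>s\<close> the two semigroups differ by the smoothing estimate, after
  \<open>s\<close> only the longer one is present and is bounded by one. The length
  \<open>t - s\<close> of the second piece is at most
  \<open>(t - s) powr \<rho> * T powr (1 - \<rho>)\<close>.\<close>

lemma increment_kernel_integral:
  assumes st: "0 \<le> s" "s < t" "t \<le> T"
  defines "k \<equiv> \<lambda>r. if r < s then (t - s) powr \<rho> * (s - r) powr (- \<rho>) else 1"
  shows "(\<integral>\<^sup>+r\<in>{0..t}. ennreal (k r) \<partial>lborel) \<le> ennreal ((t - s) powr \<rho> * (T powr (1 - \<rho>) * (1 / (1 - \<rho>) + 1)))"
proof -
  have "(\<integral>\<^sup>+r\<in>{0..t}. ennreal (k r) \<partial>lborel) \<le>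
      (\<integral>\<^sup>+r. ennreal ((t - s) powr \<rho>) * (ennreal ((s - r) powr (- \<rho>)) * indicator {0..s} r) + indicator {s..t} r \<partial>lborel)"
  proof (rule nn_integral_mono)
    fix r :: real
    consider "r < 0 \<or> t < r" | "0 \<le> r" "r < s" | "s \<le> r" "r \<le> t" by linarith
    then show "ennreal (k r) * indicator {0..t} r \<le>
        ennreal ((t - s) powr \<rho>) * (ennreal ((s - r) powr (- \<rho>)) * indicator {0..s} r) + indicator {s..t} r"
    proof cases
      case 1 then show ?thesis by auto
    next
      case 2 then show ?thesis using st by (simp add: k_def ennreal_mult)
    next
      case 3 then show ?thesis using st by (simp add: k_def indicator_def)
    qed
  qed
  also have "\<dots> = ennreal ((t - s) powr \<rho>) * (\<integral>\<^sup>+r\<in>{0..s}. ennreal ((s - r) powr (- \<rho>)) \<partial>lborel) + ennreal (t - s)"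
    using st by (subst nn_integral_add) (auto simp: nn_integral_cmult)
  also have "\<dots> \<le> ennreal ((t - s) powr \<rho>) * ennreal (T powr (1 - \<rho>) / (1 - \<rho>)) + ennreal ((t - s) powr \<rho> * T powr (1 - \<rho>))"
  proof (intro add_mono mult_left_mono nn_integral_singular_kernel_le ennreal_leI)
    have "t - s = (t - s) powr \<rho> * (t - s) powr (1 - \<rho>)" using st by (simp add: powr_add[symmetric])
    also have "\<dots> \<le> (t - s) powr \<rho> * T powr (1 - \<rho>)" using st rho by (intro mult_left_mono powr_mono2) auto
    finally show "t - s \<le> (t - s) powr \<rho> * T powr (1 - \<rho>)" .
  qed (use st rho in auto)
  also have "\<dots> = ennreal ((t - s) powr \<rho> * (T powr (1 - \<rho>) / (1 - \<rho>)) + (t - s) powr \<rho> * T powr (1 - \<rho>))"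
    using rho by (subst ennreal_mult[symmetric]) (auto simp: ennreal_plus[symmetric] simp del: ennreal_plus)
  also have "(t - s) powr \<rho> * (T powr (1 - \<rho>) / (1 - \<rho>)) + (t - s) powr \<rho> * T powr (1 - \<rho>) =
      (t - s) powr \<rho> * (T powr (1 - \<rho>) * (1 / (1 - \<rho>) + 1))"
    by (simp add: algebra_simps)
  finally show ?thesis .
qed

definition holder_bound :: real where
  "holder_bound = 3 * (\<Xi> + 16 * HS + 2 * (T powr (1 - \<rho>) * (1 / (1 - \<rho>) + 1))\<^sup>2 * drift_bound)"

lemma holder_bound_nonneg: "0 \<le> holder_bound"
  unfolding holder_bound_def using \<Xi>_nonneg HS_nonneg drift_bound_nonneg by simp

text \<open>The initial value contributes through its own regularity, the noise through
  \<open>conv_increment\<close>, and the drift through smoothing by the semigroup, which asks for no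
  spatial regularity of \<open>F (X N s \<omega>)\<close>.\<close>

lemma solution_holder:
  assumes st: "0 \<le> s" "s \<le> t" "t \<le> T"
  shows "msq M N (\<lambda>i \<omega>. X N t \<omega> \<bullet> e i - X N s \<omega> \<bullet> e i) \<le> ennreal (holder_bound * (t - s) powr (2*\<rho>))"
proof (cases "s = t")
  case True
  then show ?thesis by simp
next
  case False
  then have h: "s < t" using st by simp
  define \<kappa> where "\<kappa> = (t - s) powr \<rho> * (T powr (1 - \<rho>) * (1 / (1 - \<rho>) + 1))"
  define k where "k r = (if r < s then (t - s) powr \<rho> * (s - r) powr (- \<rho>) else 1)" for r
  have \<kappa>0: "0 \<le> \<kappa>" using rho by (simp add: \<kappa>_def)
  have km [measurable]: "k \<in> borel_measurable borel" unfolding k_def by measurable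
  have kint: "(\<integral>\<^sup>+r\<in>{0..t}. ennreal (k r) \<partial>lborel) \<le> ennreal \<kappa>"
    unfolding k_def \<kappa>_def by (rule increment_kernel_integral) (use st h in auto)
  have [measurable]: "drift_int N i t \<in> borel_measurable M" "drift_int N i s \<in> borel_measurable M"
     "conv i 0 t \<in> borel_measurable M" "conv i 0 s \<in> borel_measurable M" for i
    using st by (auto intro: drift_int_measurable conv_measurable)
  have tT: "t \<in> {0..T}" and sT: "s \<in> {0..T}" using st by auto
  have sq: "((t - s) powr \<rho>)\<^sup>2 = (t - s) powr (2*\<rho>)"
    by (rule powr_square)
  have A: "msq M N (\<lambda>i \<omega>. (exp (- t * lam i) - exp (- s * lam i)) * (\<xi> \<omega> \<bullet> e i)) \<le> ennreal ((t - s) powr (2*\<rho>) * \<Xi>)"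
  proof (rule msq_initial_bound)
    fix i \<omega>
    have "exp (- s * lam i) - exp (- t * lam i) = exp (- s * lam i) * (1 - exp (- ((t - s) * lam i)))"
      by (simp add: right_diff_distrib mult_exp_exp algebra_simps)
    then have "\<bar>exp (- t * lam i) - exp (- s * lam i)\<bar> = exp (- s * lam i) * (1 - exp (- ((t - s) * lam i)))"
      using h lam_pos[of i] by (simp add: abs_if)
    also have "\<dots> \<le> 1 * ((t - s) * lam i) powr \<rho>"
    proof (rule mult_mono)
      show "exp (- s * lam i) \<le> 1" using st(1) lam_pos[of i] by simp
      show "1 - exp (- ((t - s) * lam i)) \<le> ((t - s) * lam i) powr \<rho>"
        using h lam_pos[of i] rho by (intro one_minus_exp_le_powr(2)) auto
    qed (use h lam_pos[of i] in auto)
    also have "\<dots> = (t - s) powr \<rho> * lam i powr \<rho>"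
      using h lam_pos[of i] by (simp add: powr_mult)
    finally have "\<bar>exp (- t * lam i) - exp (- s * lam i)\<bar>\<^sup>2 \<le> ((t - s) powr \<rho> * lam i powr \<rho>)\<^sup>2"
      by (rule power_mono) simp
    also have "\<dots> = (t - s) powr (2*\<rho>) * lam i powr (2*\<rho>)"
      by (simp only: power_mult_distrib powr_square)
    finally show "((exp (- t * lam i) - exp (- s * lam i)) * (\<xi> \<omega> \<bullet> e i))\<^sup>2 \<le> (t - s) powr (2*\<rho>) * lam i powr (2*\<rho>) * (\<xi> \<omega> \<bullet> e i)\<^sup>2"
      unfolding power_mult_distrib by (intro mult_right_mono) auto
  qed simp
  have B: "msq M N (\<lambda>i \<omega>. conv i 0 t \<omega> - conv i 0 s \<omega>) \<le> ennreal (16 * (t - s) powr (2*\<rho>) * HS)"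
    by (rule msq_noise_bound) (use conv_increment[OF st(1) h] in auto)
  have C: "msq M N (\<lambda>i \<omega>. drift_int N i t \<omega> - drift_int N i s \<omega>) \<le> ennreal (2 * (\<kappa>\<^sup>2 * drift_bound))"
  proof -
    \<comment> \<open>The integrand of the earlier time is extended by zero, so that both integrals
      live on \<open>{0..t}\<close>.\<close>
    let ?G = "\<lambda>i r \<omega>. exp (- (t - r) * lam i) * (F (X N r \<omega>) \<bullet> e i) -
        (if r \<in> {0..s} then exp (- (s - r) * lam i) * (F (X N r \<omega>) \<bullet> e i) else 0)"
    have "msq M N (\<lambda>i \<omega>. drift_int N i t \<omega> - drift_int N i s \<omega>) \<le>
      2 * ((\<integral>\<^sup>+s\<in>{0..t}. ennreal (k s) \<partial>lborel) * (\<integral>\<^sup>+s\<in>{0..t}. ennreal (k s) * msq M N (\<lambda>i \<omega>. F (X N s \<omega>) \<bullet> e i) \<partial>lborel)) +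
      2 * ((\<integral>\<^sup>+s\<in>{0..t}. ennreal 0 \<partial>lborel) * (\<integral>\<^sup>+s\<in>{0..t}. ennreal 0 * msq M N (\<lambda>i \<omega>. 0) \<partial>lborel))"
    proof (rule drift_msq_bound[where ?f1.0 = "\<lambda>i s \<omega>. F (X N s \<omega>) \<bullet> e i" and ?f2.0 = "\<lambda>i s \<omega>. 0" and G = ?G])
      fix i assume i: "i < N"
      show "AE \<omega> in M. ((\<lambda>r. ?G i r \<omega>) has_integral drift_int N i t \<omega> - drift_int N i s \<omega>) {0..t}"
        using mild_components(1)[OF tT, of N] mild_components(1)[OF sT, of N]
      proof eventually_elim
        case (elim \<omega>)
        have "((\<lambda>r. if r \<in> {0..s} then exp (- (s - r) * lam i) * (F (X N r \<omega>) \<bullet> e i) else 0) has_integral drift_int N i s \<omega>) {0..t}"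
          using elim(2) i st by (subst has_integral_restrict) auto
        then show ?case using elim(1) i by (intro has_integral_diff) blast+
      qed
      fix r \<omega> assume r: "r \<in> {0..t}"
      have "\<bar>exp (- (t - r) * lam i) - (if r \<in> {0..s} then exp (- (s - r) * lam i) else 0)\<bar> \<le> k r"
      proof -
        consider "r < s" | "r = s" | "s < r" by linarith
        then show ?thesis
        proof cases
          case 1
          have "exp (- (s - r) * lam i) - exp (- (t - r) * lam i) = exp (- ((s - r) * lam i)) * (1 - exp (- ((t - s) * lam i)))"
            by (simp add: right_diff_distrib mult_exp_exp algebra_simps)
          moreover have "0 \<le> exp (- ((s - r) * lam i)) * (1 - exp (- ((t - s) * lam i)))"
            using h lam_pos[of i] by simp
          moreover have "exp (- ((s - r) * lam i)) * (1 - exp (- ((t - s) * lam i))) \<le> ((t - s) * lam i) powr \<rho> * ((s - r) * lam i) powr (- \<rho>)"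
            using 1 h lam_pos[of i] rho by (intro exp_smoothing) auto
          moreover have "((t - s) * lam i) powr \<rho> * ((s - r) * lam i) powr (- \<rho>) = (t - s) powr \<rho> * (s - r) powr (- \<rho>)"
          proof -
            \<comment> \<open>The eigenvalue cancels, which makes \<open>k\<close> common to all
              coordinates.\<close>
            have "lam i powr \<rho> * lam i powr (- \<rho>) = 1" using lam_pos[of i] by (simp add: powr_add[symmetric])
            then show ?thesis using 1 h lam_pos[of i] by (simp add: powr_mult)
          qed
          ultimately show ?thesis using 1 r by (simp add: k_def)
        next
          \<comment> \<open>At \<open>r = s\<close> the shorter semigroup still equals one;
            \<open>k\<close> has the value one there, and the difference stays below it.\<close>
          case 2
          have "exp (- (t - s) * lam i) \<le> 1" using h lam_pos[of i] by (simp add: mult_nonpos_nonneg)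
          then show ?thesis using 2 r exp_gt_zero[of "- (t - s) * lam i"] by (simp add: k_def)
        next
          case 3
          have "exp (- (t - r) * lam i) \<le> 1" using r lam_pos[of i] by (simp add: mult_nonpos_nonneg)
          then show ?thesis using 3 by (simp add: k_def)
        qed
      qed
      then have "\<bar>exp (- (t - r) * lam i) - (if r \<in> {0..s} then exp (- (s - r) * lam i) else 0)\<bar> * \<bar>F (X N r \<omega>) \<bullet> e i\<bar> \<le> k r * \<bar>F (X N r \<omega>) \<bullet> e i\<bar>"
        by (rule mult_right_mono) simp
      moreover have "?G i r \<omega> = (exp (- (t - r) * lam i) - (if r \<in> {0..s} then exp (- (s - r) * lam i) else 0)) * (F (X N r \<omega>) \<bullet> e i)"
        by (simp add: left_diff_distrib)
      ultimately show "\<bar>?G i r \<omega>\<bar> \<le> k r * \<bar>F (X N r \<omega>) \<bullet> e i\<bar> + 0 * \<bar>0\<bar>"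
        by (simp only: abs_mult mult_zero_left add_0_right)
    qed (use FX_joint in \<open>auto simp: k_def\<close>)
    also have "\<dots> \<le> 2 * ennreal (\<kappa>\<^sup>2 * drift_bound)"
      using weighted_drift_moment[OF km _ kint \<kappa>0] st by (simp add: mult_left_mono)
    also have "\<dots> = ennreal (2 * (\<kappa>\<^sup>2 * drift_bound))" using drift_bound_nonneg by (simp add: ennreal_mult)
    finally show ?thesis .
  qed
  have "msq M N (\<lambda>i \<omega>. X N t \<omega> \<bullet> e i - X N s \<omega> \<bullet> e i) \<le>
      3 * (msq M N (\<lambda>i \<omega>. (exp (- t * lam i) - exp (- s * lam i)) * (\<xi> \<omega> \<bullet> e i)) +
        msq M N (\<lambda>i \<omega>. conv i 0 t \<omega> - conv i 0 s \<omega>) + msq M N (\<lambda>i \<omega>. drift_int N i t \<omega> - drift_int N i s \<omega>))"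
    by (rule msq_add3_le) (measurable, simp add: drift_int_def algebra_simps)
  also have "\<dots> \<le> 3 * (ennreal ((t - s) powr (2*\<rho>) * \<Xi>) + ennreal (16 * (t - s) powr (2*\<rho>) * HS) + ennreal (2 * (\<kappa>\<^sup>2 * drift_bound)))"
    by (intro mult_left_mono add_mono A B C) auto
  also have "\<dots> = ennreal (3 * ((t - s) powr (2*\<rho>) * \<Xi> + 16 * (t - s) powr (2*\<rho>) * HS + 2 * (\<kappa>\<^sup>2 * drift_bound)))"
    by (rule ennreal_triple_sum) (use \<Xi>_nonneg HS_nonneg drift_bound_nonneg in auto)
  also have "3 * ((t - s) powr (2*\<rho>) * \<Xi> + 16 * (t - s) powr (2*\<rho>) * HS + 2 * (\<kappa>\<^sup>2 * drift_bound)) = holder_bound * (t - s) powr (2*\<rho>)"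
    unfolding \<kappa>_def power_mult_distrib[of "(t - s) powr \<rho>"] sq holder_bound_def by (simp add: algebra_simps)
  finally show ?thesis .
qed

end

section \<open>Error of the fully discrete scheme\<close>

context galerkin_setting
begin

text \<open>The coefficients of \<open>\<tau> powr (2*\<rho>)\<close> in the recursion:
  \<open>16 * \<Xi>\<close> from the resolvent error at grid points, \<open>1024 * HS\<close> from
  the noise, the squared kernel integral from the drift, and the last term from the time regularity
  of the solution inside \<open>F\<close>.\<close>

definition rate_bound :: real where
  "rate_bound = 3 * (16 * \<Xi> + 1024 * HS + 2 * ((16 * (T powr (1 - \<rho>) / (1 - \<rho>)))\<^sup>2 * drift_bound) + 6 * T\<^sup>2 * L\<^sup>2 * holder_bound)"

lemma rate_bound_nonneg: "0 \<le> rate_bound"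
  unfolding rate_bound_def using \<Xi>_nonneg HS_nonneg drift_bound_nonneg holder_bound_nonneg by simp

section \<open>The scheme in coordinates and its noise error\<close>

context
  fixes Mt :: nat and N :: nat
  assumes Mt: "1 \<le> Mt"
begin

definition \<tau> :: real where "\<tau> = T / real Mt"

definition Y :: "nat \<Rightarrow> 'b \<Rightarrow> 'a" where "Y m = scheme e lam F \<Phi> w \<xi> T Mt N m"

definition res :: "nat \<Rightarrow> real" where "res i = 1 / (1 + \<tau> * lam i)"

definition noise :: "nat \<Rightarrow> nat \<Rightarrow> 'b \<Rightarrow> real" where
  "noise i k \<omega> = (\<Sum>n. \<phi> i n * (w n (real (Suc k) * \<tau>) \<omega> - w n (real k * \<tau>) \<omega>))"

lemma tau_pos: "0 < \<tau>"
  using T Mt by (simp add: \<tau>_def)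

lemma grid_le_T: "m \<le> Mt \<Longrightarrow> real m * \<tau> \<le> T"
  using T Mt by (simp add: \<tau>_def field_simps)

lemma res_bounds: "0 < res i" "res i \<le> 1"
  using tau_pos lam_pos[of i] by (auto simp: res_def field_simps add_pos_nonneg)

lemma scheme_0_inner: "Y 0 \<omega> \<bullet> e i = (if i < N then \<xi> \<omega> \<bullet> e i else 0)"
  by (simp add: Y_def projN_inner)

lemma scheme_Suc_inner:
  "Y (Suc m) \<omega> \<bullet> e i =
    (if i < N then res i * (Y m \<omega> \<bullet> e i + \<tau> * (F (Y m \<omega>) \<bullet> e i) + noise i m \<omega>) else Y m \<omega> \<bullet> e i)"
proof -
  have "noise_incrN e lam \<Phi> w N \<tau> (real m * \<tau>) (real (Suc m) * \<tau>) \<omega> \<bullet> e i =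
      (if i < N then noise i m \<omega> / (1 + \<tau> * lam i) else 0)"
    by (simp add: noise_incrN_def inner_sum_basis noise_def \<phi>_def)
  moreover have "Y (Suc m) \<omega> = resolvN e lam N \<tau> (Y m \<omega>) + \<tau> *\<^sub>R resolvN e lam N \<tau> (projN e N (F (Y m \<omega>)))
       + noise_incrN e lam \<Phi> w N \<tau> (real m * \<tau>) (real (Suc m) * \<tau>) \<omega>"
    by (simp add: Y_def \<tau>_def Let_def)
  ultimately show ?thesis
    by (simp add: inner_add_left resolvN_inner projN_inner res_def add_divide_distrib)
qed

lemma scheme_inner_zero: "N \<le> i \<Longrightarrow> Y m \<omega> \<bullet> e i = 0"
  by (induction m) (simp_all add: scheme_0_inner scheme_Suc_inner)

lemma scheme_expansion: "Y m \<omega> = (\<Sum>i<N. (Y m \<omega> \<bullet> e i) *\<^sub>R e i)"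
  by (rule finite_expansion) (rule scheme_inner_zero)

text \<open>Discrete variation of constants. The exponent is \<open>m - k\<close> and not
  \<open>m - k - 1\<close> because the implicit step applies the resolvent also to the drift and
  noise of its own step.\<close>

lemma scheme_inner:
  assumes i: "i < N"
  shows "Y m \<omega> \<bullet> e i = res i ^ m * (\<xi> \<omega> \<bullet> e i) + (\<Sum>k<m. \<tau> * (res i ^ (m - k) * (F (Y k \<omega>) \<bullet> e i)))
    + (\<Sum>k<m. res i ^ (m - k) * noise i k \<omega>)"
proof (induction m)
  case 0
  then show ?case using i by (simp add: scheme_0_inner)
next
  case (Suc m)
  have p: "res i * res i ^ (m - k) = res i ^ (Suc m - k)" if "k < m" for k
    using that by (simp add: Suc_diff_le)
  have 1: "res i * (\<Sum>k<m. \<tau> * (res i ^ (m - k) * (F (Y k \<omega>) \<bullet> e i))) =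
      (\<Sum>k<m. \<tau> * (res i ^ (Suc m - k) * (F (Y k \<omega>) \<bullet> e i)))"
    unfolding sum_distrib_left by (intro sum.cong refl) (simp add: p[symmetric])
  have 2: "res i * (\<Sum>k<m. res i ^ (m - k) * noise i k \<omega>) = (\<Sum>k<m. res i ^ (Suc m - k) * noise i k \<omega>)"
    unfolding sum_distrib_left by (intro sum.cong refl) (simp add: p[symmetric])
  have "Y (Suc m) \<omega> \<bullet> e i = res i * (Y m \<omega> \<bullet> e i) + res i * (\<tau> * (F (Y m \<omega>) \<bullet> e i)) + res i * noise i m \<omega>"
    using i by (simp add: scheme_Suc_inner distrib_left)
  also have "res i * (Y m \<omega> \<bullet> e i) = res i ^ Suc m * (\<xi> \<omega> \<bullet> e i) +
      (\<Sum>k<m. \<tau> * (res i ^ (Suc m - k) * (F (Y k \<omega>) \<bullet> e i))) + (\<Sum>k<m. res i ^ (Suc m - k) * noise i k \<omega>)"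
    unfolding Suc distrib_left 1 2 by simp
  finally show ?case by simp
qed

lemma noise_measurable [measurable]: "noise i k \<in> borel_measurable M"
proof -
  have "(\<lambda>\<omega> t. w n t \<omega>) \<in> measurable M (Pi\<^sub>M UNIV (\<lambda>_. borel))" for n
    using indep by (auto simp: indep_vars_def)
  from measurable_compose[OF this measurable_component_singleton]
  have [measurable]: "w n t \<in> borel_measurable M" for n t by simp
  show ?thesis unfolding noise_def by measurable
qed

lemma scheme_measurable: "Y m \<in> borel_measurable M"
proof (induction m)
  case 0
  have "(\<lambda>\<omega>. \<Sum>i<N. (Y 0 \<omega> \<bullet> e i) *\<^sub>R e i) \<in> borel_measurable M"
    by (rule borel_measurable_sum_scaleR) (simp add: scheme_0_inner)
  then show ?case unfolding scheme_expansion[symmetric] .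
next
  case (Suc m)
  have [measurable]: "(\<lambda>\<omega>. Y m \<omega> \<bullet> e i) \<in> borel_measurable M" "(\<lambda>\<omega>. F (Y m \<omega>) \<bullet> e i) \<in> borel_measurable M" for i
    using borel_measurable_inner_basis[OF Suc] F_inner_measurable[OF Suc] by auto
  have "(\<lambda>\<omega>. \<Sum>i<N. (Y (Suc m) \<omega> \<bullet> e i) *\<^sub>R e i) \<in> borel_measurable M"
    by (rule borel_measurable_sum_scaleR) (simp add: scheme_Suc_inner)
  then show ?case unfolding scheme_expansion[symmetric] .
qed

lemma Y_inner_measurable [measurable]: "(\<lambda>\<omega>. Y m \<omega> \<bullet> e i) \<in> borel_measurable M"
  by (rule borel_measurable_inner_basis[OF scheme_measurable])

lemma FY_inner_measurable [measurable]: "(\<lambda>\<omega>. F (Y m \<omega>) \<bullet> e i) \<in> borel_measurable M"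
  by (rule F_inner_measurable[OF scheme_measurable])

text \<open>The series for the difference of the two convolutions is identified with the difference
  of their series. This requires convergence of the convolution series and of each of the
  \<open>m\<close> increment series outside one null set.\<close>

lemma stochastic_error:
  assumes m: "m \<le> Mt"
  shows "(\<integral>\<^sup>+\<omega>. ennreal ((conv i 0 (real m * \<tau>) \<omega> - (\<Sum>k<m. res i ^ (m - k) * noise i k \<omega>))\<^sup>2) \<partial>M) \<le>
    ennreal (1024 * \<tau> powr (2*\<rho>) * lam i powr (\<beta> - 1) * noise_weight i)"
proof -
  obtain Z where Z: "Z \<in> borel_measurable M"
    "AE \<omega> in M. (\<lambda>n. \<phi> i n * (wexp (lam i) 0 (real m * \<tau>) (\<lambda>r. w n r \<omega>) -
      (\<Sum>k<m. (1 / (1 + \<tau> * lam i)) ^ (m - k) * (w n (real (Suc k) * \<tau>) \<omega> - w n (real k * \<tau>) \<omega>)))) sums Z \<omega>"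
    "(\<integral>\<^sup>+\<omega>. ennreal ((Z \<omega>)\<^sup>2) \<partial>M) \<le>
      ennreal (1024 * \<tau> powr (2*\<rho>) * lam i powr (2*\<rho> - 2*H) * (\<Sum>n. (\<phi> i n)\<^sup>2))"
    using fbm_scheme_error_series[OF fbm H(1) less_imp_le[OF H(2)] indep lam_pos[of i] tau_pos \<phi>_summable[of i] rho(4,2), of m]
    by blast
  have "AE \<omega> in M. \<forall>k\<in>{..<m}. summable (\<lambda>n. \<phi> i n * (w n (real (Suc k) * \<tau>) \<omega> - w n (real k * \<tau>) \<omega>))"
    using tau_pos by (intro AE_finite_allI fbm_increment_series[OF fbm indep _ _ \<phi>_summable]) auto
  moreover have "AE \<omega> in M. (\<lambda>n. \<phi> i n * wexp (lam i) 0 (real m * \<tau>) (\<lambda>r. w n r \<omega>)) sums conv i 0 (real m * \<tau>) \<omega>"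
    using tau_pos by (intro conv(2)) auto
  ultimately have "AE \<omega> in M. conv i 0 (real m * \<tau>) \<omega> - (\<Sum>k<m. res i ^ (m - k) * noise i k \<omega>) = Z \<omega>"
    using Z(2)
  proof eventually_elim
    case (elim \<omega>)
    let ?d = "\<lambda>n k. w n (real (Suc k) * \<tau>) \<omega> - w n (real k * \<tau>) \<omega>"
    have "(\<lambda>n. \<phi> i n * wexp (lam i) 0 (real m * \<tau>) (\<lambda>r. w n r \<omega>) - (\<Sum>k<m. res i ^ (m - k) * (\<phi> i n * ?d n k)))
        sums (conv i 0 (real m * \<tau>) \<omega> - (\<Sum>k<m. res i ^ (m - k) * noise i k \<omega>))"
    proof (intro sums_diff sums_sum sums_mult elim(2))
      fix k assume "k \<in> {..<m}"
      then show "(\<lambda>n. \<phi> i n * ?d n k) sums noise i k \<omega>"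
        unfolding noise_def using elim(1) by (intro summable_sums) auto
    qed
    moreover have "\<phi> i n * wexp (lam i) 0 (real m * \<tau>) (\<lambda>r. w n r \<omega>) - (\<Sum>k<m. res i ^ (m - k) * (\<phi> i n * ?d n k)) =
        \<phi> i n * (wexp (lam i) 0 (real m * \<tau>) (\<lambda>r. w n r \<omega>) - (\<Sum>k<m. (1 / (1 + \<tau> * lam i)) ^ (m - k) * ?d n k))" for n
    proof -
      have S: "(\<Sum>k<m. res i ^ (m - k) * (\<phi> i n * ?d n k)) = \<phi> i n * (\<Sum>k<m. (1 / (1 + \<tau> * lam i)) ^ (m - k) * ?d n k)"
        unfolding res_def sum_distrib_left by (intro sum.cong refl) (simp only: ac_simps)
      show ?thesis unfolding S by (simp only: right_diff_distrib)
    qed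
    ultimately show ?case using elim(3) sums_unique2 by simp blast
  qed
  then have "(\<integral>\<^sup>+\<omega>. ennreal ((conv i 0 (real m * \<tau>) \<omega> - (\<Sum>k<m. res i ^ (m - k) * noise i k \<omega>))\<^sup>2) \<partial>M) =
      (\<integral>\<^sup>+\<omega>. ennreal ((Z \<omega>)\<^sup>2) \<partial>M)"
    by (intro nn_integral_cong_AE) (auto elim!: AE_mp)
  then show ?thesis using Z(3) by (simp add: rho(6) noise_weight_def)
qed

section \<open>Drift error, error recursion and the final estimate\<close>

definition cell :: "real \<Rightarrow> nat" where "cell s = nat \<lfloor>s / \<tau>\<rfloor>"

definition err :: "nat \<Rightarrow> ennreal" where
  "err m = msq M N (\<lambda>i \<omega>. X N (real m * \<tau>) \<omega> \<bullet> e i - Y m \<omega> \<bullet> e i)"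

text \<open>The solution at the left grid point is inserted: its distance to the solution at
  \<open>s\<close> is paid by time regularity, the rest is the error of the scheme at that
  point.\<close>

lemma drift_difference:
  assumes s: "s \<in> {0..T}"
  shows "msq M N (\<lambda>i \<omega>. F (X N s \<omega>) \<bullet> e i - F (Y (cell s) \<omega>) \<bullet> e i) \<le>
    ennreal (3 * L\<^sup>2) * (ennreal (holder_bound * \<tau> powr (2*\<rho>)) + err (cell s))"
proof -
  define k where "k = cell s"
  have k: "real k * \<tau> \<le> s" "s < real (Suc k) * \<tau>"
    using nat_floor_bounds[OF tau_pos, of s] s by (auto simp: k_def cell_def)
  have k0: "0 \<le> real k * \<tau>" using tau_pos by simp
  have "msq M N (\<lambda>i \<omega>. F (X N s \<omega>) \<bullet> e i - F (Y k \<omega>) \<bullet> e i) \<le>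
      (\<integral>\<^sup>+\<omega>. ennreal (L\<^sup>2) * ennreal (\<Sum>i<N. (X N s \<omega> \<bullet> e i - Y k \<omega> \<bullet> e i)\<^sup>2) \<partial>M)"
    unfolding msq_def
  proof (rule nn_integral_mono_AE)
    show "AE \<omega> in M. ennreal (\<Sum>i<N. (F (X N s \<omega>) \<bullet> e i - F (Y k \<omega>) \<bullet> e i)\<^sup>2) \<le>
        ennreal (L\<^sup>2) * ennreal (\<Sum>i<N. (X N s \<omega> \<bullet> e i - Y k \<omega> \<bullet> e i)\<^sup>2)"
      using mild_components(2)[OF s, of N]
    proof eventually_elim
      case (elim \<omega>)
      have "(\<Sum>i<N. (F (X N s \<omega>) \<bullet> e i - F (Y k \<omega>) \<bullet> e i)\<^sup>2) \<le> L\<^sup>2 * (\<Sum>i<N. (X N s \<omega> \<bullet> e i - Y k \<omega> \<bullet> e i)\<^sup>2)"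
        using elim scheme_inner_zero by (intro F_lipschitz_components) auto
      then show ?case by (subst ennreal_mult[symmetric]) (auto intro: ennreal_leI sum_nonneg)
    qed
  qed
  also have "\<dots> = ennreal (L\<^sup>2) * msq M N (\<lambda>i \<omega>. X N s \<omega> \<bullet> e i - Y k \<omega> \<bullet> e i)"
    unfolding msq_def by (rule nn_integral_cmult) measurable
  also have "\<dots> \<le> ennreal (L\<^sup>2) * (3 * (ennreal (holder_bound * \<tau> powr (2*\<rho>)) + err k))"
  proof (rule mult_left_mono)
    have "msq M N (\<lambda>i \<omega>. X N s \<omega> \<bullet> e i - Y k \<omega> \<bullet> e i) \<le>
        3 * (msq M N (\<lambda>i \<omega>. X N s \<omega> \<bullet> e i - X N (real k * \<tau>) \<omega> \<bullet> e i) + err k)"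
      unfolding err_def
      by (rule msq_add_le) (auto intro!: borel_measurable_diff X_inner_measurable Y_inner_measurable)
    also have "\<dots> \<le> 3 * (ennreal (holder_bound * \<tau> powr (2*\<rho>)) + err k)"
    proof (intro mult_left_mono add_mono order_refl)
      have "msq M N (\<lambda>i \<omega>. X N s \<omega> \<bullet> e i - X N (real k * \<tau>) \<omega> \<bullet> e i) \<le> ennreal (holder_bound * (s - real k * \<tau>) powr (2*\<rho>))"
        by (rule solution_holder) (use k0 k s in auto)
      also have "\<dots> \<le> ennreal (holder_bound * \<tau> powr (2*\<rho>))"
      proof (intro ennreal_leI mult_left_mono powr_mono2 holder_bound_nonneg)
        have "real (Suc k) * \<tau> = real k * \<tau> + \<tau>" by (simp add: distrib_right)
        then show "s - real k * \<tau> \<le> \<tau>" using k by linarith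
      qed (use k rho in auto)
      finally show "msq M N (\<lambda>i \<omega>. X N s \<omega> \<bullet> e i - X N (real k * \<tau>) \<omega> \<bullet> e i) \<le> ennreal (holder_bound * \<tau> powr (2*\<rho>))" .
    qed auto
    finally show "msq M N (\<lambda>i \<omega>. X N s \<omega> \<bullet> e i - Y k \<omega> \<bullet> e i) \<le> 3 * (ennreal (holder_bound * \<tau> powr (2*\<rho>)) + err k)" .
  qed simp
  also have "\<dots> = ennreal (3 * L\<^sup>2) * (ennreal (holder_bound * \<tau> powr (2*\<rho>)) + err k)"
  proof -
    have "ennreal (3 * L\<^sup>2) = ennreal (L\<^sup>2) * 3" by (subst mult.commute, subst ennreal_mult) auto
    then show ?thesis by (simp only: mult.assoc)
  qed
  finally show ?thesis by (simp only: k_def)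
qed

text \<open>With \<open>r\<close> the resolvent power, the integrand splits into
  \<open>exp (- (t - s) * lam i) - r\<close> times the drift of the solution plus \<open>r\<close>
  times the difference of the drifts. The former has the singular kernel \<open>k1\<close>, the
  latter a kernel at most one.\<close>

lemma drift_error:
  assumes m: "m \<le> Mt"
  defines "\<kappa> \<equiv> 16 * \<tau> powr \<rho> * (T powr (1 - \<rho>) / (1 - \<rho>))"
  shows "msq M N (\<lambda>i \<omega>. drift_int N i (real m * \<tau>) \<omega> - (\<Sum>k<m. \<tau> * (res i ^ (m - k) * (F (Y k \<omega>) \<bullet> e i)))) \<le>
    2 * ennreal (\<kappa>\<^sup>2 * drift_bound) +
    2 * (ennreal T * (\<Sum>k<m. ennreal \<tau> * (ennreal (3 * L\<^sup>2) * (ennreal (holder_bound * \<tau> powr (2*\<rho>)) + err k))))"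
proof -
  define t where "t = real m * \<tau>"
  have t: "0 \<le> t" "t \<le> T" "t \<in> {0..T}" using tau_pos grid_le_T[OF m] by (auto simp: t_def)
  define k1 where "k1 s = 16 * \<tau> powr \<rho> * (t - s) powr (- \<rho>)" for s
  have k1m [measurable]: "k1 \<in> borel_measurable borel" unfolding k1_def by measurable
  let ?G = "\<lambda>i s \<omega>. exp (- (t - s) * lam i) * (F (X N s \<omega>) \<bullet> e i) - res i ^ (m - cell s) * (F (Y (cell s) \<omega>) \<bullet> e i)"
  let ?f2 = "\<lambda>i s \<omega>. F (X N s \<omega>) \<bullet> e i - F (Y (cell s) \<omega>) \<bullet> e i"
  have \<kappa>0: "0 \<le> \<kappa>" using rho by (simp add: \<kappa>_def)
  have k1int: "(\<integral>\<^sup>+s\<in>{0..t}. ennreal (k1 s) \<partial>lborel) \<le> ennreal \<kappa>"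
  proof -
    have "(\<integral>\<^sup>+s\<in>{0..t}. ennreal (k1 s) \<partial>lborel) =
        (\<integral>\<^sup>+s. ennreal (16 * \<tau> powr \<rho>) * (ennreal ((t - s) powr (- \<rho>)) * indicator {0..t} s) \<partial>lborel)"
      by (intro nn_integral_cong) (simp add: k1_def ennreal_mult mult.assoc)
    also have "\<dots> = ennreal (16 * \<tau> powr \<rho>) * (\<integral>\<^sup>+s\<in>{0..t}. ennreal ((t - s) powr (- \<rho>)) \<partial>lborel)"
      by (rule nn_integral_cmult) measurable
    also have "\<dots> \<le> ennreal (16 * \<tau> powr \<rho>) * ennreal (T powr (1 - \<rho>) / (1 - \<rho>))"
      by (intro mult_left_mono nn_integral_singular_kernel_le rho t) auto
    also have "\<dots> = ennreal \<kappa>" unfolding \<kappa>_def using rho by (intro ennreal_mult[symmetric]) auto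
    finally show ?thesis .
  qed
  have cell_m [measurable]: "cell \<in> measurable borel (count_space UNIV)"
    unfolding cell_def by measurable
  have "msq M N (\<lambda>i \<omega>. drift_int N i t \<omega> - (\<Sum>k<m. \<tau> * (res i ^ (m - k) * (F (Y k \<omega>) \<bullet> e i)))) \<le>
      2 * ((\<integral>\<^sup>+s\<in>{0..t}. ennreal (k1 s) \<partial>lborel) * (\<integral>\<^sup>+s\<in>{0..t}. ennreal (k1 s) * msq M N (\<lambda>i \<omega>. F (X N s \<omega>) \<bullet> e i) \<partial>lborel)) +
      2 * ((\<integral>\<^sup>+s\<in>{0..t}. ennreal 1 \<partial>lborel) * (\<integral>\<^sup>+s\<in>{0..t}. ennreal 1 * msq M N (\<lambda>i. ?f2 i s) \<partial>lborel))"
  proof (rule drift_msq_bound[where ?f1.0 = "\<lambda>i s \<omega>. F (X N s \<omega>) \<bullet> e i" and ?f2.0 = ?f2 and G = ?G])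
    fix i assume i: "i < N"
    have Yj: "(\<lambda>p. F (Y (cell (fst p)) (snd p)) \<bullet> e i) \<in> borel_measurable (lborel \<Otimes>\<^sub>M M)"
      by (rule measurable_compose_countable[where f = "\<lambda>k p. F (Y k (snd p)) \<bullet> e i" and g = "\<lambda>p. cell (fst p)"]) measurable
    show "(\<lambda>p. ?f2 i (fst p) (snd p)) \<in> borel_measurable (lborel \<Otimes>\<^sub>M M)"
      by (intro borel_measurable_diff FX_joint Yj)
    show "(\<lambda>\<omega>. drift_int N i t \<omega> - (\<Sum>k<m. \<tau> * (res i ^ (m - k) * (F (Y k \<omega>) \<bullet> e i)))) \<in> borel_measurable M"
      using drift_int_measurable[OF t(1), of N i] by measurable
    show "AE \<omega> in M. ((\<lambda>s. ?G i s \<omega>) has_integral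
        drift_int N i t \<omega> - (\<Sum>k<m. \<tau> * (res i ^ (m - k) * (F (Y k \<omega>) \<bullet> e i)))) {0..t}"
      using mild_components(1)[OF t(3), of N]
    proof eventually_elim
      case (elim \<omega>)
      have "((\<lambda>s. res i ^ (m - cell s) * (F (Y (cell s) \<omega>) \<bullet> e i)) has_integral
          (\<Sum>k<m. \<tau> * (res i ^ (m - k) * (F (Y k \<omega>) \<bullet> e i)))) {0..t}"
        unfolding t_def cell_def by (rule has_integral_step_function[OF tau_pos])
      then show ?case using elim i by (intro has_integral_diff) auto
    qed
    fix s \<omega> assume s: "s \<in> {0..t}"
    define r where "r = res i ^ (m - cell s)"
    have r: "0 \<le> r" "r \<le> 1" using res_bounds[of i] by (auto simp: r_def power_le_one)
    have "\<bar>exp (- (t - s) * lam i) - r\<bar> \<le> k1 s"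
    proof (cases "s = t")
      case True
      \<comment> \<open>At the end point the floor jumps to \<open>m\<close>, the resolvent power is
        one and the difference is zero; \<open>k1\<close> vanishes there because
        \<open>0 powr\<close> anything is zero.\<close>
      then have "cell s = m" using tau_pos by (simp add: cell_def t_def)
      then show ?thesis using True by (simp add: k1_def r_def)
    next
      case False
      have b: "real (cell s) * \<tau> \<le> s" "s < real (Suc (cell s)) * \<tau>"
        using nat_floor_bounds[OF tau_pos, of s] s by (auto simp: cell_def)
      have "real (cell s) * \<tau> < real m * \<tau>" using b s False by (auto simp: t_def)
      then have cm: "cell s < m" using tau_pos by simp
      have z: "- (t - s) * lam i = - (\<tau> * lam i) * ((t - s) / \<tau>)" using tau_pos by (simp add: field_simps)
      have "\<bar>exp (- (\<tau> * lam i) * ((t - s) / \<tau>)) - (1 / (1 + \<tau> * lam i)) ^ (m - cell s)\<bar> \<le> 16 * ((t - s) / \<tau>) powr (- \<rho>)"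
      proof (rule exp_resolvent_diff_powr)
        show "0 \<le> \<tau> * lam i" using tau_pos lam_pos[of i] by simp
        show "real (m - cell s) - 1 \<le> (t - s) / \<tau>" "(t - s) / \<tau> \<le> real (m - cell s)"
          using b cm tau_pos by (simp_all add: t_def of_nat_diff field_simps)
        show "0 < (t - s) / \<tau>" using s False tau_pos by auto
      qed (use rho in auto)
      also have "16 * ((t - s) / \<tau>) powr (- \<rho>) = k1 s"
        using s tau_pos by (simp add: k1_def powr_divide powr_minus_divide)
      finally show ?thesis unfolding r_def res_def z .
    qed
    then have "\<bar>exp (- (t - s) * lam i) - r\<bar> * \<bar>F (X N s \<omega>) \<bullet> e i\<bar> \<le> k1 s * \<bar>F (X N s \<omega>) \<bullet> e i\<bar>"
      by (rule mult_right_mono) simp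
    moreover have "r * \<bar>?f2 i s \<omega>\<bar> \<le> 1 * \<bar>?f2 i s \<omega>\<bar>" using r by (intro mult_right_mono) auto
    moreover have "?G i s \<omega> = (exp (- (t - s) * lam i) - r) * (F (X N s \<omega>) \<bullet> e i) + r * ?f2 i s \<omega>"
      by (simp add: r_def algebra_simps)
    then have "\<bar>?G i s \<omega>\<bar> \<le> \<bar>exp (- (t - s) * lam i) - r\<bar> * \<bar>F (X N s \<omega>) \<bullet> e i\<bar> + r * \<bar>?f2 i s \<omega>\<bar>"
      using abs_triangle_ineq[of "(exp (- (t - s) * lam i) - r) * (F (X N s \<omega>) \<bullet> e i)" "r * ?f2 i s \<omega>"] r(1)
      by (simp only: abs_mult abs_of_nonneg)
    ultimately show "\<bar>?G i s \<omega>\<bar> \<le> k1 s * \<bar>F (X N s \<omega>) \<bullet> e i\<bar> + 1 * \<bar>?f2 i s \<omega>\<bar>" by linarith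
  qed (use FX_joint in \<open>auto simp: k1_def\<close>)
  also have "\<dots> \<le> 2 * ennreal (\<kappa>\<^sup>2 * drift_bound) +
      2 * (ennreal T * (\<Sum>k<m. ennreal \<tau> * (ennreal (3 * L\<^sup>2) * (ennreal (holder_bound * \<tau> powr (2*\<rho>)) + err k))))"
  proof -
    have one: "(\<integral>\<^sup>+s\<in>{0..t}. ennreal 1 \<partial>lborel) \<le> ennreal T"
      using t by (simp add: ennreal_leI)
    have "(\<integral>\<^sup>+s\<in>{0..t}. ennreal 1 * msq M N (\<lambda>i. ?f2 i s) \<partial>lborel) \<le>
        (\<integral>\<^sup>+s\<in>{0..real m * \<tau>}. (\<lambda>k. ennreal (3 * L\<^sup>2) * (ennreal (holder_bound * \<tau> powr (2*\<rho>)) + err k)) (nat \<lfloor>s / \<tau>\<rfloor>) \<partial>lborel)"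
    proof (rule nn_integral_mono)
      fix s :: real
      show "ennreal 1 * msq M N (\<lambda>i. ?f2 i s) * indicator {0..t} s \<le>
          ennreal (3 * L\<^sup>2) * (ennreal (holder_bound * \<tau> powr (2*\<rho>)) + err (nat \<lfloor>s / \<tau>\<rfloor>)) * indicator {0..real m * \<tau>} s"
      proof (cases "s \<in> {0..t}")
        case True
        then have "s \<in> {0..T}" using t by auto
        from drift_difference[OF this] show ?thesis unfolding t_def[symmetric] cell_def ennreal_1 mult_1
          by (rule mult_right_mono) simp
      next
        case False
        then have "indicator {0..t} s = (0::ennreal)" by (rule indicator_simps(2))
        then show ?thesis by (simp only: mult_zero_right zero_le)
      qed
    qed
    also have "\<dots> = (\<Sum>k<m. ennreal \<tau> * (ennreal (3 * L\<^sup>2) * (ennreal (holder_bound * \<tau> powr (2*\<rho>)) + err k)))"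
      by (rule nn_integral_step_function[OF tau_pos])
    finally show ?thesis
      by (intro add_mono mult_left_mono mult_mono one weighted_drift_moment[OF k1m t(3) k1int \<kappa>0]) auto
  qed
  finally show ?thesis unfolding t_def .
qed

text \<open>The coefficient 18 collects 3 from the splitting into initial value, noise and drift, 2
  from the drift estimate, and 3 from inserting the solution at the grid point.\<close>

lemma error_recursion:
  assumes m: "m \<le> Mt"
  shows "err m \<le> ennreal (rate_bound * \<tau> powr (2*\<rho>)) + ennreal (18 * T * L\<^sup>2 * \<tau>) * (\<Sum>k<m. err k)"
proof -
  define t where "t = real m * \<tau>"
  define \<kappa> where "\<kappa> = 16 * \<tau> powr \<rho> * (T powr (1 - \<rho>) / (1 - \<rho>))"
  define Q where "Q = \<tau> powr (2*\<rho>)"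
  have t: "0 \<le> t" "t \<le> T" using tau_pos grid_le_T[OF m] by (auto simp: t_def)
  have Q: "0 \<le> Q" by (simp add: Q_def)
  have [measurable]: "drift_int N i t \<in> borel_measurable M" "conv i 0 t \<in> borel_measurable M" for i
    using t by (auto intro: drift_int_measurable conv_measurable)
  let ?A = "\<lambda>i \<omega>. (exp (- t * lam i) - res i ^ m) * (\<xi> \<omega> \<bullet> e i)"
  let ?B = "\<lambda>i \<omega>. conv i 0 t \<omega> - (\<Sum>k<m. res i ^ (m - k) * noise i k \<omega>)"
  let ?C = "\<lambda>i \<omega>. drift_int N i t \<omega> - (\<Sum>k<m. \<tau> * (res i ^ (m - k) * (F (Y k \<omega>) \<bullet> e i)))"
  have A: "msq M N ?A \<le> ennreal (16 * Q * \<Xi>)"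
  proof (rule msq_initial_bound)
    fix i \<omega>
    have z: "- t * lam i = - (\<tau> * lam i) * real m" by (simp add: t_def)
    have "\<bar>exp (- t * lam i) - res i ^ m\<bar> \<le> 4 * (\<tau> * lam i) powr \<rho>"
      unfolding z res_def by (rule exp_resolvent_diff_node) (use tau_pos lam_pos[of i] rho in auto)
    then have "\<bar>exp (- t * lam i) - res i ^ m\<bar>\<^sup>2 \<le> (4 * (\<tau> * lam i) powr \<rho>)\<^sup>2"
      by (rule power_mono) simp
    also have "\<dots> = 16 * (\<tau> * lam i) powr (2*\<rho>)" unfolding power_mult_distrib powr_square by simp
    also have "\<dots> = 16 * Q * lam i powr (2*\<rho>)"
      using tau_pos lam_pos[of i] by (simp add: Q_def powr_mult)
    finally show "(?A i \<omega>)\<^sup>2 \<le> 16 * Q * lam i powr (2*\<rho>) * (\<xi> \<omega> \<bullet> e i)\<^sup>2"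
      unfolding power_mult_distrib power2_abs by (rule mult_right_mono) simp
  qed (use Q in simp)
  have B: "msq M N ?B \<le> ennreal (1024 * Q * HS)"
  proof (rule msq_noise_bound)
    fix i
    show "?B i \<in> borel_measurable M" by measurable
    show "(\<integral>\<^sup>+\<omega>. ennreal ((?B i \<omega>)\<^sup>2) \<partial>M) \<le> ennreal (1024 * Q * lam i powr (\<beta> - 1) * noise_weight i)"
      using stochastic_error[OF m, of i] by (simp add: t_def Q_def)
  qed (use Q in simp)
  have C: "msq M N ?C \<le> ennreal (2 * (\<kappa>\<^sup>2 * drift_bound)) + ennreal (6 * T\<^sup>2 * L\<^sup>2 * (holder_bound * Q)) + ennreal (6 * T * L\<^sup>2 * \<tau>) * (\<Sum>k<m. err k)"
  proof -
    have c6: "2 * (ennreal T * (ennreal \<tau> * ennreal (3 * L\<^sup>2))) = ennreal (6 * T * L\<^sup>2 * \<tau>)"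
    proof -
      have "ennreal (6 * T * L\<^sup>2 * \<tau>) = ennreal (2 * (T * (\<tau> * (3 * L\<^sup>2))))" by (simp add: ac_simps)
      also have "\<dots> = 2 * (ennreal T * (ennreal \<tau> * ennreal (3 * L\<^sup>2)))"
        using T tau_pos by (subst ennreal_mult, simp, simp, subst ennreal_mult, simp, simp, subst ennreal_mult) auto
      finally show ?thesis by simp
    qed
    have "2 * (ennreal T * (\<Sum>k<m. ennreal \<tau> * (ennreal (3 * L\<^sup>2) * (ennreal (holder_bound * Q) + err k)))) =
        (2 * (ennreal T * (ennreal \<tau> * ennreal (3 * L\<^sup>2)))) * (\<Sum>k<m. ennreal (holder_bound * Q) + err k)"
      by (simp add: sum_distrib_left mult.assoc)
    also have "\<dots> = ennreal (6 * T * L\<^sup>2 * \<tau>) * (of_nat m * ennreal (holder_bound * Q)) + ennreal (6 * T * L\<^sup>2 * \<tau>) * (\<Sum>k<m. err k)"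
      unfolding c6 by (simp add: sum.distrib distrib_left)
    also have "ennreal (6 * T * L\<^sup>2 * \<tau>) * (of_nat m * ennreal (holder_bound * Q)) \<le> ennreal (6 * T\<^sup>2 * L\<^sup>2 * (holder_bound * Q))"
    proof -
      have "ennreal (6 * T * L\<^sup>2 * \<tau>) * (of_nat m * ennreal (holder_bound * Q)) = ennreal (6 * T * L\<^sup>2 * \<tau> * (real m * (holder_bound * Q)))"
        using T tau_pos Q holder_bound_nonneg
        by (simp add: ennreal_of_nat_eq_real_of_nat ennreal_mult[symmetric] del: ennreal_mult'')
      \<comment> \<open>The \<open>m\<close> equal local contributions, each with a factor
        \<open>\<tau>\<close>, add up to \<open>t \<le> T\<close>.\<close>
      also have "6 * T * L\<^sup>2 * \<tau> * (real m * (holder_bound * Q)) = t * (6 * T * L\<^sup>2 * (holder_bound * Q))"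
        by (simp add: t_def)
      also have "ennreal (t * (6 * T * L\<^sup>2 * (holder_bound * Q))) \<le> ennreal (T * (6 * T * L\<^sup>2 * (holder_bound * Q)))"
        using t T Q holder_bound_nonneg by (intro ennreal_leI mult_right_mono) auto
      finally show ?thesis by (simp add: power2_eq_square ac_simps)
    qed
    finally have *: "2 * (ennreal T * (\<Sum>k<m. ennreal \<tau> * (ennreal (3 * L\<^sup>2) * (ennreal (holder_bound * Q) + err k)))) \<le>
        ennreal (6 * T\<^sup>2 * L\<^sup>2 * (holder_bound * Q)) + ennreal (6 * T * L\<^sup>2 * \<tau>) * (\<Sum>k<m. err k)"
      by (simp add: add_right_mono)
    have "2 * ennreal (\<kappa>\<^sup>2 * drift_bound) = ennreal (2 * (\<kappa>\<^sup>2 * drift_bound))"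
      using drift_bound_nonneg by (subst ennreal_mult) auto
    then show ?thesis
      using drift_error[OF m] * unfolding t_def Q_def \<kappa>_def
      by (simp only: add.assoc) (rule order_trans, assumption, rule add_left_mono)
  qed
  have "err m \<le> 3 * (msq M N ?A + msq M N ?B + msq M N ?C)"
    unfolding err_def
  proof (rule msq_add3_le)
    fix i assume "i < N"
    then show "AE \<omega> in M. X N (real m * \<tau>) \<omega> \<bullet> e i - Y m \<omega> \<bullet> e i = ?A i \<omega> + ?B i \<omega> + ?C i \<omega>"
      by (simp add: scheme_inner drift_int_def t_def algebra_simps)
  qed measurable
  also have "\<dots> \<le> 3 * (ennreal (16 * Q * \<Xi>) + ennreal (1024 * Q * HS) +
      (ennreal (2 * (\<kappa>\<^sup>2 * drift_bound)) + ennreal (6 * T\<^sup>2 * L\<^sup>2 * (holder_bound * Q)) + ennreal (6 * T * L\<^sup>2 * \<tau>) * (\<Sum>k<m. err k)))"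
    by (intro mult_left_mono add_mono A B C) auto
  also have "\<dots> = ennreal (3 * (16 * Q * \<Xi> + 1024 * Q * HS + 2 * (\<kappa>\<^sup>2 * drift_bound) + 6 * T\<^sup>2 * L\<^sup>2 * (holder_bound * Q))) +
      ennreal (3 * (6 * T * L\<^sup>2 * \<tau>)) * (\<Sum>k<m. err k)"
  proof -
    have 1: "ennreal (3 * (6 * T * L\<^sup>2 * \<tau>)) = 3 * ennreal (6 * T * L\<^sup>2 * \<tau>)"
      using T tau_pos by (subst ennreal_mult) auto
    have "ennreal (3 * (16 * Q * \<Xi> + 1024 * Q * HS + (2 * (\<kappa>\<^sup>2 * drift_bound) + 6 * T\<^sup>2 * L\<^sup>2 * (holder_bound * Q)))) =
      3 * (ennreal (16 * Q * \<Xi>) + ennreal (1024 * Q * HS) + ennreal (2 * (\<kappa>\<^sup>2 * drift_bound) + 6 * T\<^sup>2 * L\<^sup>2 * (holder_bound * Q)))"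
      by (rule ennreal_triple_sum[symmetric]) (use Q \<Xi>_nonneg HS_nonneg drift_bound_nonneg holder_bound_nonneg in auto)
    moreover have "ennreal (2 * (\<kappa>\<^sup>2 * drift_bound) + 6 * T\<^sup>2 * L\<^sup>2 * (holder_bound * Q)) =
        ennreal (2 * (\<kappa>\<^sup>2 * drift_bound)) + ennreal (6 * T\<^sup>2 * L\<^sup>2 * (holder_bound * Q))"
      by (rule ennreal_plus) (use Q drift_bound_nonneg holder_bound_nonneg in auto)
    ultimately show ?thesis unfolding 1 by (simp only: distrib_left mult.assoc add.assoc)
  qed
  also have "3 * (16 * Q * \<Xi> + 1024 * Q * HS + 2 * (\<kappa>\<^sup>2 * drift_bound) + 6 * T\<^sup>2 * L\<^sup>2 * (holder_bound * Q)) = rate_bound * Q"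
  proof -
    have "\<kappa>\<^sup>2 = Q * (16 * (T powr (1 - \<rho>) / (1 - \<rho>)))\<^sup>2"
      unfolding \<kappa>_def Q_def powr_square[symmetric] power_mult_distrib by (simp only: ac_simps)
    then show ?thesis by (simp add: rate_bound_def algebra_simps)
  qed
  finally show ?thesis by (simp add: Q_def mult.assoc)
qed

text \<open>Since \<open>m * \<tau> \<le> T\<close>, the growth factor of the discrete inequality
  stays below an exponential that does not depend on the step size.\<close>

lemma error_bound:
  assumes m: "m \<le> Mt"
  shows "err m \<le> ennreal (rate_bound * exp (18 * T\<^sup>2 * L\<^sup>2) * \<tau> powr (2*\<rho>))"
proof -
  have "err m \<le> ennreal (rate_bound * \<tau> powr (2*\<rho>) * (1 + 18 * T * L\<^sup>2 * \<tau>) ^ m)"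
    by (rule discrete_gronwall_ennreal[OF _ _ error_recursion m])
       (use T tau_pos rate_bound_nonneg in auto)
  also have "\<dots> \<le> ennreal (rate_bound * \<tau> powr (2*\<rho>) * exp (18 * T\<^sup>2 * L\<^sup>2))"
  proof (intro ennreal_leI mult_left_mono)
    have "(1 + 18 * T * L\<^sup>2 * \<tau>) ^ m \<le> exp (18 * T * L\<^sup>2 * \<tau>) ^ m"
      using T tau_pos by (intro power_mono exp_ge_add_one_self) auto
    also have "\<dots> = exp ((real m * \<tau>) * (18 * T * L\<^sup>2))"
      by (simp add: exp_of_nat_mult[symmetric] ac_simps)
    also have "\<dots> \<le> exp (T * (18 * T * L\<^sup>2))"
      using grid_le_T[OF m] T by (subst exp_le_cancel_iff) (intro mult_right_mono, auto)
    finally show "(1 + 18 * T * L\<^sup>2 * \<tau>) ^ m \<le> exp (18 * T\<^sup>2 * L\<^sup>2)"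
      by (simp add: power2_eq_square ac_simps)
  qed (use rate_bound_nonneg in auto)
  finally show ?thesis by (simp add: ac_simps)
qed

lemma norm_error:
  assumes m: "m \<le> Mt"
  shows "(\<integral>\<^sup>+\<omega>. ennreal ((norm (X N (real m * \<tau>) \<omega> - Y m \<omega>))\<^sup>2) \<partial>M) = err m"
  unfolding err_def msq_def
proof (rule nn_integral_cong_AE)
  have "real m * \<tau> \<in> {0..T}" using tau_pos grid_le_T[OF m] by simp
  from mild_components(2)[OF this, of N]
  show "AE \<omega> in M. ennreal ((norm (X N (real m * \<tau>) \<omega> - Y m \<omega>))\<^sup>2) =
      ennreal (\<Sum>i<N. (X N (real m * \<tau>) \<omega> \<bullet> e i - Y m \<omega> \<bullet> e i)\<^sup>2)"
  proof eventually_elim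
    case (elim \<omega>)
    have "(norm (X N (real m * \<tau>) \<omega> - Y m \<omega>))\<^sup>2 = (\<Sum>i<N. ((X N (real m * \<tau>) \<omega> - Y m \<omega>) \<bullet> e i)\<^sup>2)"
      by (rule norm_finite_expansion) (use elim scheme_inner_zero in \<open>auto simp: inner_diff_left\<close>)
    then show ?case by (simp add: inner_diff_left)
  qed
qed

end

lemma strong_convergence:
  "\<exists>C. \<forall>N Mt m. 1 \<le> Mt \<longrightarrow> m \<le> Mt \<longrightarrow>
     (\<integral>\<^sup>+\<omega>. ennreal ((norm (X N (real m * (T / real Mt)) \<omega>
                 - scheme e lam F \<Phi> w \<xi> T Mt N m \<omega>))\<^sup>2) \<partial>M)
     \<le> ennreal ((C * (1 + sqrt (enn2real (\<integral>\<^sup>+\<omega>. Vnorm2 e lam (2*H + \<beta> - 1) (\<xi> \<omega>) \<partial>M)))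
         * (T / real Mt) powr ((2*H + \<beta> - 1) / 2))\<^sup>2)"
proof (intro exI allI impI)
  fix N Mt m :: nat assume Mt: "1 \<le> Mt" and m: "m \<le> Mt"
  \<comment> \<open>Every ingredient is defined without reference to \<open>N\<close>,
    \<open>Mt\<close> or \<open>m\<close>. The constant sought is the square root of
    \<open>?K\<close>, as the estimate is stated for squares.\<close>
  let ?K = "rate_bound * exp (18 * T\<^sup>2 * L\<^sup>2)"
  let ?s = "sqrt (enn2real (\<integral>\<^sup>+\<omega>. Vnorm2 e lam (2*H + \<beta> - 1) (\<xi> \<omega>) \<partial>M))"
  have K: "0 \<le> ?K" using rate_bound_nonneg by simp
  have "(\<integral>\<^sup>+\<omega>. ennreal ((norm (X N (real m * (T / real Mt)) \<omega> - scheme e lam F \<Phi> w \<xi> T Mt N m \<omega>))\<^sup>2) \<partial>M) \<le>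
      ennreal (?K * (T / real Mt) powr (2*\<rho>))"
    using norm_error[OF Mt m, of N] error_bound[OF Mt m, of N] by (simp add: \<tau>_def[OF Mt] Y_def[OF Mt])
  also have "\<dots> \<le> ennreal ((sqrt ?K * (1 + ?s) * (T / real Mt) powr ((2*H + \<beta> - 1) / 2))\<^sup>2)"
  proof (rule ennreal_leI)
    \<comment> \<open>The moment of \<open>\<xi>\<close> is already contained in \<open>?K\<close>;
      the factor \<open>1 + ?s\<close> is at least one and can be inserted.\<close>
    have "1 \<le> (1 + ?s)\<^sup>2" by (rule one_le_power) simp
    then have "?K * 1 * (T / real Mt) powr (2*\<rho>) \<le> ?K * (1 + ?s)\<^sup>2 * (T / real Mt) powr (2*\<rho>)"
      using K by (intro mult_right_mono mult_left_mono) auto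
    also have "\<dots> = (sqrt ?K * (1 + ?s) * (T / real Mt) powr \<rho>)\<^sup>2"
      unfolding power_mult_distrib powr_square using K by simp
    finally show "?K * (T / real Mt) powr (2*\<rho>) \<le> (sqrt ?K * (1 + ?s) * (T / real Mt) powr ((2*H + \<beta> - 1) / 2))\<^sup>2"
      by (simp only: \<rho>_def mult_1_right)
  qed
  finally show "(\<integral>\<^sup>+\<omega>. ennreal ((norm (X N (real m * (T / real Mt)) \<omega> - scheme e lam F \<Phi> w \<xi> T Mt N m \<omega>))\<^sup>2) \<partial>M) \<le>
      ennreal ((sqrt ?K * (1 + ?s) * (T / real Mt) powr ((2*H + \<beta> - 1) / 2))\<^sup>2)" .
qed

end

theorem mainTheorem5:
  fixes M :: "'b measure" and Fl :: "real \<Rightarrow> 'b measure"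
    and e :: "nat \<Rightarrow> 'a::{real_inner,complete_space}" and lam :: "nat \<Rightarrow> real"
    and F \<Phi> :: "'a \<Rightarrow> 'a" and L H \<beta> T :: real
    and w :: "nat \<Rightarrow> real \<Rightarrow> 'b \<Rightarrow> real" and \<xi> :: "'b \<Rightarrow> 'a"
    and X :: "nat \<Rightarrow> real \<Rightarrow> 'b \<Rightarrow> 'a"
  assumes prob: "prob_space M"
    and filt: "filtration (space M) Fl" and filt_sub: "\<forall>t. subalgebra M (Fl t)"
    and ortho: "\<forall>i j. e i \<bullet> e j = (if i = j then 1 else 0)"
    and complete: "\<forall>x. (\<lambda>i. (x \<bullet> e i) *\<^sub>R e i) sums x"
    and lam_pos: "0 < lam 0" and lam_mono: "mono lam"
    and lam_inf: "filterlim lam at_top sequentially"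
    and F_growth: "\<forall>u. norm (F u) \<le> L * (norm u + 1)"
    and F_lip: "\<forall>u v. norm (F u - F v) \<le> L * norm (u - v)"
    and H: "1/2 < H" "H < 1"
    and \<beta>: "1 - 2*H < \<beta>" "\<beta> \<le> 1"
    and T: "0 < T"
    and fbm: "\<forall>n. is_fbm M H (w n)"
    and indep: "prob_space.indep_vars M (\<lambda>_. Pi\<^sub>M UNIV (\<lambda>_. borel))
                  (\<lambda>n \<omega> t. w n t \<omega>) UNIV"
    and adapted: "\<forall>n t. 0 \<le> t \<longrightarrow> w n t \<in> borel_measurable (Fl t)"
    and \<Phi>_lin: "linear \<Phi>"
    and \<Phi>_HS: "(\<Sum>n. Vnorm2 e lam (\<beta> - 1) (\<Phi> (e n))) < \<infinity>"
    and \<xi>_meas: "\<xi> \<in> borel_measurable (Fl 0)"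
    and \<xi>_L2: "(\<integral>\<^sup>+\<omega>. Vnorm2 e lam (2*H + \<beta> - 1) (\<xi> \<omega>) \<partial>M) < \<infinity>"
    and mild: "\<forall>N. galerkin_mild M e lam F \<Phi> w \<xi> T N (X N)"
  shows "\<exists>C. \<forall>N Mt m. 1 \<le> Mt \<longrightarrow> m \<le> Mt \<longrightarrow>
     (\<integral>\<^sup>+\<omega>. ennreal ((norm (X N (real m * (T / real Mt)) \<omega>
                 - scheme e lam F \<Phi> w \<xi> T Mt N m \<omega>))\<^sup>2) \<partial>M)
     \<le> ennreal ((C * (1 + sqrt (enn2real (\<integral>\<^sup>+\<omega>. Vnorm2 e lam (2*H + \<beta> - 1) (\<xi> \<omega>) \<partial>M)))
         * (T / real Mt) powr ((2*H + \<beta> - 1) / 2))\<^sup>2)"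
proof -
  interpret prob_space M by (rule prob)
  interpret galerkin_setting M e lam F \<Phi> L H \<beta> T w \<xi> X
  proof unfold_locales
    show "\<xi> \<in> borel_measurable M"
      using measurable_from_subalg[OF filt_sub[rule_format] \<xi>_meas] .
  qed (use assms in auto)
  show ?thesis by (rule strong_convergence)
qed

end
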